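(* Let $n,d\ge 1$, let $\mathcal{G}=\{G_1,\dots,G_m\}\subseteq\mathcal{S}_n(\mathbb{R}[X])$ be a finite set, and let $G\subseteq\mathbb{R}[X]$ be a finite set such that $\mathbf{K}_{\mathcal{G}}=K_G$ and $(T_G)^n\subseteq\mathcal{T}_{\mathcal{G}}$. Let $\mathbf{F}\in\mathcal{S}_n(\mathbb{R}[X])$. Assume: (1) $\mathbf{K}_{\mathcal{G}}$ is compact; (2) $\mathbf{F}\succcurlyeq\mathbf{0}$ on $\mathbf{K}_{\mathcal{G}}$; (3) for each $\mathbf{x}\in\mathbb{R}^n\setminus\{0\}$, $\mathbf{x}^T\mathbf{F}\mathbf{x}$ has only finitely many zeros in $\mathbf{K}_{\mathcal{G}}$; (4) for each $\mathbf{x}\in\mathbb{R}^n\setminus\{0\}$ and for each zero $p$ of $\mathbf{x}^T\mathbf{F}\mathbf{x}$ in $\mathbf{K}_{\mathcal{G}}$, $\mathbf{x}^T\mathbf{F}\mathbf{x}$ belongs to $(\widehat{T_G})_p\subseteq\mathbb{R}[[X-p]]$. Then: (i) there exists a matrix $\mathbf{X}_-\in\mathcal{M}_n(\mathbb{R}[X])$ such that $\mathbf{X}_-\mathbf{F}\mathbf{X}_-^T\in(T_G)^n\subseteq\mathcal{T}_{\mathcal{G}}$; (ii) there exists a non-zero polynomial $b\in\mathbb{R}[X]$ such that $b^2\mathbf{F}\in(T_G)^n\subseteq\mathcal{T}_{\mathcal{G}}$.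
   Context: $\mathbb{R}[X]=\mathbb{R}[x_1,\dots,x_d]$. For a commutative unital ring $R$, $\mathcal{M}_n(R)$ is the ring of $n\times n$ matrices over $R$, $\mathcal{S}_n(R)$ its subset of symmetric matrices, $\mathbf{I}_n$ the identity matrix. A quadratic module in $\mathcal{M}_n(R)$ is a set $\mathcal{M}\subseteq\mathcal{S}_n(R)$ with $\mathbf{I}_n\in\mathcal{M}$, $\mathcal{M}+\mathcal{M}\subseteq\mathcal{M}$, and $A^T\mathcal{M}A\subseteq\mathcal{M}$ for all $A\in\mathcal{M}_n(R)$. A preordering in $\mathcal{M}_n(R)$ is a quadratic module $\mathcal{T}$ such that $\mathcal{T}\cap(R\cdot\mathbf{I}_n)$ is closed under multiplication. $\mathcal{T}_{\mathcal{G}}$ denotes the smallest preordering in $\mathcal{M}_n(\mathbb{R}[X])$ containing $\mathcal{G}$. A preordering of a commutative ring $R$ is a subset closed under addition and multiplication and containing all squares; $T_G$ denotes the smallest preordering of $\mathbb{R}[X]$ containing $G$. For $p\in\mathbb{R}^d$, $\mathbb{R}[[X-p]]$ is the ring of formal power series in $x_1-p_1,\dots,x_d-p_d$, in which $\mathbb{R}[X]$ embeds by Taylor expansion at $p$, and $(\widehat{T_G})_p$ is the preordering of $\mathbb{R}[[X-p]]$ generated by $G$. For a quadratic module $M\subseteq\mathbb{R}[X]$ (in particular $M=T_G$), $M^n$ denotes the set of all finite sums $\sum_i m_iA_i^TA_i$ with $m_i\in M$, $A_i\in\mathcal{M}_n(\mathbb{R}[X])$. $\mathbf{K}_{\mathcal{G}}=\{x\in\mathbb{R}^d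 : \mathbf{G}(x)\succcurlyeq\mathbf{0}\ \forall\,\mathbf{G}\in\mathcal{G}\}$ and $K_G=\{x\in\mathbb{R}^d: g(x)\ge 0\ \forall g\in G\}$. "$\succcurlyeq\mathbf 0$ on a set" means positive semidefinite at each point of the set. For constant $\mathbf{x}\in\mathbb{R}^n$, $\mathbf{x}^T\mathbf{F}\mathbf{x}$ is regarded as a polynomial in $\mathbb{R}[X]$. *)

theory Defs
  imports "HOL-Analysis.Analysis" "HOL-Library.Poly_Mapping"
begin

section \<open>Multivariate formal power series\<close>

text \<open>
  A power series in variables indexed by the finite type \<open>'v\<close> is the family of its coefficients,
  indexed by the exponents \<open>'v \<Rightarrow>\<^sub>0 nat\<close>; the product is the Cauchy product.
\<close>

typedef ('v, 'a) mfps = "UNIV :: (('v \<Rightarrow>\<^sub>0 nat) \<Rightarrow> 'a) set"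
  morphisms mfps_coeff Mfps
  by simp

lemma mfps_coeff_Mfps [simp]: "mfps_coeff (Mfps f) = f"
  by (simp add: Mfps_inverse)

lemma mfps_eqI: "(\<And>m. mfps_coeff f m = mfps_coeff g m) \<Longrightarrow> f = g"
  by (metis ext mfps_coeff_inject)

definition splittings :: "('v \<Rightarrow>\<^sub>0 nat) \<Rightarrow> (('v \<Rightarrow>\<^sub>0 nat) \<times> ('v \<Rightarrow>\<^sub>0 nat)) set" where
  "splittings m = {(k, l). k + l = m}"

lemma splittings_iff [simp]: "(k, l) \<in> splittings m \<longleftrightarrow> k + l = m"
  by (simp add: splittings_def)

lemma finite_splittings [simp]:
  fixes m :: "'v::finite \<Rightarrow>\<^sub>0 nat"
  shows "finite (splittings m)"
proof -
  define B where "B = {k::'v \<Rightarrow>\<^sub>0 nat. \<forall>i. Poly_Mapping.lookup k i \<le> Poly_Mapping.lookup m i}"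
  have "finite (PiE UNIV (\<lambda>i. {..Poly_Mapping.lookup m i}))"
    by (intro finite_PiE) auto
  moreover have "Poly_Mapping.lookup ` B \<subseteq> PiE UNIV (\<lambda>i. {..Poly_Mapping.lookup m i})"
    by (auto simp: B_def)
  ultimately have "finite (Poly_Mapping.lookup ` B)"
    by (rule rev_finite_subset)
  then have "finite B"
    by (rule finite_imageD) (auto intro: inj_onI poly_mapping_eqI)
  then have "finite (B \<times> B)" by simp
  moreover have "splittings m \<subseteq> B \<times> B"
    by (auto simp: B_def splittings_def lookup_add)
  ultimately show ?thesis by (rule rev_finite_subset)
qed

instantiation mfps :: (finite, comm_ring_1) comm_ring_1
begin

definition "0 = Mfps (\<lambda>m. 0)"
definition "1 = Mfps (\<lambda>m. if m = 0 then 1 else 0)"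
definition "f + g = Mfps (\<lambda>m. mfps_coeff f m + mfps_coeff g m)"
definition "f - g = Mfps (\<lambda>m. mfps_coeff f m - mfps_coeff g m)"
definition "- f = Mfps (\<lambda>m. - mfps_coeff f m)"
definition "f * g = Mfps (\<lambda>m. \<Sum>(k, l)\<in>splittings m. mfps_coeff f k * mfps_coeff g l)"

instance
proof
  fix f g h :: "('a, 'b) mfps"
  show "f * g * h = f * (g * h)"
  proof (rule mfps_eqI)
    fix m
    have "mfps_coeff (f * g * h) m =
      (\<Sum>(s, l)\<in>splittings m. \<Sum>(j, k)\<in>splittings s. mfps_coeff f j * mfps_coeff g k * mfps_coeff h l)"
      by (simp add: times_mfps_def sum_distrib_right case_prod_unfold)
    also have "\<dots> = (\<Sum>((s, l), (j, k))\<in>(SIGMA x:splittings m. splittings (fst x)).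
        mfps_coeff f j * mfps_coeff g k * mfps_coeff h l)"
      by (subst sum.Sigma[symmetric]) (auto simp: case_prod_unfold)
    also have "\<dots> = (\<Sum>((j, s), (k, l))\<in>(SIGMA x:splittings m. splittings (snd x)).
        mfps_coeff f j * (mfps_coeff g k * mfps_coeff h l))"
      by (rule sum.reindex_bij_witness
          [where j = "\<lambda>((s, l), (j, k)). ((j, k + l), (k, l))"
             and i = "\<lambda>((j, s), (k, l)). ((j + k, l), (j, k))"])
         (auto simp: add.assoc mult.assoc)
    also have "\<dots> = (\<Sum>(j, s)\<in>splittings m. \<Sum>(k, l)\<in>splittings s.
        mfps_coeff f j * (mfps_coeff g k * mfps_coeff h l))"
      by (subst sum.Sigma[symmetric]) (auto simp: case_prod_unfold)
    also have "\<dots> = mfps_coeff (f * (g * h)) m"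
      by (simp add: times_mfps_def sum_distrib_left case_prod_unfold)
    finally show "mfps_coeff (f * g * h) m = mfps_coeff (f * (g * h)) m" .
  qed
  show "f * g = g * f"
  proof (rule mfps_eqI)
    fix m
    show "mfps_coeff (f * g) m = mfps_coeff (g * f) m"
      unfolding times_mfps_def mfps_coeff_Mfps
      by (rule sum.reindex_bij_witness[where i = prod.swap and j = prod.swap])
         (auto simp: add.commute mult.commute)
  qed
  show "1 * f = f"
  proof (rule mfps_eqI)
    fix m
    have "mfps_coeff (1 * f) m = (\<Sum>(k, l)\<in>splittings m. (if k = 0 then 1 else 0) * mfps_coeff f l)"
      by (simp add: times_mfps_def one_mfps_def)
    also have "\<dots> = (\<Sum>x\<in>splittings m. if x = (0, m) then mfps_coeff f m else 0)"
      by (rule sum.cong) (auto simp: splittings_def split: if_splits)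
    finally show "mfps_coeff (1 * f) m = mfps_coeff f m" by simp
  qed
  show "(f + g) * h = f * h + g * h"
    by (rule mfps_eqI)
       (simp add: times_mfps_def plus_mfps_def case_prod_unfold algebra_simps sum.distrib)
  show "f + g + h = f + (g + h)" "f + g = g + f" "0 + f = f" "- f + f = 0" "f - g = f + - g"
    by (rule mfps_eqI, simp add: plus_mfps_def minus_mfps_def uminus_mfps_def zero_mfps_def)+
  have "mfps_coeff (0 :: ('a, 'b) mfps) 0 \<noteq> mfps_coeff 1 0"
    by (simp add: zero_mfps_def one_mfps_def)
  then show "(0 :: ('a, 'b) mfps) \<noteq> 1" by auto
qed

end

definition mfps_const :: "'a \<Rightarrow> ('v::finite, 'a::comm_ring_1) mfps" where
  "mfps_const c = Mfps (\<lambda>m. if m = 0 then c else 0)"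

definition mfps_var :: "'v \<Rightarrow> ('v::finite, 'a::comm_ring_1) mfps" where
  "mfps_var i = Mfps (\<lambda>m. if m = Poly_Mapping.single i 1 then 1 else 0)"


section \<open>Multivariate polynomials\<close>

type_synonym ('v, 'a) mpoly = "('v \<Rightarrow>\<^sub>0 nat) \<Rightarrow>\<^sub>0 'a"

definition mpoly_const :: "'a \<Rightarrow> ('v, 'a::zero) mpoly" where
  "mpoly_const c = Poly_Mapping.single 0 c"

text \<open>
  Substitution of \<open>v i\<close> for the \<open>i\<close>-th variable, where the coefficients are mapped into the
  target ring by \<open>\<phi>\<close>.
\<close>

definition mpoly_subst :: "('a \<Rightarrow> 'b) \<Rightarrow> ('v \<Rightarrow> 'b) \<Rightarrow> ('v::finite, 'a::zero) mpoly \<Rightarrow> 'b::comm_ring_1" where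
  "mpoly_subst \<phi> v f =
     (\<Sum>m\<in>Poly_Mapping.keys f. \<phi> (Poly_Mapping.lookup f m) * (\<Prod>i\<in>UNIV. v i ^ Poly_Mapping.lookup m i))"

definition mpoly_eval :: "real ^ 'd \<Rightarrow> ('d::finite, real) mpoly \<Rightarrow> real" where
  "mpoly_eval x f = mpoly_subst (\<lambda>c. c) (\<lambda>i. x $ i) f"

text \<open>
  An element of \<open>('d, real) mfps\<close> is read as a power series in the variables \<open>x\<^sub>i - p\<^sub>i\<close>, i.e.
  \<open>mfps_var i\<close> stands for \<open>x\<^sub>i - p\<^sub>i\<close>. Taylor expansion at \<open>p\<close> thus is the substitution
  \<open>x\<^sub>i = p\<^sub>i + (x\<^sub>i - p\<^sub>i)\<close>.
\<close>

definition taylor :: "real ^ 'd \<Rightarrow> ('d::finite, real) mpoly \<Rightarrow> ('d, real) mfps" where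
  "taylor p f = mpoly_subst mfps_const (\<lambda>i. mfps_const (p $ i) + mfps_var i) f"


section \<open>Preorderings\<close>

text \<open>
  The smallest preordering containing a set \<open>G\<close> is written \<open>ring_preordering hull G\<close>, and similarly
  for matrices.
\<close>

definition ring_preordering :: "'a::comm_ring_1 set \<Rightarrow> bool" where
  "ring_preordering T \<longleftrightarrow>
     (\<forall>a\<in>T. \<forall>b\<in>T. a + b \<in> T) \<and> (\<forall>a\<in>T. \<forall>b\<in>T. a * b \<in> T) \<and> (\<forall>a. a\<^sup>2 \<in> T)"

definition symmetric_matrices :: "('a ^ 'n ^ 'n) set" where
  "symmetric_matrices = {A. transpose A = A}"

definition matrix_quadratic_module :: "('a::comm_ring_1 ^ 'n ^ 'n) set \<Rightarrow> bool" where
  "matrix_quadratic_module M \<longleftrightarrow>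
     M \<subseteq> symmetric_matrices \<and> mat 1 \<in> M \<and> (\<forall>A\<in>M. \<forall>B\<in>M. A + B \<in> M) \<and>
     (\<forall>A. \<forall>B\<in>M. transpose A ** B ** A \<in> M)"

text \<open>The scalar matrices \<open>R \<cdot> I\<^sub>n\<close> form the set \<open>range mat\<close>.\<close>

definition matrix_preordering :: "('a::comm_ring_1 ^ 'n ^ 'n) set \<Rightarrow> bool" where
  "matrix_preordering T \<longleftrightarrow>
     matrix_quadratic_module T \<and>
     (\<forall>A \<in> T \<inter> range mat. \<forall>B \<in> T \<inter> range mat. A ** B \<in> T \<inter> range mat)"

lemma ring_preordering_hull: "ring_preordering (ring_preordering hull (G :: 'a::comm_ring_1 set))"
proof (rule hull_in)
  fix \<T> :: "'a set set"
  assume "Ball \<T> ring_preordering"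
  then show "ring_preordering (\<Inter>\<T>)"
    by (simp add: ring_preordering_def)
qed

lemma mat_mult_mat: "mat a ** mat b = (mat (a * b) :: 'a::comm_ring_1 ^ 'n ^ 'n)"
  by (simp add: matrix_matrix_mult_def mat_def vec_eq_iff if_distrib [of "\<lambda>x. x * y" for y]
      cong: if_cong)

lemma matrix_preordering_symmetric_matrices:
  "matrix_preordering (symmetric_matrices :: ('a::comm_ring_1 ^ 'n ^ 'n) set)"
proof -
  have "transpose (A + B) = transpose A + transpose B" for A B :: "'a ^ 'n ^ 'n"
    by (simp add: transpose_def vec_eq_iff)
  then show ?thesis
    by (auto simp: matrix_preordering_def matrix_quadratic_module_def symmetric_matrices_def
        matrix_transpose_mul matrix_mul_assoc mat_mult_mat mult.commute)
qed

lemma matrix_preordering_hull: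
  assumes "\<G> \<subseteq> symmetric_matrices"
  shows "matrix_preordering (matrix_preordering hull \<G>)"
proof -
  let ?T = "matrix_preordering hull \<G>"
  have in_hull: "A \<in> ?T" if "\<And>T. matrix_preordering T \<Longrightarrow> \<G> \<subseteq> T \<Longrightarrow> A \<in> T" for A
    using that by (simp add: hull_def)
  have hull_in: "A \<in> T" if "A \<in> ?T" "matrix_preordering T" "\<G> \<subseteq> T" for A T
    using hull_minimal[of \<G> T matrix_preordering] that by blast
  have "?T \<subseteq> symmetric_matrices"
    using hull_in assms matrix_preordering_symmetric_matrices by blast
  moreover have "mat 1 \<in> ?T"
    by (rule in_hull) (simp add: matrix_preordering_def matrix_quadratic_module_def)
  moreover have "A + B \<in> ?T" if "A \<in> ?T" "B \<in> ?T" for A B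
    by (rule in_hull)
       (use that hull_in in \<open>simp add: matrix_preordering_def matrix_quadratic_module_def\<close>)
  moreover have "transpose A ** B ** A \<in> ?T" if "B \<in> ?T" for A B
    by (rule in_hull)
       (use that hull_in in \<open>simp add: matrix_preordering_def matrix_quadratic_module_def\<close>)
  moreover have "A ** B \<in> ?T \<inter> range mat" if "A \<in> ?T \<inter> range mat" "B \<in> ?T \<inter> range mat" for A B
  proof
    show "A ** B \<in> ?T"
      by (rule in_hull) (use that hull_in in \<open>simp add: matrix_preordering_def\<close>)
    show "A ** B \<in> range mat"
      using that by (auto simp: mat_mult_mat)
  qed
  ultimately show ?thesis
    unfolding matrix_preordering_def matrix_quadratic_module_def by simp
qed

definition matrix_module :: "'a::comm_ring_1 set \<Rightarrow> ('a ^ 'n ^ 'n) set" where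
  "matrix_module M =
     {\<Sum>i<k. map_matrix ((*) (m i)) (transpose (A i) ** A i) | (k::nat) m (A :: nat \<Rightarrow> 'a ^ 'n ^ 'n). \<forall>i<k. m i \<in> M}"


section \<open>Positivity sets\<close>

definition psd :: "real ^ 'n ^ 'n \<Rightarrow> bool" where
  "psd A \<longleftrightarrow> transpose A = A \<and> (\<forall>v. v \<bullet> (A *v v) \<ge> 0)"

definition matrix_eval :: "real ^ 'd \<Rightarrow> ('d::finite, real) mpoly ^ 'n ^ 'n \<Rightarrow> real ^ 'n ^ 'n" where
  "matrix_eval x F = map_matrix (mpoly_eval x) F"

definition matrix_nonneg_set :: "(('d::finite, real) mpoly ^ 'n ^ 'n) set \<Rightarrow> (real ^ 'd) set" where
  "matrix_nonneg_set \<G> = {x. \<forall>H\<in>\<G>. psd (matrix_eval x H)}"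

definition nonneg_set :: "('d::finite, real) mpoly set \<Rightarrow> (real ^ 'd) set" where
  "nonneg_set G = {x. \<forall>g\<in>G. mpoly_eval x g \<ge> 0}"

definition quadratic_form ::
    "real ^ 'n \<Rightarrow> ('d::finite, real) mpoly ^ 'n ^ 'n \<Rightarrow> ('d, real) mpoly" where
  "quadratic_form v F =
     scalar_product (\<chi> i. mpoly_const (v $ i)) (F *v (\<chi> i. mpoly_const (v $ i)))"

end

theory Submission
  imports Defs "HOL-Algebra.Algebraic_Closure_Type" "HOL-Computational_Algebra.Polynomial_Factorial"
begin

text \<open>
  Symmetric elimination reduces part (ii) to scalars: if \<open>f \<ge> 0\<close> on \<open>K\<^sub>G\<close>, then \<open>c\<^sup>2 f \<in> T\<^sub>G\<close> for some \<open>c \<noteq> 0\<close>. Part (i) follows with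
  \<open>X = b I\<close>. The scalar statement is dual to the Artin-Lang theorem: if no \<open>- b\<^sup>2\<close> with \<open>b \<noteq> 0\<close> lies in the
  preordering generated by \<open>G \<union> {- f}\<close>, then the preordering extends to an ordering of a real closed
  field containing the polynomials, in which the generic point satisfies all the strict inequalities; these
  transfer to the reals.

  The real closed field is obtained from a maximal preordered subfield of an algebraic closure.
  There the intermediate value property for polynomials follows directly from maximality. The transfer
  eliminates one variable at a time, in the manner of Cohen and Hoermander: the order type of the zeros of
  finitely many polynomials in one variable, together with their signs, is determined by the signs of
  finitely many expressions in the coefficients.
\<close>

hide_const (open) Polynomials.degree Polynomials.lead_coeff up_ring.coeff up_ring.monom Coset.order
  module.smult
no_notation Polynomials.var (\<open>X\<index>\<close>)
no_notation fps_nth (infixl \<open>$\<close> 75)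

section \<open>Polynomials over real closed fields\<close>

text \<open>All candidate ordered fields are subsets of one algebraically closed field, and a
  candidate is only a set \<open>P\<close> of would-be nonnegative elements; its field is recovered
  as \<open>differences P\<close>. A single maximal choice then settles two questions: the order is
  total, because a missing sign could be added to \<open>P\<close>, and the field is real closed,
  because a missing root could be adjoined, with \<open>P\<close> extended by weighted sums of
  squares.

  The transfer is simpler than full quantifier elimination, since one of the two points compared is
  generic: the map \<open>\<phi>\<close> kills no nonzero polynomial, so leading coefficients never
  vanish on its side and no case distinction on degrees arises. Equal signs of finitely many
  coefficients carry this over to the real side.

  Denominators enter as squares. In the field of fractions the generated preordering consists of
  quotients \<open>t / b^2\<close>, so its failure to be proper is an identity
  \<open>- b^2 = t\<close> between polynomials. The squared denominator of part (ii) originates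
  there.\<close>

class real_closed_field = linordered_field +
  assumes sum_IVT: "a < b \<Longrightarrow> (\<Sum>k\<le>n. f k * a ^ k) < 0 \<Longrightarrow> 0 < (\<Sum>k\<le>n. f k * b ^ k) \<Longrightarrow>
    \<exists>x. a < x \<and> x < b \<and> (\<Sum>k\<le>n. f k * x ^ k) = 0"

text \<open>The class axiom in polynomial form. The axiom itself uses finite sums, so that it
  involves only the operations of an ordered field.\<close>

lemma poly_IVT:
  fixes p :: "'a::real_closed_field poly"
  assumes "a < b" "poly p a < 0" "0 < poly p b"
  shows "\<exists>x. a < x \<and> x < b \<and> poly p x = 0"
  using sum_IVT[of a b "coeff p" "degree p"] assms by (simp add: poly_altdef)

instance real :: real_closed_field
proof
  fix a b :: real and f n
  define p where "p = (\<Sum>k\<le>n. monom (f k :: real) k)"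
  have p: "(\<Sum>k\<le>n. f k * x ^ k) = poly p x" for x
    by (simp add: p_def poly_sum poly_monom)
  assume "a < b" "(\<Sum>k\<le>n. f k * a ^ k) < 0" "0 < (\<Sum>k\<le>n. f k * b ^ k)"
  then show "\<exists>x. a < x \<and> x < b \<and> (\<Sum>k\<le>n. f k * x ^ k) = 0"
    unfolding p by (rule poly_IVT_pos)
qed

text \<open>Integer valued, so that signs taken in two different ordered fields can be compared by
  an equation.\<close>

definition sg :: "'a::linordered_idom \<Rightarrow> int" where
  "sg x = (if x = 0 then 0 else if x > 0 then 1 else - 1)"

lemma sg_0 [simp]: "sg 0 = 0"
  by (simp add: sg_def)

lemma sg_minus [simp]: "sg (- x) = - sg x"
  by (auto simp: sg_def)

lemma sg_eq_0 [simp]: "sg x = 0 \<longleftrightarrow> x = 0"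
  by (auto simp: sg_def)

lemma sg_eq_cong:
  assumes "sg x = sg y"
  shows "x = 0 \<longleftrightarrow> y = 0" "0 < x \<longleftrightarrow> 0 < y" "x < 0 \<longleftrightarrow> y < 0"
  using assms by (auto simp: sg_def split: if_splits)

section \<open>Sign changes, Rolle's theorem and the mean value theorem\<close>

lemma poly_root_between:
  fixes p :: "'a::real_closed_field poly"
  assumes "a < b" "poly p a * poly p b < 0"
  obtains x where "a < x" "x < b" "poly p x = 0"
proof (cases "poly p a < 0")
  case True
  then have "0 < poly p b" using assms(2) by (simp add: mult_less_0_iff)
  with True assms(1) that show ?thesis using poly_IVT by blast
next
  case False
  then have "poly (- p) a < 0" "0 < poly (- p) b" using assms(2) by (auto simp: mult_less_0_iff)
  from poly_IVT[OF assms(1) this] that show ?thesis by auto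
qed

lemma poly_sg_const:
  fixes p :: "'a::real_closed_field poly"
  assumes nz: "\<And>x. u \<le> x \<Longrightarrow> x \<le> v \<Longrightarrow> poly p x \<noteq> 0" and "u \<le> v"
  shows "sg (poly p u) = sg (poly p v)"
proof (rule ccontr)
  assume neq: "sg (poly p u) \<noteq> sg (poly p v)"
  then have "u < v" using \<open>u \<le> v\<close> by (cases "u = v") auto
  moreover have "poly p u * poly p v < 0"
    using neq nz[of u] nz[of v] \<open>u \<le> v\<close> by (auto simp: sg_def mult_less_0_iff split: if_splits)
  ultimately obtain x where "u < x" "x < v" "poly p x = 0" by (rule poly_root_between)
  then show False using nz[of x] by simp
qed

lemma poly_sg_const_open:
  fixes p :: "'a::real_closed_field poly"
  assumes nz: "\<And>x. a < x \<Longrightarrow> x < b \<Longrightarrow> poly p x \<noteq> 0" and "a < u" "u < b" "a < v" "v < b"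
  shows "sg (poly p u) = sg (poly p v)"
proof (cases "u \<le> v")
  case True
  then show ?thesis using assms by (intro poly_sg_const) auto
next
  case False
  then show ?thesis using assms by (intro poly_sg_const[symmetric]) auto
qed

text \<open>
  After splitting off the two zeros, the remaining factor of the derivative takes values of
  opposite sign at them.
\<close>

lemma poly_Rolle_adjacent:
  fixes p :: "'a::real_closed_field poly"
  assumes "p \<noteq> 0" "a < b" "poly p a = 0" "poly p b = 0"
    and nz: "\<And>x. a < x \<Longrightarrow> x < b \<Longrightarrow> poly p x \<noteq> 0"
  obtains x where "a < x" "x < b" "poly (pderiv p) x = 0"
proof -
  obtain q0 k where q0: "p = [:- a, 1:] ^ k * q0" "\<not> [:- a, 1:] dvd q0" "k = order a p"
    using order_decomp[OF \<open>p \<noteq> 0\<close>] by blast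
  have "k \<noteq> 0" using q0(3) assms(1,3) by (simp add: order_root)
  then obtain m where m: "k = Suc m" using not0_implies_Suc by blast
  have q0nz: "q0 \<noteq> 0" "poly q0 a \<noteq> 0" using q0(2) by (auto simp: poly_eq_0_iff_dvd)
  have "poly p b = (b - a) ^ k * poly q0 b" unfolding q0(1) by simp
  then have "poly q0 b = 0" using assms(2,4) by simp
  obtain q l where q: "q0 = [:- b, 1:] ^ l * q" "\<not> [:- b, 1:] dvd q" "l = order b q0"
    using order_decomp[OF q0nz(1)] by blast
  have "l \<noteq> 0" using q(3) \<open>poly q0 b = 0\<close> q0nz(1) by (simp add: order_root)
  then obtain n where n: "l = Suc n" using not0_implies_Suc by blast
  define A B where "A = [:- a, 1:]" and "B = [:- b, 1:]"
  have p: "p = A ^ Suc m * (B ^ Suc n * q)"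
    using q0(1) q(1) unfolding m n A_def B_def by simp
  have qb: "poly q b \<noteq> 0" using q(2) by (auto simp: poly_eq_0_iff_dvd)
  have qa: "poly q a \<noteq> 0" using q0nz(2) unfolding q(1) by simp
  have qnz: "poly q x \<noteq> 0" if "a \<le> x" "x \<le> b" for x
  proof (cases "x = a \<or> x = b")
    case True
    then show ?thesis using qa qb by blast
  next
    case False
    then have "poly p x \<noteq> 0" using nz that by auto
    then show ?thesis unfolding p by auto
  qed
  have dA: "pderiv A = 1" and dB: "pderiv B = 1"
    by (simp_all add: A_def B_def pderiv_pCons one_pCons)
  \<comment> \<open>By the product rule the derivative is \<open>A ^ m * B ^ n * r\<close>. At
    \<open>a\<close> only the first summand of \<open>r\<close> survives, at \<open>b\<close> only
    the second. They carry the factors \<open>a - b\<close> and \<open>b - a\<close>, while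
    \<open>q\<close> has the same sign at both ends, having no zero on the closed interval.\<close>
  define r where "r = of_nat (Suc m) * (B * q) + of_nat (Suc n) * (A * q) + A * B * pderiv q"
  have "pderiv p = A ^ m * B ^ n * r"
    unfolding p pderiv_mult pderiv_power_Suc dA dB r_def
    by (simp add: of_nat_poly algebra_simps smult_add_left)
  moreover have "poly r a * poly r b < 0"
  proof -
    have AB: "poly A a = 0" "poly A b = b - a" "poly B a = a - b" "poly B b = 0"
      by (simp_all add: A_def B_def)
    have ra: "poly r a = of_nat (Suc m) * ((a - b) * poly q a)"
      by (simp add: r_def AB)
    have rb: "poly r b = of_nat (Suc n) * ((b - a) * poly q b)"
      by (simp add: r_def AB)
    have pos: "0 < poly q a * poly q b"
    proof -
      have "sg (poly q a) = sg (poly q b)"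
        using qnz assms(2) by (intro poly_sg_const) auto
      with qa qb show ?thesis by (auto simp: sg_def zero_less_mult_iff split: if_splits)
    qed
    have "poly r a * poly r b
        = - (of_nat (Suc m) * of_nat (Suc n) * (b - a)\<^sup>2 * (poly q a * poly q b))"
      unfolding ra rb by (simp add: power2_eq_square algebra_simps del: of_nat_Suc)
    also have "\<dots> < 0"
      using pos assms(2)
      by (simp del: of_nat_Suc) 
    finally show ?thesis .
  qed
  then obtain x where "a < x" "x < b" "poly r x = 0"
    using poly_root_between[OF assms(2)] by blast
  ultimately show ?thesis using that by simp
qed

lemma poly_Rolle:
  fixes p :: "'a::real_closed_field poly"
  assumes "a < b" "poly p a = 0" "poly p b = 0"
  obtains x where "a < x" "x < b" "poly (pderiv p) x = 0"
proof (cases "p = 0")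
  case True
  with assms(1) that[of "(a + b) / 2"] show ?thesis by simp
next
  case False
  \<comment> \<open>No zero separates \<open>a\<close> from the nearest zero on its right, so the
    adjacent case applies to these two. The point \<open>b\<close> ensures that there is such a
    zero.\<close>
  define R where "R = {x. poly p x = 0} \<inter> {a<..b}"
  have R: "finite R" "b \<in> R" using False assms by (auto simp: R_def poly_roots_finite)
  define c where "c = Min R"
  have "c \<in> R" unfolding c_def by (rule Min_in) (use R in auto)
  then have c: "a < c" "c \<le> b" "poly p c = 0" by (auto simp: R_def)
  have "poly p x \<noteq> 0" if "a < x" "x < c" for x
  proof
    assume "poly p x = 0"
    then have "x \<in> R" using that c by (simp add: R_def)
    then have "c \<le> x" using R by (simp add: c_def)
    with that show False by simp
  qed
  then obtain x where "a < x" "x < c" "poly (pderiv p) x = 0"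
    using poly_Rolle_adjacent[OF False c(1) assms(2) c(3)] by blast
  with c that show ?thesis by simp
qed

lemma poly_mean_value:
  fixes p :: "'a::real_closed_field poly"
  assumes "a < b"
  obtains x where "a < x" "x < b" "poly p b - poly p a = (b - a) * poly (pderiv p) x"
proof -
  define s where "s = (poly p b - poly p a) / (b - a)"
  define q where "q = p - [:poly p a - s * a, s:]"
  have s: "s * (b - a) = poly p b - poly p a" using assms by (simp add: s_def)
  have "poly q a = 0" "poly q b = 0"
    using s by (simp_all add: q_def algebra_simps)
  then obtain x where "a < x" "x < b" "poly (pderiv q) x = 0"
    using poly_Rolle[OF assms] by blast
  moreover have "pderiv q = pderiv p - [:s:]"
    by (simp add: q_def pderiv_diff pderiv_pCons)
  ultimately show ?thesis using that[of x] s by (simp add: algebra_simps)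
qed

lemma poly_strict_mono:
  fixes p :: "'a::real_closed_field poly"
  assumes "\<And>x. a < x \<Longrightarrow> x < b \<Longrightarrow> 0 < poly (pderiv p) x" "a \<le> x" "x < y" "y \<le> b"
  shows "poly p x < poly p y"
proof -
  obtain z where z: "x < z" "z < y" "poly p y - poly p x = (y - x) * poly (pderiv p) z"
    using poly_mean_value[OF \<open>x < y\<close>] by blast
  then have "0 < poly (pderiv p) z" using assms by auto
  then have "0 < poly p y - poly p x" using z assms by simp
  then show ?thesis by simp
qed

text \<open>By strict monotonicity the signs at the ends decide which signs occur strictly inside:
  only positive after a nonnegative start, only negative before a nonpositive end, and all three
  otherwise. The second polynomial has the same end signs, so it takes inside every sign that the
  first one takes there.\<close>

lemma poly_cell_lift_increasing:
  fixes p :: "'a::real_closed_field poly" and q :: "'b::real_closed_field poly"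
  assumes p': "\<And>x. a < x \<Longrightarrow> x < b \<Longrightarrow> 0 < poly (pderiv p) x"
    and q': "\<And>y. c < y \<Longrightarrow> y < d \<Longrightarrow> 0 < poly (pderiv q) y"
    and ends: "sg (poly p a) = sg (poly q c)" "sg (poly p b) = sg (poly q d)"
    and z: "a < z" "z < b" and "c < d"
  obtains y where "c < y" "y < d" "sg (poly p z) = sg (poly q y)"
proof -
  note mp = poly_strict_mono[where p = p and a = a and b = b, OF p']
  note mq = poly_strict_mono[where p = q and a = c and b = d, OF q']
  have mid: "c < (c + d) / 2" "(c + d) / 2 < d" using \<open>c < d\<close> by simp_all
  consider "0 \<le> poly p a" | "poly p b \<le> 0" | "poly p a < 0" "0 < poly p b" by linarith
  then show ?thesis
  proof cases
    case 1
    then have "0 < poly p z" using mp[of a z] z by simp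
    moreover have "0 \<le> poly q c" using 1 sg_eq_cong(3)[OF ends(1)] by simp
    then have "0 < poly q ((c + d) / 2)" using mq[of c "(c + d) / 2"] mid by simp
    ultimately show ?thesis using that[OF mid] by (simp add: sg_def)
  next
    case 2
    then have "poly p z < 0" using mp[of z b] z by simp
    moreover have "poly q d \<le> 0" using 2 sg_eq_cong(2)[OF ends(2)] by (simp add: not_less[symmetric])
    then have "poly q ((c + d) / 2) < 0" using mq[of "(c + d) / 2" d] mid by simp
    ultimately show ?thesis using that[OF mid] by (simp add: sg_def)
  next
    case 3
    then have "poly q c < 0" "0 < poly q d"
      using sg_eq_cong(3)[OF ends(1)] sg_eq_cong(2)[OF ends(2)] by auto
    then obtain w where w: "c < w" "w < d" "poly q w = 0"
      using poly_IVT[OF \<open>c < d\<close>] by blast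
    have "poly q ((c + w) / 2) < 0" using mq[of "(c + w) / 2" w] w by simp
    moreover have "0 < poly q ((w + d) / 2)" using mq[of w "(w + d) / 2"] w by simp
    moreover have "c < (c + w) / 2" "(c + w) / 2 < d" "c < (w + d) / 2" "(w + d) / 2 < d"
      using w by (simp_all add: field_simps)
    ultimately show ?thesis
      using that[of w] that[of "(c + w) / 2"] that[of "(w + d) / 2"] w
      by (cases "poly p z" "0::'a" rule: linorder_cases) (auto simp: sg_def)
  qed
qed

text \<open>On a cell free of its zeros the derivative keeps one sign. The decreasing case is
  reduced to the increasing one by negating both polynomials.\<close>

lemma poly_cell_lift:
  fixes p :: "'a::real_closed_field poly" and q :: "'b::real_closed_field poly"
  assumes p': "\<And>x. a < x \<Longrightarrow> x < b \<Longrightarrow> poly (pderiv p) x \<noteq> 0"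
    and q': "\<And>y. c < y \<Longrightarrow> y < d \<Longrightarrow> sg (poly (pderiv q) y) = sg (poly (pderiv p) z)"
    and ends: "sg (poly p a) = sg (poly q c)" "sg (poly p b) = sg (poly q d)"
    and z: "a < z" "z < b" and "c < d"
  obtains y where "c < y" "y < d" "sg (poly p z) = sg (poly q y)"
proof -
  have const: "sg (poly (pderiv p) x) = sg (poly (pderiv p) z)" if "a < x" "x < b" for x
    by (rule poly_sg_const_open[where a = a and b = b]) (use p' that z in auto)
  show ?thesis
  proof (cases "0 < poly (pderiv p) z")
    case True
    have "0 < poly (pderiv p) x" if "a < x" "x < b" for x
      using sg_eq_cong(2)[OF const[OF that]] True by blast
    moreover have "0 < poly (pderiv q) y" if "c < y" "y < d" for y
      using sg_eq_cong(2)[OF q'[OF that]] True by blast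
    ultimately show ?thesis
      using poly_cell_lift_increasing[OF _ _ ends z \<open>c < d\<close>] that by blast
  next
    case False
    then have neg: "poly (pderiv p) z < 0" using p'[of z] z by (simp add: not_less_iff_gr_or_eq)
    have "0 < poly (pderiv (- p)) x" if "a < x" "x < b" for x
      using sg_eq_cong(3)[OF const[OF that]] neg by (simp add: pderiv_minus)
    moreover have "0 < poly (pderiv (- q)) y" if "c < y" "y < d" for y
      using sg_eq_cong(3)[OF q'[OF that]] neg by (simp add: pderiv_minus)
    moreover have "sg (poly (- p) a) = sg (poly (- q) c)" "sg (poly (- p) b) = sg (poly (- q) d)"
      using ends by simp_all
    ultimately obtain y where "c < y" "y < d" "sg (poly (- p) z) = sg (poly (- q) y)"
      using poly_cell_lift_increasing[OF _ _ _ _ z \<open>c < d\<close>] by blast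
    then show ?thesis using that by simp
  qed
qed

section \<open>Signs near the two infinities\<close>

lemma poly_at_top_bound:
  fixes p :: "'a::linordered_field poly"
  assumes "p \<noteq> 0"
  shows "\<exists>N e. 0 < e \<and> (\<forall>x\<ge>N. e \<le> of_int (sg (lead_coeff p)) * poly p x)"
  using assms
proof (induction p)
  case 0
  then show ?case by simp
next
  case (pCons a p)
  show ?case
  proof (cases "p = 0")
    case True
    with pCons have "a \<noteq> 0" by simp
    then show ?thesis using True by (intro exI[of _ 0] exI[of _ "\<bar>a\<bar>"]) (auto simp: sg_def)
  next
    case False
    then obtain N e where e: "0 < e" "\<And>x. N \<le> x \<Longrightarrow> e \<le> of_int (sg (lead_coeff p)) * poly p x"
      using pCons.IH by blast
    define s :: 'a where "s = of_int (sg (lead_coeff p))"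
    have s: "\<bar>s\<bar> \<le> 1" by (simp add: s_def sg_def)
    \<comment> \<open>The induction carries a lower bound \<open>e\<close> and not mere positivity,
      because \<open>x\<close> times the value of \<open>p\<close> must absorb the new constant
      coefficient. From \<open>1 + \<bar>a\<bar> / e \<le> x\<close> one gets
      \<open>e \<le> x * e - \<bar>a\<bar>\<close>, so the same \<open>e\<close> works
      again.\<close>
    define N' where "N' = max (max N 0) (1 + \<bar>a\<bar> / e)"
    have "e \<le> s * poly (pCons a p) x" if "N' \<le> x" for x
    proof -
      have x: "N \<le> x" "0 \<le> x" "1 + \<bar>a\<bar> / e \<le> x" using that by (auto simp: N'_def)
      have "e \<le> (x - \<bar>a\<bar> / e) * e" using x(3) e(1) by simp
      also have "\<dots> = x * e - \<bar>a\<bar>" using e(1) by (simp add: field_simps)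
      also have "\<dots> \<le> x * (s * poly p x) - \<bar>s * a\<bar>"
        using mult_left_mono[OF e(2)[OF x(1)] x(2)] s
        by (intro diff_mono) (auto simp: s_def abs_mult mult_left_le_one_le)
      also have "\<dots> \<le> s * poly (pCons a p) x" by (simp add: algebra_simps)
      finally show ?thesis .
    qed
    then show ?thesis using e(1) False by (auto simp: s_def)
  qed
qed

lemma poly_sg_at_top:
  fixes p :: "'a::linordered_field poly"
  assumes "p \<noteq> 0"
  shows "\<exists>N. \<forall>x\<ge>N. sg (poly p x) = sg (lead_coeff p)"
proof -
  obtain N e where e: "0 < e" "\<And>x. N \<le> x \<Longrightarrow> e \<le> of_int (sg (lead_coeff p)) * poly p x"
    using poly_at_top_bound[OF assms] by blast
  have "sg (poly p x) = sg (lead_coeff p)" if "N \<le> x" for x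
  proof -
    have "0 < of_int (sg (lead_coeff p)) * poly p x" using e that by (meson less_le_trans)
    then show ?thesis by (auto simp: sg_def split: if_splits)
  qed
  then show ?thesis by blast
qed

lemma poly_sg_at_bot:
  fixes p :: "'a::linordered_field poly"
  assumes "p \<noteq> 0"
  shows "\<exists>N. \<forall>x\<ge>N. sg (poly p (- x)) = (- 1) ^ degree p * sg (lead_coeff p)"
proof -
  define q where "q = p \<circ>\<^sub>p [:0, - 1:]"
  have "q \<noteq> 0" using assms by (simp add: q_def pcompose_eq_0_iff)
  have "lead_coeff q = (- 1) ^ degree p * lead_coeff p"
    unfolding q_def by (subst lead_coeff_comp) auto
  moreover have "sg ((- 1) ^ n * x) = (- 1) ^ n * sg x" for n and x :: 'a
    by (induction n) auto
  ultimately show ?thesis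
    using poly_sg_at_top[OF \<open>q \<noteq> 0\<close>] by (simp add: q_def poly_pcompose)
qed

section \<open>Transfer of sign conditions between real closed fields\<close>

definition ring_map :: "('r::comm_ring_1 \<Rightarrow> 'a::comm_ring_1) \<Rightarrow> bool" where
  "ring_map \<phi> \<longleftrightarrow> \<phi> 1 = 1 \<and> (\<forall>x y. \<phi> (x + y) = \<phi> x + \<phi> y) \<and> (\<forall>x y. \<phi> (x * y) = \<phi> x * \<phi> y)"

lemma ring_mapD:
  assumes "ring_map \<phi>"
  shows "\<phi> 1 = 1" "\<phi> (x + y) = \<phi> x + \<phi> y" "\<phi> (x * y) = \<phi> x * \<phi> y"
    "\<phi> 0 = 0" "\<phi> (- x) = - \<phi> x" "\<phi> (x - y) = \<phi> x - \<phi> y" "\<phi> (x ^ n) = \<phi> x ^ n"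
    "\<phi> (of_nat n) = of_nat n" "\<phi> (sum g A) = (\<Sum>i\<in>A. \<phi> (g i))"
proof -
  show 1: "\<phi> 1 = 1" and add: "\<And>x y. \<phi> (x + y) = \<phi> x + \<phi> y"
    and mult: "\<And>x y. \<phi> (x * y) = \<phi> x * \<phi> y"
    using assms by (auto simp: ring_map_def)
  show 0: "\<phi> 0 = 0" using add[of 0 0] by simp
  show neg: "\<phi> (- x) = - \<phi> x" for x
    using add[of x "- x"] 0 by (simp add: add_eq_0_iff)
  show "\<phi> (x - y) = \<phi> x - \<phi> y" using add[of x "- y"] neg by simp
  show "\<phi> (x ^ n) = \<phi> x ^ n" by (induction n) (simp_all add: 1 mult)
  show "\<phi> (of_nat n) = of_nat n" by (induction n) (simp_all add: 0 1 add)
  show "\<phi> (sum g A) = (\<Sum>i\<in>A. \<phi> (g i))"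
    by (induction A rule: infinite_finite_induct) (simp_all add: 0 add)
qed

text \<open>\<^const>\<open>pderiv\<close> is restricted to rings without zero divisors.\<close>

definition formal_deriv :: "'r::comm_ring_1 poly \<Rightarrow> 'r poly" where
  "formal_deriv p = (\<Sum>i<degree p. monom (of_nat (Suc i) * coeff p (Suc i)) i)"

lemma coeff_formal_deriv: "coeff (formal_deriv p) n = of_nat (Suc n) * coeff p (Suc n)"
proof -
  have "coeff (formal_deriv p) n = (\<Sum>i<degree p. if i = n then of_nat (Suc i) * coeff p (Suc i) else 0)"
    unfolding formal_deriv_def coeff_sum by (rule sum.cong) (simp_all add: monom.rep_eq)
  also have "\<dots> = of_nat (Suc n) * coeff p (Suc n)"
    by (cases "n < degree p") (simp_all add: coeff_eq_0)
  finally show ?thesis .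
qed

lemma map_poly_ring_map:
  assumes "ring_map \<phi>"
  shows "map_poly \<phi> (p + q) = map_poly \<phi> p + map_poly \<phi> q"
    "map_poly \<phi> (p * q) = map_poly \<phi> p * map_poly \<phi> q"
    "map_poly \<phi> (smult c p) = smult (\<phi> c) (map_poly \<phi> p)"
  by (rule poly_eqI; simp add: coeff_map_poly ring_mapD[OF assms] coeff_mult)+

lemma map_poly_formal_deriv:
  fixes \<phi> :: "'r::comm_ring_1 \<Rightarrow> 'a::idom"
  assumes "ring_map \<phi>"
  shows "map_poly \<phi> (formal_deriv p) = pderiv (map_poly \<phi> p)"
  by (rule poly_eqI)
     (simp add: coeff_map_poly ring_mapD[OF assms] coeff_formal_deriv coeff_pderiv del: of_nat_Suc)

lemma poly_map_poly_ring_map: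
  assumes "ring_map \<phi>"
  shows "poly (map_poly \<phi> p) (\<phi> x) = \<phi> (poly p x)"
  by (induction p) (simp_all add: map_poly_pCons ring_mapD[OF assms])

lemma lead_coeff_map_poly:
  assumes "ring_map \<phi>" "\<phi> (lead_coeff p) \<noteq> 0"
  shows "degree (map_poly \<phi> p) = degree p" "lead_coeff (map_poly \<phi> p) = \<phi> (lead_coeff p)"
    "map_poly \<phi> p \<noteq> 0"
proof -
  show deg: "degree (map_poly \<phi> p) = degree p"
    using assms by (intro map_poly_degree_eq) auto
  show lc: "lead_coeff (map_poly \<phi> p) = \<phi> (lead_coeff p)"
    by (simp only: deg) (simp add: coeff_map_poly ring_mapD[OF assms(1)])
  show "map_poly \<phi> p \<noteq> 0" using lc assms(2) by auto
qed

text \<open>One half of having the same sign diagram, in back-and-forth style: finitely many points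
  on one line have an increasing copy on the other line with the same signs. Since \<open>Z\<close>
  is arbitrary, it can hold zeros and test points together, and no sorted list of zeros has to be
  written down.\<close>

definition lifts :: "('r::comm_ring_1 \<Rightarrow> 'a::real_closed_field) \<Rightarrow> ('r \<Rightarrow> 'b::real_closed_field)
    \<Rightarrow> 'r poly set \<Rightarrow> bool" where
  "lifts \<phi> \<psi> F \<longleftrightarrow> (\<forall>Z. finite Z \<longrightarrow> (\<exists>h. strict_mono_on Z h \<and>
     (\<forall>z\<in>Z. \<forall>f\<in>F. sg (poly (map_poly \<phi> f) z) = sg (poly (map_poly \<psi> f) (h z)))))"

lemma liftsE:
  assumes "lifts \<phi> \<psi> F" "finite Z"
  obtains h where "strict_mono_on Z h"
    "\<And>z f. z \<in> Z \<Longrightarrow> f \<in> F \<Longrightarrow> sg (poly (map_poly \<phi> f) z) = sg (poly (map_poly \<psi> f) (h z))"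
proof -
  have "\<exists>h. strict_mono_on Z h \<and>
      (\<forall>z\<in>Z. \<forall>f\<in>F. sg (poly (map_poly \<phi> f) z) = sg (poly (map_poly \<psi> f) (h z)))"
    using assms(1)[unfolded lifts_def, rule_format, OF assms(2)] .
  then show ?thesis using that by (elim exE conjE) simp
qed

text \<open>Equal signs of the leading coefficients: equal degree and equal behaviour at infinity.\<close>

definition same_lead :: "('r::comm_ring_1 \<Rightarrow> 'a::real_closed_field) \<Rightarrow> ('r \<Rightarrow> 'b::real_closed_field)
    \<Rightarrow> 'r poly \<Rightarrow> bool" where
  "same_lead \<phi> \<psi> f \<longleftrightarrow> \<phi> (lead_coeff f) \<noteq> 0 \<and> sg (\<phi> (lead_coeff f)) = sg (\<psi> (lead_coeff f))"

lemma same_lead_sym: "same_lead \<phi> \<psi> f \<longleftrightarrow> same_lead \<psi> \<phi> f"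
  by (auto simp: same_lead_def sg_def split: if_splits)

lemma same_leadD:
  assumes "same_lead \<phi> \<psi> f"
  shows "\<phi> (lead_coeff f) \<noteq> 0" "\<psi> (lead_coeff f) \<noteq> 0"
    "sg (\<phi> (lead_coeff f)) = sg (\<psi> (lead_coeff f))"
  using assms sg_eq_cong(1)[of "\<phi> (lead_coeff f)" "\<psi> (lead_coeff f)"] by (auto simp: same_lead_def)

lemma sg_pos_mult: "0 < c \<Longrightarrow> sg (c * x) = sg x"
  by (simp add: sg_def zero_less_mult_iff)

lemma strict_mono_onD':
  fixes h :: "'a::linorder \<Rightarrow> 'b::linorder"
  assumes "strict_mono_on A h" "x \<in> A" "y \<in> A"
  shows "h x < h y \<longleftrightarrow> x < y" "h x = h y \<longleftrightarrow> x = y" "h x \<le> h y \<longleftrightarrow> x \<le> y"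
proof -
  have "h x < h y" if "x < y" using assms that by (auto simp: strict_mono_on_def)
  moreover have "h y < h x" if "y < x" using assms that by (auto simp: strict_mono_on_def)
  ultimately show "h x < h y \<longleftrightarrow> x < y" "h x = h y \<longleftrightarrow> x = y" "h x \<le> h y \<longleftrightarrow> x \<le> y"
    by (cases x y rule: linorder_cases; force)+
qed

text \<open>The converse lifting bounds the number of zeros, so that no zeros are missed.\<close>

lemma lifts_roots:
  assumes lift: "lifts \<psi> \<phi> F" and f: "f \<in> F" and hom: "ring_map \<phi>" "ring_map \<psi>"
    and lead: "same_lead \<phi> \<psi> f"
    and h: "strict_mono_on Z h" "\<And>z. z \<in> Z \<Longrightarrow> sg (poly (map_poly \<phi> f) z) = sg (poly (map_poly \<psi> f) (h z))"
    and Z: "{x. poly (map_poly \<phi> f) x = 0} \<subseteq> Z"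
  shows "h ` {x. poly (map_poly \<phi> f) x = 0} = {y. poly (map_poly \<psi> f) y = 0}"
proof -
  let ?R = "{x. poly (map_poly \<phi> f) x = 0}" and ?R' = "{y. poly (map_poly \<psi> f) y = 0}"
  have nz: "map_poly \<phi> f \<noteq> 0" "map_poly \<psi> f \<noteq> 0"
    using lead_coeff_map_poly(3)[OF hom(1)] lead_coeff_map_poly(3)[OF hom(2)] same_leadD[OF lead]
    by blast+
  have fin: "finite ?R" "finite ?R'" using nz by (simp_all add: poly_roots_finite)
  obtain k where k: "strict_mono_on ?R' k"
    "\<And>z g. z \<in> ?R' \<Longrightarrow> g \<in> F \<Longrightarrow> sg (poly (map_poly \<psi> g) z) = sg (poly (map_poly \<phi> g) (k z))"
    by (rule liftsE[OF lift fin(2)], rule that)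
  have sub: "k ` ?R' \<subseteq> ?R"
  proof
    fix x assume "x \<in> k ` ?R'"
    then obtain z where z: "z \<in> ?R'" "x = k z" by blast
    then show "x \<in> ?R" using sg_eq_cong(1)[OF k(2)[OF z(1) f]] by simp
  qed
  have card: "card ?R' \<le> card ?R"
    by (rule card_inj_on_le[OF strict_mono_on_imp_inj_on[OF k(1)] sub fin(1)])
  have "inj_on h ?R"
    by (rule inj_on_subset[OF strict_mono_on_imp_inj_on[OF h(1)] Z])
  then have "card (h ` ?R) = card ?R" by (rule card_image)
  moreover have "h ` ?R \<subseteq> ?R'"
  proof
    fix y assume "y \<in> h ` ?R"
    then obtain z where z: "z \<in> ?R" "y = h z" by blast
    then have "z \<in> Z" using Z by blast
    then show "y \<in> ?R'" using sg_eq_cong(1)[OF h(2)] z by simp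
  qed
  ultimately show ?thesis using fin(2) card by (intro card_seteq) simp_all
qed

lemma finite_eventually_ge:
  fixes P :: "'i \<Rightarrow> 'a::linorder \<Rightarrow> bool"
  assumes "finite I" "\<And>i. i \<in> I \<Longrightarrow> \<exists>N. \<forall>x\<ge>N. P i x"
  shows "\<exists>N. \<forall>x\<ge>N. \<forall>i\<in>I. P i x"
  using assms
proof (induction I rule: finite_induct)
  case empty
  then show ?case by simp
next
  case (insert j I)
  then obtain N where N: "\<forall>x\<ge>N. \<forall>i\<in>I. P i x" by auto
  obtain N' where N': "\<forall>x\<ge>N'. P j x" using insert.prems by blast
  show ?case using N N' by (intro exI[of _ "max N N'"]) auto
qed

text \<open>\<open>M\<close> and \<open>- M\<close> replace the two infinities. All relevant points
  lie between them, so every cell becomes bounded, and the signs at its outer ends depend only on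
  degrees and leading coefficients.\<close>

lemma exists_far_bound:
  fixes \<phi> :: "'r::comm_ring_1 \<Rightarrow> 'a::real_closed_field"
  assumes hom: "ring_map \<phi>" and "finite F" and F: "\<And>f. f \<in> F \<Longrightarrow> \<phi> (lead_coeff f) \<noteq> 0"
    and "finite W"
  obtains M where "0 < M" "\<And>w. w \<in> W \<Longrightarrow> - M < w \<and> w < M"
    "\<And>f. f \<in> F \<Longrightarrow> sg (poly (map_poly \<phi> f) M) = sg (\<phi> (lead_coeff f))"
    "\<And>f. f \<in> F \<Longrightarrow> sg (poly (map_poly \<phi> f) (- M)) = (- 1) ^ degree f * sg (\<phi> (lead_coeff f))"
proof -
  have "\<exists>N. \<forall>x\<ge>N. \<forall>f\<in>F. sg (poly (map_poly \<phi> f) x) = sg (\<phi> (lead_coeff f))"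
  proof (rule finite_eventually_ge[OF \<open>finite F\<close>])
    fix f assume "f \<in> F"
    note lc = lead_coeff_map_poly[OF hom F[OF this]]
    show "\<exists>N. \<forall>x\<ge>N. sg (poly (map_poly \<phi> f) x) = sg (\<phi> (lead_coeff f))"
      using poly_sg_at_top[OF lc(3)] unfolding lc(2) .
  qed
  then obtain N1 where N1: "\<And>x f. N1 \<le> x \<Longrightarrow> f \<in> F \<Longrightarrow> sg (poly (map_poly \<phi> f) x) = sg (\<phi> (lead_coeff f))"
    by blast
  have "\<exists>N. \<forall>x\<ge>N. \<forall>f\<in>F. sg (poly (map_poly \<phi> f) (- x)) = (- 1) ^ degree f * sg (\<phi> (lead_coeff f))"
  proof (rule finite_eventually_ge[OF \<open>finite F\<close>])
    fix f assume "f \<in> F"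
    note lc = lead_coeff_map_poly[OF hom F[OF this]]
    show "\<exists>N. \<forall>x\<ge>N. sg (poly (map_poly \<phi> f) (- x)) = (- 1) ^ degree f * sg (\<phi> (lead_coeff f))"
      using poly_sg_at_bot[OF lc(3)] unfolding lc(2) unfolding lc(1) .
  qed
  then obtain N2 where N2: "\<And>x f. N2 \<le> x \<Longrightarrow> f \<in> F \<Longrightarrow>
      sg (poly (map_poly \<phi> f) (- x)) = (- 1) ^ degree f * sg (\<phi> (lead_coeff f))"
    by blast
  have "\<exists>N. \<forall>x\<ge>N. \<forall>w\<in>W. - x < w \<and> w < x"
  proof (rule finite_eventually_ge[OF \<open>finite W\<close>])
    fix w assume "w \<in> W"
    show "\<exists>N. \<forall>x\<ge>N. - x < w \<and> w < x"
      by (rule exI[of _ "\<bar>w\<bar> + 1"]) (auto simp: abs_if split: if_splits)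
  qed
  then obtain N3 where N3: "\<And>x w. N3 \<le> x \<Longrightarrow> w \<in> W \<Longrightarrow> - x < w \<and> w < x" by blast
  define M where "M = max 1 (max N1 (max N2 N3))"
  have "0 < M" "N1 \<le> M" "N2 \<le> M" "N3 \<le> M" by (auto simp: M_def less_max_iff_disj)
  with N1 N2 N3 that show ?thesis by blast
qed

lemma strict_mono_on_insert:
  fixes h :: "'a::linorder \<Rightarrow> 'b::linorder"
  assumes "strict_mono_on T h" "z \<notin> T"
    and "\<And>x. x \<in> T \<Longrightarrow> x < z \<Longrightarrow> h x < y" "\<And>x. x \<in> T \<Longrightarrow> z < x \<Longrightarrow> y < h x"
  shows "strict_mono_on (insert z T) (h(z := y))"
  using assms unfolding strict_mono_on_def by auto

text \<open>
  Points are added one at a time: between two neighbouring points that enclose no zero of the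
  derivative, \<open>p\<close> is monotone, so its sign pattern there is determined by its signs at the two points.
\<close>

lemma lifts_insert:
  fixes \<phi> :: "'r::comm_ring_1 \<Rightarrow> 'a::real_closed_field" and \<psi> :: "'r \<Rightarrow> 'b::real_closed_field"
  assumes hom: "ring_map \<phi>" "ring_map \<psi>"
    and lift: "lifts \<phi> \<psi> F0" "lifts \<psi> \<phi> F0"
    and "finite F" and sub: "F \<subseteq> F0" "formal_deriv p \<in> F0" "formal_deriv p \<noteq> 0"
    and lead: "\<And>f. f \<in> insert p (insert (formal_deriv p) F) \<Longrightarrow> f \<noteq> 0 \<Longrightarrow> same_lead \<phi> \<psi> f"
    and rem: "\<And>q. q \<in> insert (formal_deriv p) F \<Longrightarrow> q \<noteq> 0 \<Longrightarrow>
      \<exists>k s. smult (lead_coeff q ^ (2 * k)) p - q * s \<in> F0"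
  shows "lifts \<phi> \<psi> (insert p F)"
  unfolding lifts_def
proof (intro allI impI)
  fix Z :: "'a set" assume "finite Z"
  let ?a = "\<lambda>f. poly (map_poly \<phi> f)" and ?b = "\<lambda>f. poly (map_poly \<psi> f)"
  \<comment> \<open>The zero polynomial is left out: it has infinitely many zeros, and its sign
    needs no matching. The zeros of the others, collected in \<open>W\<close>, bound the
    cells.\<close>
  define D where "D = {f \<in> insert (formal_deriv p) F. f \<noteq> 0}"
  define W where "W = (\<Union>f\<in>D. {x. ?a f x = 0})"
  have D: "finite D" "D \<subseteq> F0" "formal_deriv p \<in> D" using \<open>finite F\<close> sub by (auto simp: D_def)
  have leadD: "same_lead \<phi> \<psi> f" if "f \<in> D" for f using that lead by (auto simp: D_def)
  have "p \<noteq> 0" using sub(3) by (auto simp: formal_deriv_def)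
  then have leadp: "same_lead \<phi> \<psi> p" using lead by auto
  have "finite W"
    unfolding W_def
    using D(1) lead_coeff_map_poly(3)[OF hom(1) same_leadD(1)[OF leadD]]
    by (intro finite_UN_I) (auto simp: poly_roots_finite)
  obtain h0 where h0: "strict_mono_on (W \<union> Z) h0"
    and h0sg: "\<And>z f. z \<in> W \<union> Z \<Longrightarrow> f \<in> F0 \<Longrightarrow> sg (?a f z) = sg (?b f (h0 z))"
    using liftsE[OF lift(1)] \<open>finite W\<close> \<open>finite Z\<close> by (metis finite_UnI)
  have roots: "h0 ` {x. ?a f x = 0} = {y. ?b f y = 0}" if "f \<in> D" for f
    using that D(2) W_def
    by (intro lifts_roots[OF lift(2) _ hom leadD h0 h0sg]) auto
  \<comment> \<open>At a zero of \<open>q\<close>, the pseudo-division identity reduces to its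
    remainder \<open>r\<close>, whose sign \<open>h0\<close> respects since \<open>r\<close> lies in
    \<open>F0\<close>. The power of the leading coefficient is even, so the multiplier of
    \<open>p\<close> is positive on both sides.\<close>
  have sgp: "sg (?a p w) = sg (?b p (h0 w))" if w: "w \<in> W" for w
  proof -
    obtain q where q: "q \<in> D" "?a q w = 0" using w by (auto simp: W_def)
    obtain k s where r: "smult (lead_coeff q ^ (2 * k)) p - q * s \<in> F0"
      using rem[of q] q(1) unfolding D_def by blast
    define r where "r = smult (lead_coeff q ^ (2 * k)) p - q * s"
    have eq: "smult (lead_coeff q ^ (2 * k)) p = q * s + r" by (simp add: r_def)
    have "?b q (h0 w) = 0" using roots[OF q(1)] q(2) by auto
    then have b: "\<psi> (lead_coeff q) ^ (2 * k) * ?b p (h0 w) = ?b r (h0 w)"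
      using arg_cong[OF eq, of "\<lambda>f. ?b f (h0 w)"]
      by (simp add: map_poly_ring_map[OF hom(2)] ring_mapD[OF hom(2)])
    have a: "\<phi> (lead_coeff q) ^ (2 * k) * ?a p w = ?a r w"
      using arg_cong[OF eq, of "\<lambda>f. ?a f w"] q(2)
      by (simp add: map_poly_ring_map[OF hom(1)] ring_mapD[OF hom(1)])
    have "0 < \<phi> (lead_coeff q) ^ (2 * k)" "0 < \<psi> (lead_coeff q) ^ (2 * k)"
      using same_leadD(1,2)[OF leadD[OF q(1)]] by (simp_all add: power_mult)
    then have "sg (?a p w) = sg (?a r w)" "sg (?b p (h0 w)) = sg (?b r (h0 w))"
      unfolding a[symmetric] b[symmetric] by (simp_all only: sg_pos_mult)
    then show ?thesis using h0sg[of w r] w r by (simp add: r_def)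
  qed
  have finF: "finite (insert p D)" using D(1) by simp
  have leadF: "\<phi> (lead_coeff f) \<noteq> 0" "\<psi> (lead_coeff f) \<noteq> 0" if "f \<in> insert p D" for f
    using that same_leadD(1,2)[OF leadp] same_leadD(1,2)[OF leadD] by auto
  obtain M where M: "0 < M" "\<And>w. w \<in> W \<union> Z \<Longrightarrow> - M < w \<and> w < M"
    "\<And>f. f \<in> insert p D \<Longrightarrow> sg (?a f M) = sg (\<phi> (lead_coeff f))"
    "\<And>f. f \<in> insert p D \<Longrightarrow> sg (?a f (- M)) = (- 1) ^ degree f * sg (\<phi> (lead_coeff f))"
    using exists_far_bound[OF hom(1) finF leadF(1), of "W \<union> Z"] \<open>finite W\<close> \<open>finite Z\<close> by blast
  obtain M' where M': "0 < M'" "\<And>w. w \<in> h0 ` (W \<union> Z) \<Longrightarrow> - M' < w \<and> w < M'"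
    "\<And>f. f \<in> insert p D \<Longrightarrow> sg (?b f M') = sg (\<psi> (lead_coeff f))"
    "\<And>f. f \<in> insert p D \<Longrightarrow> sg (?b f (- M')) = (- 1) ^ degree f * sg (\<psi> (lead_coeff f))"
    using exists_far_bound[OF hom(2) finF leadF(2), of "h0 ` (W \<union> Z)"] \<open>finite W\<close> \<open>finite Z\<close> by blast
  have MM': "sg (?a f M) = sg (?b f M')" "sg (?a f (- M)) = sg (?b f (- M'))" if "f \<in> insert p D" for f
    using that M(3,4)[OF that] M'(3,4)[OF that] same_leadD(3)[OF leadp] same_leadD(3)[OF leadD] by auto
  \<comment> \<open>\<open>h0\<close> gives the right sign of \<open>p\<close> on \<open>W\<close>
    but says nothing about \<open>p\<close> at the points of \<open>Z\<close>. Their images are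
    therefore chosen anew, one at a time; \<open>h0\<close> only serves to identify the signs of the
    polynomials in \<open>D\<close> on a cell.\<close>
  define T where "T Y = W \<union> {M, - M} \<union> Y" for Y
  define good where "good Y h \<longleftrightarrow> strict_mono_on (T Y) h \<and> (\<forall>w\<in>W. h w = h0 w) \<and> h M = M' \<and> h (- M) = - M' \<and>
     (\<forall>z\<in>T Y. \<forall>f\<in>insert p D. sg (?a f z) = sg (?b f (h z)))" for Y h
  have "\<exists>h. good Y h" if "finite Y" "Y \<subseteq> Z" for Y
    using that
  proof (induction Y rule: finite_induct)
    case empty
    define h where "h x = (if x = M then M' else if x = - M then - M' else h0 x)" for x
    have hW: "h w = h0 w" if "w \<in> W" for w using M(2)[of w] that by (auto simp: h_def)
    have hM: "h M = M'" "h (- M) = - M'" using M(1) by (auto simp: h_def)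
    have "strict_mono_on (T {}) h"
      unfolding strict_mono_on_def T_def
    proof (intro allI impI, elim conjE)
      fix r s assume rs: "r \<in> W \<union> {M, - M} \<union> {}" "s \<in> W \<union> {M, - M} \<union> {}" "r < s"
      consider "r \<in> W" "s \<in> W" | "r \<in> W" "s = M" | "r = - M" "s \<in> W" | "r = - M" "s = M"
        | "r \<in> W" "s = - M" | "r = M" "s \<in> W" | "r = M" "s = - M" using rs by blast
      then show "h r < h s"
      proof cases
        case 1
        then show ?thesis using rs(3) h0 hW by (auto simp: strict_mono_on_def)
      qed (use rs(3) hW hM M(1) M(2)[of r] M(2)[of s] M'(1) M'(2)[of "h0 r"] M'(2)[of "h0 s"] in auto)
    qed
    moreover have "sg (?a f w) = sg (?b f (h w))" if "w \<in> T {}" "f \<in> insert p D" for w f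
      using that MM'[OF that(2)] hM hW h0sg[of w f] sgp[of w] D(2) by (auto simp: T_def)
    ultimately have "good {} h" using hW hM by (simp add: good_def)
    then show ?case by blast
  next
    case (insert z Y)
    then obtain h where h: "good Y h" by auto
    then have hmono: "strict_mono_on (T Y) h" and hW: "\<And>w. w \<in> W \<Longrightarrow> h w = h0 w"
      and hM: "h M = M'" "h (- M) = - M'"
      and hsg: "\<And>x f. x \<in> T Y \<Longrightarrow> f \<in> insert p D \<Longrightarrow> sg (?a f x) = sg (?b f (h x))"
      by (auto simp: good_def)
    show ?case
    proof (cases "z \<in> T Y")
      case True
      then have "T (insert z Y) = T Y" by (auto simp: T_def)
      then show ?thesis using h by (auto simp: good_def)
    next
      case False
      have "z \<in> Z" "z \<notin> W" "finite (T Y)"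
        using insert.prems insert.hyps False \<open>finite W\<close> by (auto simp: T_def)
      define a b where "a = Max {x \<in> T Y. x < z}" and "b = Min {x \<in> T Y. z < x}"
      have "- M < z" "z < M" using M(2) \<open>z \<in> Z\<close> by auto
      then have ne: "{x \<in> T Y. x < z} \<noteq> {}" "{x \<in> T Y. z < x} \<noteq> {}" by (auto simp: T_def)
      have fin: "finite {x \<in> T Y. x < z}" "finite {x \<in> T Y. z < x}"
        using \<open>finite (T Y)\<close> by auto
      have "a \<in> {x \<in> T Y. x < z}" "b \<in> {x \<in> T Y. z < x}"
        unfolding a_def b_def by (rule Max_in[OF fin(1) ne(1)], rule Min_in[OF fin(2) ne(2)])
      then have ab: "a \<in> T Y" "a < z" "b \<in> T Y" "z < b" by auto
      have le_a: "x \<le> a" if "x \<in> T Y" "x < z" for x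
        unfolding a_def by (rule Max_ge[OF fin(1)]) (use that in auto)
      have ge_b: "b \<le> x" if "x \<in> T Y" "z < x" for x
        unfolding b_def by (rule Min_le[OF fin(2)]) (use that in auto)
      have W_T: "w \<in> T Y" if "w \<in> W" for w using that by (simp add: T_def)
      have gap: "w \<le> a \<or> b \<le> w" if "w \<in> T Y" for w
        using that le_a ge_b False by (metis linorder_neqE)
      have hab: "h a < h b" using strict_mono_onD'(1)[OF hmono ab(1,3)] ab by auto
      have nza: "?a f x \<noteq> 0" if "f \<in> D" "a < x" "x < b" for f x
        using that gap W_T by (auto simp: W_def dest!: leD)
      have rootW: "\<exists>w\<in>W. y = h0 w" if f: "f \<in> D" and y: "?b f y = 0" for f y
      proof -
        have "y \<in> h0 ` {x. ?a f x = 0}" unfolding roots[OF f] using y by simp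
        then show ?thesis using f unfolding W_def by blast
      qed
      have nzb: "?b f y \<noteq> 0" if f: "f \<in> D" and y: "h a < y" "y < h b" for f y
      proof
        assume z0: "?b f y = 0"
        obtain w where w: "w \<in> W" "y = h0 w" using rootW[OF f z0] by blast
        then have "y = h w" "w \<in> T Y" using hW W_T by auto
        with y gap[of w] show False
          using strict_mono_onD'(3)[OF hmono] ab(1,3) by (metis not_less)
      qed
      \<comment> \<open>With respect to the images of all zeros in \<open>W\<close>, the point
        \<open>h0 z\<close> lies in the same cell as \<open>y\<close>. Hence no zero of
        \<open>f\<close> separates them, and the sign of \<open>f\<close> at \<open>z\<close>, which
        \<open>h0\<close> preserves, is its sign at \<open>y\<close>.\<close>
      have cell: "sg (?b f y) = sg (?a f z)" if f: "f \<in> D" and y: "h a < y" "y < h b" for f y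
      proof -
        have nz: "?b f u \<noteq> 0" if u: "min y (h0 z) \<le> u" "u \<le> max y (h0 z)" for u
        proof
          assume z0: "?b f u = 0"
          obtain w where w: "w \<in> W" "u = h0 w" using rootW[OF f z0] by blast
          have "w \<noteq> z" using w \<open>z \<notin> W\<close> by auto
          show False
          proof (cases "w < z")
            case True
            then have "h0 w < h0 z" using h0 w(1) \<open>z \<in> Z\<close> by (auto simp: strict_mono_on_def)
            moreover have "h w \<le> h a"
              using strict_mono_onD'(3)[OF hmono W_T[OF w(1)] ab(1)] le_a[OF W_T[OF w(1)] True] by simp
            ultimately show False using u w y hW[OF w(1)] by auto
          next
            case False
            then have "z < w" using \<open>w \<noteq> z\<close> by simp
            then have "h0 z < h0 w" using h0 w(1) \<open>z \<in> Z\<close> by (auto simp: strict_mono_on_def)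
            moreover have "h b \<le> h w"
              using strict_mono_onD'(3)[OF hmono ab(3) W_T[OF w(1)]] ge_b[OF W_T[OF w(1)] \<open>z < w\<close>] by simp
            ultimately show False using u w y hW[OF w(1)] by auto
          qed
        qed
        have "sg (?b f (min y (h0 z))) = sg (?b f (max y (h0 z)))"
          by (rule poly_sg_const) (use nz in auto)
        then have "sg (?b f y) = sg (?b f (h0 z))" by (auto simp: min_def max_def split: if_splits)
        then show ?thesis using h0sg[of z f] \<open>z \<in> Z\<close> f D(2) by auto
      qed
      obtain y where y: "h a < y" "y < h b" "sg (?a p z) = sg (?b p y)"
      proof (rule poly_cell_lift[where p = "map_poly \<phi> p" and q = "map_poly \<psi> p" and z = z])
        show "poly (pderiv (map_poly \<phi> p)) x \<noteq> 0" if "a < x" "x < b" for x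
          using nza[OF D(3) that] by (simp add: map_poly_formal_deriv[OF hom(1)])
        show "sg (poly (pderiv (map_poly \<psi> p)) y) = sg (poly (pderiv (map_poly \<phi> p)) z)"
          if "h a < y" "y < h b" for y
          using cell[OF D(3) that] by (simp add: map_poly_formal_deriv[OF hom(1)] map_poly_formal_deriv[OF hom(2)])
      qed (use ab hab hsg in auto)
      define h' where "h' = h(z := y)"
      have "strict_mono_on (insert z (T Y)) h'"
        unfolding h'_def
      proof (rule strict_mono_on_insert[OF hmono False])
        show "h x < y" if "x \<in> T Y" "x < z" for x
          using strict_mono_onD'(3)[OF hmono that(1) ab(1)] le_a[OF that] y(1) by auto
        show "y < h x" if "x \<in> T Y" "z < x" for x
          using strict_mono_onD'(3)[OF hmono ab(3) that(1)] ge_b[OF that] y(2) by auto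
      qed
      moreover have "insert z (T Y) = T (insert z Y)" by (auto simp: T_def)
      moreover have "sg (?a f x) = sg (?b f (h' x))" if "x \<in> insert z (T Y)" "f \<in> insert p D" for x f
        using that hsg[of x f] y(3) cell[OF _ y(1,2)] by (auto simp: h'_def)
      moreover have "z \<noteq> M" "z \<noteq> - M" using \<open>- M < z\<close> \<open>z < M\<close> by auto
      ultimately have "good (insert z Y) h'"
        using hW hM \<open>z \<notin> W\<close> unfolding good_def by (auto simp: h'_def)
      then show ?thesis by blast
    qed
  qed
  then obtain h where h: "good Z h" using \<open>finite Z\<close> by blast
  have "strict_mono_on Z h"
    using h unfolding good_def strict_mono_on_def T_def by auto
  moreover have "sg (?a f z) = sg (?b f (h z))" if "z \<in> Z" "f \<in> insert p F" for z f
  proof (cases "f = 0")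
    case False
    then have "f \<in> insert p D" using that(2) by (auto simp: D_def)
    then show ?thesis using h that(1) by (auto simp: good_def T_def)
  qed simp
  ultimately show "\<exists>h. strict_mono_on Z h \<and>
      (\<forall>z\<in>Z. \<forall>f\<in>insert p F. sg (?a f z) = sg (?b f (h z)))" by blast
qed

section \<open>Subrings as coefficient domains, and pseudo-division\<close>

definition subring_on :: "'r::comm_ring_1 set \<Rightarrow> bool" where
  "subring_on S \<longleftrightarrow> 1 \<in> S \<and> (\<forall>x\<in>S. \<forall>y\<in>S. x - y \<in> S \<and> x * y \<in> S)"

lemma subring_onD:
  assumes "subring_on S"
  shows "0 \<in> S" "1 \<in> S" "x \<in> S \<Longrightarrow> y \<in> S \<Longrightarrow> x + y \<in> S" "x \<in> S \<Longrightarrow> y \<in> S \<Longrightarrow> x * y \<in> S"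
    "x \<in> S \<Longrightarrow> - x \<in> S" "x \<in> S \<Longrightarrow> y \<in> S \<Longrightarrow> x - y \<in> S" "x \<in> S \<Longrightarrow> x ^ n \<in> S" "of_nat n \<in> S"
    "(\<And>i. i \<in> A \<Longrightarrow> g i \<in> S) \<Longrightarrow> sum g A \<in> S"
proof -
  show one: "1 \<in> S" and diff: "x \<in> S \<Longrightarrow> y \<in> S \<Longrightarrow> x - y \<in> S"
    and mult: "x \<in> S \<Longrightarrow> y \<in> S \<Longrightarrow> x * y \<in> S" for x y
    using assms by (auto simp: subring_on_def)
  show zero: "0 \<in> S" using diff[OF one one] by simp
  show neg: "- x \<in> S" if "x \<in> S" for x using diff[OF zero that] by simp
  show add: "x + y \<in> S" if "x \<in> S" "y \<in> S" for x y
    using diff[OF that(1) neg[OF that(2)]] by simp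
  show "x ^ n \<in> S" if "x \<in> S" by (induction n) (simp_all add: one mult that)
  show "of_nat n \<in> S" by (induction n) (simp_all add: zero one add)
  show "sum g A \<in> S" if "\<And>i. i \<in> A \<Longrightarrow> g i \<in> S"
    using that by (induction A rule: infinite_finite_induct) (simp_all add: zero add)
qed

text \<open>Coefficients are confined to a subset and not to a type: eliminating a variable shrinks
  the subset, while the ring and the ring maps on it stay the same.\<close>

definition polys_over :: "'r::comm_ring_1 set \<Rightarrow> 'r poly set" where
  "polys_over S = {p. \<forall>i. coeff p i \<in> S}"

lemma subring_on_polys_over:
  assumes "subring_on S"
  shows "subring_on (polys_over S)"
  unfolding subring_on_def polys_over_def
  by (auto simp: coeff_mult coeff_1 subring_onD[OF assms] intro!: subring_onD(9)[OF assms])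

lemma polys_over_intros:
  assumes "subring_on S"
  shows "c \<in> S \<Longrightarrow> p \<in> polys_over S \<Longrightarrow> pCons c p \<in> polys_over S"
    "c \<in> S \<Longrightarrow> p \<in> polys_over S \<Longrightarrow> smult c p \<in> polys_over S"
    "c \<in> S \<Longrightarrow> monom c n \<in> polys_over S"
    "p \<in> polys_over S \<Longrightarrow> formal_deriv p \<in> polys_over S"
  by (auto simp: polys_over_def coeff_pCons coeff_formal_deriv monom.rep_eq subring_onD[OF assms]
      simp del: of_nat_Suc split: nat.split)

lemma polys_overD: "p \<in> polys_over S \<Longrightarrow> coeff p i \<in> S"
  by (simp add: polys_over_def)

text \<open>Division without inverses. Each step multiplies by the square of the leading
  coefficient, one factor more than cancellation requires, so that the total multiplier is positive
  under every ring map into an ordered field that does not kill the leading coefficient.\<close>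

lemma pseudo_remainder:
  assumes S: "subring_on S" and "p \<in> polys_over S" and q: "q \<in> polys_over S" "q \<noteq> 0"
  shows "\<exists>k. \<exists>s\<in>polys_over S. smult (lead_coeff q ^ (2 * k)) p - q * s \<in> polys_over S \<and>
    (smult (lead_coeff q ^ (2 * k)) p - q * s = 0 \<or>
     degree (smult (lead_coeff q ^ (2 * k)) p - q * s) < degree q)"
  using assms(2)
\<comment> \<open>Zero ranks below the nonzero constants, because division by a constant
  \<open>q\<close> ends at zero without a drop in degree.\<close>
proof (induction "if p = 0 then 0 else Suc (degree p)" arbitrary: p rule: less_induct)
  case less
  show ?case
  proof (cases "p = 0 \<or> degree p < degree q")
    case True
    then show ?thesis
      using less.prems subring_onD(1)[OF subring_on_polys_over[OF S]]
      by (intro exI[of _ 0] bexI[of _ 0]) auto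
  next
    case False
    then have "p \<noteq> 0" and deg: "degree q \<le> degree p" by auto
    define t where "t = monom (lead_coeff q * lead_coeff p) (degree p - degree q)"
    define p1 where "p1 = smult (lead_coeff q ^ 2) p - q * t"
    have t: "t \<in> polys_over S"
      unfolding t_def
      by (intro polys_over_intros[OF S] subring_onD[OF S] polys_overD less.prems q(1))
    then have p1: "p1 \<in> polys_over S"
      unfolding p1_def
      by (intro subring_onD[OF subring_on_polys_over[OF S]] polys_over_intros[OF S] subring_onD[OF S]
          polys_overD less.prems q(1))
    have "degree p1 \<le> degree p"
    proof -
      have "degree (q * t) \<le> degree q + (degree p - degree q)"
        unfolding t_def by (rule order_trans[OF degree_mult_le]) (simp add: degree_monom_le)
      then show ?thesis
        unfolding p1_def using deg by (intro degree_diff_le) (auto intro: order_trans[OF degree_smult_le])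
    qed
    moreover have "coeff p1 (degree p) = 0"
    proof -
      have "coeff (q * t) (degree q + (degree p - degree q)) = lead_coeff q * (lead_coeff q * lead_coeff p)"
      proof -
        have "coeff (monom (lead_coeff q * lead_coeff p) (degree p - degree q) * q)
            ((degree p - degree q) + degree q) = lead_coeff q * lead_coeff p * lead_coeff q"
          by (simp add: coeff_monom_mult)
        then show ?thesis by (simp add: t_def ac_simps)
      qed
      then show ?thesis using deg by (simp add: p1_def power2_eq_square ac_simps)
    qed
    ultimately have "p1 = 0 \<or> degree p1 < degree p"
      by (metis le_neq_implies_less leading_coeff_0_iff)
    then have "(if p1 = 0 then 0 else Suc (degree p1)) < (if p = 0 then 0 else Suc (degree p))"
      using \<open>p \<noteq> 0\<close> by auto
    from less.hyps[OF this p1] obtain k s where ks: "s \<in> polys_over S"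
      "smult (lead_coeff q ^ (2 * k)) p1 - q * s \<in> polys_over S"
      "smult (lead_coeff q ^ (2 * k)) p1 - q * s = 0 \<or>
       degree (smult (lead_coeff q ^ (2 * k)) p1 - q * s) < degree q" by blast
    have "smult (lead_coeff q ^ (2 * k)) p1 - q * s =
      smult (lead_coeff q ^ (2 * Suc k)) p - q * (smult (lead_coeff q ^ (2 * k)) t + s)"
      by (simp add: p1_def algebra_simps power2_eq_square smult_diff_right)
    moreover have "smult (lead_coeff q ^ (2 * k)) t + s \<in> polys_over S"
      by (intro subring_onD[OF subring_on_polys_over[OF S]] polys_over_intros[OF S] subring_onD[OF S]
          polys_overD q(1) t ks(1))
    ultimately show ?thesis using ks(2,3) by (intro exI[of _ "Suc k"] bexI) auto
  qed
qed

section \<open>Elimination of one variable\<close>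

lemma lifts_const:
  assumes "lifts \<phi> \<psi> F" "sg (\<phi> c) = sg (\<psi> c)" "ring_map \<phi>" "ring_map \<psi>"
  shows "lifts \<phi> \<psi> (insert [:c:] F)"
proof -
  have "map_poly \<phi> [:c:] = [:\<phi> c:]" "map_poly \<psi> [:c:] = [:\<psi> c:]"
    using assms(3,4) by (simp_all add: map_poly_pCons ring_mapD)
  then show ?thesis using assms(1,2) unfolding lifts_def by simp
qed

lemma lifts_empty:
  fixes \<phi> :: "'r::comm_ring_1 \<Rightarrow> 'a::real_closed_field" and \<psi> :: "'r \<Rightarrow> 'b::real_closed_field"
  shows "lifts \<phi> \<psi> {}"
  unfolding lifts_def
proof (intro allI impI)
  fix Z :: "'a set" assume "finite Z"
  have "card {x \<in> Z. x < r} < card {x \<in> Z. x < s}" if "r \<in> Z" "r < s" for r s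
    by (rule psubset_card_mono) (use \<open>finite Z\<close> that in auto)
  \<comment> \<open>With no signs to respect, each point can be sent to its rank in
    \<open>Z\<close>.\<close>
  then have "strict_mono_on Z (\<lambda>z. of_nat (card {x \<in> Z. x < z}) :: 'b)"
    unfolding strict_mono_on_def by simp
  then show "\<exists>h :: 'a \<Rightarrow> 'b. strict_mono_on Z h \<and>
      (\<forall>z\<in>Z. \<forall>f\<in>{}. sg (poly (map_poly \<phi> f) z) = sg (poly (map_poly \<psi> f) (h z)))" by blast
qed

lemma degree_formal_deriv:
  fixes \<phi> :: "'r::comm_ring_1 \<Rightarrow> 'a::{idom, ring_char_0}"
  assumes "0 < degree p" "ring_map \<phi>" "\<phi> (lead_coeff p) \<noteq> 0"
  shows "degree (formal_deriv p) < degree p" "formal_deriv p \<noteq> 0"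
proof -
  have "degree (formal_deriv p) \<le> degree p - 1"
    by (rule degree_le) (use assms(1) in \<open>auto simp: coeff_formal_deriv coeff_eq_0\<close>)
  then show "degree (formal_deriv p) < degree p" using assms(1) by simp
  have "\<phi> (coeff (formal_deriv p) (degree p - 1)) = of_nat (degree p) * \<phi> (lead_coeff p)"
    using assms(1) by (simp add: coeff_formal_deriv ring_mapD[OF assms(2)] del: of_nat_Suc)
  also have "\<dots> \<noteq> 0" using assms(1,3) by simp
  finally show "formal_deriv p \<noteq> 0" using ring_mapD(4)[OF assms(2)] by auto
qed

text \<open>
  Induction on the maximal degree and on the number of polynomials attaining it: one of them
  is replaced by its derivative and by its remainders modulo the other polynomials.
\<close>

lemma sign_transfer_aux:
  fixes \<phi> :: "'r::comm_ring_1 \<Rightarrow> 'a::real_closed_field"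
  assumes S: "subring_on S" and hom: "ring_map \<phi>" and inj: "\<And>x. x \<in> S \<Longrightarrow> \<phi> x = 0 \<Longrightarrow> x = 0"
  assumes "finite F" "F \<subseteq> polys_over S" "\<And>f. f \<in> F \<Longrightarrow> degree f < n"
  shows "\<exists>B. finite B \<and> B \<subseteq> S \<and> (\<forall>\<psi> :: 'r \<Rightarrow> 'b::real_closed_field. ring_map \<psi> \<longrightarrow>
    (\<forall>b\<in>B. sg (\<phi> b) = sg (\<psi> b)) \<longrightarrow> lifts \<phi> \<psi> F \<and> lifts \<psi> \<phi> F)"
  using assms(4-6)
proof (induction n arbitrary: F)
  case 0
  then have "F = {}" by auto
  then show ?case by (intro exI[of _ "{}"]) (simp add: lifts_empty)
next
  case (Suc n)
  show ?case
    using Suc.prems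
  proof (induction "card {f \<in> F. degree f = n}" arbitrary: F)
    case 0
    then have "{f \<in> F. degree f = n} = {}" by simp
    with 0 have "degree f < n" if "f \<in> F" for f using that by (metis (mono_tags, lifting) empty_iff less_antisym mem_Collect_eq)
    then show ?case using Suc.IH 0 by blast
  next
    case (Suc m)
    have "{f \<in> F. degree f = n} \<noteq> {}" using Suc.hyps(2) card.empty by (metis nat.distinct(1))
    then obtain p where p: "p \<in> F" "degree p = n" by auto
    define F' where "F' = F - {p}"
    have F: "F = insert p F'" "p \<notin> F'" using p(1) by (auto simp: F'_def)
    have fin: "finite F'" and over: "F' \<subseteq> polys_over S" and pover: "p \<in> polys_over S"
      and degF': "\<And>f. f \<in> F' \<Longrightarrow> degree f < Suc n"
      using Suc.prems p(1) by (auto simp: F'_def)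
    have "{f \<in> F. degree f = n} = insert p {f \<in> F'. degree f = n}" using F p(2) by auto
    then have card: "m = card {f \<in> F'. degree f = n}" using Suc.hyps(2) F(2) fin by simp
    show ?case
    proof (cases "n = 0")
      case True
      then obtain c where c: "p = [:c:]" using p(2) by (metis degree_eq_zeroE)
      then have "c \<in> S" using polys_overD[OF pover, of 0] by simp
      from Suc.hyps(1)[OF card fin over degF'] obtain B where B: "finite B" "B \<subseteq> S"
        "\<And>\<psi> :: 'r \<Rightarrow> 'b. ring_map \<psi> \<Longrightarrow> (\<forall>b\<in>B. sg (\<phi> b) = sg (\<psi> b)) \<Longrightarrow> lifts \<phi> \<psi> F' \<and> lifts \<psi> \<phi> F'"
        by blast
      have "lifts \<phi> \<psi> F \<and> lifts \<psi> \<phi> F"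
        if \<psi>: "ring_map \<psi>" "\<forall>b\<in>insert c B. sg (\<phi> b) = sg (\<psi> b)" for \<psi> :: "'r \<Rightarrow> 'b"
        unfolding F c
        by (intro conjI lifts_const hom \<psi>(1)) (use B(3)[OF \<psi>(1)] \<psi>(2) in auto)
      then show ?thesis using B(1,2) \<open>c \<in> S\<close> by (intro exI[of _ "insert c B"]) auto
    next
      case False
      \<comment> \<open>Here injectivity on \<open>S\<close> enters: leading coefficients survive,
        so the polynomials keep their degrees under \<open>\<phi>\<close>.\<close>
      have nz: "\<phi> (lead_coeff f) \<noteq> 0" if "f \<in> polys_over S" "f \<noteq> 0" for f
        using inj[of "lead_coeff f"] polys_overD[OF that(1)] that(2) by auto
      have "p \<noteq> 0" using False p(2) by auto
      have p0: "degree (formal_deriv p) < n" "formal_deriv p \<noteq> 0"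
        using degree_formal_deriv[OF _ hom nz[OF pover \<open>p \<noteq> 0\<close>]] False p(2) by auto
      have dover: "formal_deriv p \<in> polys_over S" using polys_over_intros(4)[OF S pover] .
      define Q where "Q = {q \<in> insert (formal_deriv p) F'. q \<noteq> 0}"
      have "\<forall>q\<in>Q. \<exists>r. r \<in> polys_over S \<and> (r = 0 \<or> degree r < degree q) \<and>
          (\<exists>k s. smult (lead_coeff q ^ (2 * k)) p - q * s = r)"
      proof
        fix q assume "q \<in> Q"
        then have "q \<in> polys_over S" "q \<noteq> 0" using dover over by (auto simp: Q_def)
        from pseudo_remainder[OF S pover this]
        show "\<exists>r. r \<in> polys_over S \<and> (r = 0 \<or> degree r < degree q) \<and>
          (\<exists>k s. smult (lead_coeff q ^ (2 * k)) p - q * s = r)" by blast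
      qed
      then obtain r where r: "\<And>q. q \<in> Q \<Longrightarrow> r q \<in> polys_over S"
        "\<And>q. q \<in> Q \<Longrightarrow> r q = 0 \<or> degree (r q) < degree q"
        "\<And>q. q \<in> Q \<Longrightarrow> \<exists>k s. smult (lead_coeff q ^ (2 * k)) p - q * s = r q"
        by (metis (no_types))
      have degQ: "degree q \<le> n" if "q \<in> Q" for q using that p0(1) degF' by (fastforce simp: Q_def)
      have degr: "degree (r q) < n" if "q \<in> Q" for q
        using r(2)[OF that] degQ[OF that] False by auto
      \<comment> \<open>\<open>p\<close> is traded for polynomials of degree below \<open>n\<close>,
        so one polynomial fewer has degree \<open>n\<close> and the inner induction hypothesis
        applies.\<close>
      define F0 where "F0 = F' \<union> insert (formal_deriv p) (r ` Q)"
      have F0: "finite F0" "F0 \<subseteq> polys_over S"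
        using fin over dover r(1) by (auto simp: F0_def Q_def)
      have degF0: "degree f < Suc n" if "f \<in> F0" for f
        using that degF' p0(1) degr by (auto simp: F0_def less_Suc_eq)
      have "{f \<in> F0. degree f = n} = {f \<in> F'. degree f = n}"
        using p0(1) degr by (auto simp: F0_def)
      then have card0: "m = card {f \<in> F0. degree f = n}" using card by simp
      from Suc.hyps(1)[OF card0 F0 degF0] obtain B where B: "finite B" "B \<subseteq> S"
        "\<And>\<psi> :: 'r \<Rightarrow> 'b. ring_map \<psi> \<Longrightarrow> (\<forall>b\<in>B. sg (\<phi> b) = sg (\<psi> b)) \<Longrightarrow> lifts \<phi> \<psi> F0 \<and> lifts \<psi> \<phi> F0"
        by blast
      \<comment> \<open>The leading coefficients are added to the tested elements, so that
        \<open>\<psi>\<close> preserves degrees and the behaviour at infinity as well.\<close>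
      define B' where "B' = B \<union> lead_coeff ` insert p (insert (formal_deriv p) F')"
      have "finite B'" "B' \<subseteq> S"
        using B(1,2) fin over dover pover by (auto simp: B'_def intro: polys_overD)
      moreover have "lifts \<phi> \<psi> F \<and> lifts \<psi> \<phi> F"
        if \<psi>: "ring_map \<psi>" "\<forall>b\<in>B'. sg (\<phi> b) = sg (\<psi> b)" for \<psi> :: "'r \<Rightarrow> 'b"
      proof -
        have lift: "lifts \<phi> \<psi> F0" "lifts \<psi> \<phi> F0" using B(3)[OF \<psi>(1)] \<psi>(2) by (auto simp: B'_def)
        have lead: "same_lead \<phi> \<psi> f" if "f \<in> insert p (insert (formal_deriv p) F')" "f \<noteq> 0" for f
          using that \<psi>(2) nz[of f] over dover pover by (auto simp: same_lead_def B'_def)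
        then have lead': "same_lead \<psi> \<phi> f" if "f \<in> insert p (insert (formal_deriv p) F')" "f \<noteq> 0" for f
          using that same_lead_sym by blast
        have rem: "\<exists>k s. smult (lead_coeff q ^ (2 * k)) p - q * s \<in> F0"
          if "q \<in> insert (formal_deriv p) F'" "q \<noteq> 0" for q
        proof -
          have "q \<in> Q" using that by (simp add: Q_def)
          then have "r q \<in> F0" by (simp add: F0_def)
          then show ?thesis using r(3)[OF \<open>q \<in> Q\<close>] by metis
        qed
        have sub: "F' \<subseteq> F0" "formal_deriv p \<in> F0" by (auto simp: F0_def)
        show ?thesis
          unfolding F(1)
          using lifts_insert[OF hom \<psi>(1) lift fin sub p0(2) lead rem]
            lifts_insert[OF \<psi>(1) hom lift(2,1) fin sub p0(2) lead' rem] by blast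
      qed
      ultimately show ?thesis by blast
    qed
  qed
qed

text \<open>\<open>B\<close> depends neither on \<open>\<psi>\<close> nor on \<open>x\<close>. It is
  the finite list of conditions on the coefficients that the next round of elimination, with one
  variable fewer, has to meet.\<close>

lemma sign_transfer:
  fixes \<phi> :: "'r::comm_ring_1 \<Rightarrow> 'a::real_closed_field"
  assumes S: "subring_on S" and hom: "ring_map \<phi>" and inj: "\<And>x. x \<in> S \<Longrightarrow> \<phi> x = 0 \<Longrightarrow> x = 0"
    and F: "finite F" "F \<subseteq> polys_over S"
  obtains B where "finite B" "B \<subseteq> S"
    "\<And>(\<psi> :: 'r \<Rightarrow> 'b::real_closed_field) x. ring_map \<psi> \<Longrightarrow> (\<And>b. b \<in> B \<Longrightarrow> sg (\<phi> b) = sg (\<psi> b)) \<Longrightarrow>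
      \<exists>y. \<forall>f\<in>F. sg (poly (map_poly \<phi> f) x) = sg (poly (map_poly \<psi> f) y)"
proof -
  have deg: "degree f < Suc (Max (degree ` F))" if "f \<in> F" for f
    using F(1) that by (simp add: less_Suc_eq_le)
  from sign_transfer_aux[OF S hom inj F deg, where 'b = 'b] obtain B where B: "finite B" "B \<subseteq> S"
    "\<And>\<psi> :: 'r \<Rightarrow> 'b. ring_map \<psi> \<Longrightarrow> (\<forall>b\<in>B. sg (\<phi> b) = sg (\<psi> b)) \<Longrightarrow> lifts \<phi> \<psi> F \<and> lifts \<psi> \<phi> F"
    by blast
  have "\<exists>y. \<forall>f\<in>F. sg (poly (map_poly \<phi> f) x) = sg (poly (map_poly \<psi> f) y)"
    if "ring_map \<psi>" "\<And>b. b \<in> B \<Longrightarrow> sg (\<phi> b) = sg (\<psi> b)" for \<psi> :: "'r \<Rightarrow> 'b" and x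
  proof -
    have "lifts \<phi> \<psi> F" using B(3) that by blast
    then obtain h where "\<And>z f. z \<in> {x} \<Longrightarrow> f \<in> F \<Longrightarrow> sg (poly (map_poly \<phi> f) z) = sg (poly (map_poly \<psi> f) (h z))"
      by (rule liftsE[of _ _ _ "{x}"]) auto
    then show ?thesis by (intro exI[of _ "h x"]) simp
  qed
  with B(1,2) that show ?thesis by blast
qed

section \<open>Maximal preordered subfields of an algebraically closed field\<close>

lemma mult_inverse_square: "x * (inverse x)\<^sup>2 = inverse (x::'c::field)"
  by (cases "x = 0") (simp_all add: power2_eq_square flip: mult.assoc)

definition subfield_on :: "'c::field set \<Rightarrow> bool" where
  "subfield_on E \<longleftrightarrow> subring_on E \<and> (\<forall>x\<in>E. inverse x \<in> E)"

text \<open>A proper preordering that carries its own field: \<open>differences P\<close> is a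
  subfield, and \<open>P\<close> contains its squares. The field is not a separate datum, so
  inclusion of cones compares orders and fields at once.\<close>

definition pos_cone :: "'c::field set \<Rightarrow> bool" where
  "pos_cone P \<longleftrightarrow> 1 \<in> P \<and> - 1 \<notin> P \<and>
     (\<forall>x\<in>P. \<forall>y\<in>P. x + y \<in> P \<and> x * y \<in> P \<and> (x - y)\<^sup>2 \<in> P) \<and> (\<forall>x\<in>P. inverse x \<in> P)"

definition differences :: "'c::field set \<Rightarrow> 'c set" where
  "differences P = {x - y | x y. x \<in> P \<and> y \<in> P}"

lemma pos_coneD:
  assumes "pos_cone P"
  shows "1 \<in> P" "- 1 \<notin> P" "x \<in> P \<Longrightarrow> y \<in> P \<Longrightarrow> x + y \<in> P" "x \<in> P \<Longrightarrow> y \<in> P \<Longrightarrow> x * y \<in> P"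
    "x \<in> P \<Longrightarrow> inverse x \<in> P" "0 \<in> P" "x \<in> differences P \<Longrightarrow> x\<^sup>2 \<in> P" "x \<in> P \<Longrightarrow> x \<in> differences P"
    "x \<in> P \<Longrightarrow> - x \<in> P \<Longrightarrow> x = 0"
proof -
  show one: "1 \<in> P" and neg: "- 1 \<notin> P" and "x \<in> P \<Longrightarrow> y \<in> P \<Longrightarrow> x + y \<in> P"
    and mult: "x \<in> P \<Longrightarrow> y \<in> P \<Longrightarrow> x * y \<in> P" and inv: "x \<in> P \<Longrightarrow> inverse x \<in> P" for x y
    using assms by (auto simp: pos_cone_def)
  show sq: "x \<in> differences P \<Longrightarrow> x\<^sup>2 \<in> P" for x
    using assms by (auto simp: pos_cone_def differences_def)
  have "1 - 1 \<in> differences P" using one unfolding differences_def by blast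
  from sq[OF this] show zero: "0 \<in> P" by simp
  have "x - 0 \<in> differences P" if "x \<in> P" using zero that unfolding differences_def by blast
  then show "x \<in> P \<Longrightarrow> x \<in> differences P" by simp
  show "x = 0" if "x \<in> P" "- x \<in> P"
  proof (rule ccontr)
    assume "x \<noteq> 0"
    then have "inverse x * - x = - 1" by simp
    with mult[OF inv[OF that(1)] that(2)] neg show False by simp
  qed
qed

lemma subfield_on_differences:
  assumes P: "pos_cone P"
  shows "subfield_on (differences P)"
proof -
  have D: "x - y \<in> differences P" if "x \<in> P" "y \<in> P" for x y using that unfolding differences_def by blast
  have sub: "subring_on (differences P)"
    unfolding subring_on_def
  proof (intro conjI ballI)
    show "1 \<in> differences P" by (intro pos_coneD(1,8)[OF P])
    fix x y assume "x \<in> differences P" "y \<in> differences P"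
    then obtain a b c d where *: "x = a - b" "y = c - d" "a \<in> P" "b \<in> P" "c \<in> P" "d \<in> P"
      by (auto simp: differences_def)
    have "a + d \<in> P" "b + c \<in> P" "a * c + b * d \<in> P" "a * d + b * c \<in> P"
      using *(3-6) pos_coneD(3,4)[OF P] by simp_all
    then have "(a + d) - (b + c) \<in> differences P" "(a * c + b * d) - (a * d + b * c) \<in> differences P"
      by (simp_all only: D)
    then show "x - y \<in> differences P" "x * y \<in> differences P" unfolding *(1,2) by (simp_all add: algebra_simps)
  qed
  moreover have "inverse x \<in> differences P" if "x \<in> differences P" for x
  proof -
    have "x * inverse (x\<^sup>2) \<in> differences P"
      by (intro subring_onD(4)[OF sub] that pos_coneD(5,7,8)[OF P])
    then show ?thesis using mult_inverse_square[of x] by (simp add: power_inverse)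
  qed
  ultimately show ?thesis by (simp add: subfield_on_def)
qed

text \<open>For multiplicatively closed \<open>P\<close> this is the preordering that
  \<open>P\<close> generates in an extension ring \<open>E\<close>. It serves for \<open>E\<close> a
  field and, with constant weights, for \<open>E\<close> a ring of polynomials.\<close>

inductive_set sos_over :: "'c::comm_ring_1 set \<Rightarrow> 'c set \<Rightarrow> 'c set" for P E where
  sos_zero: "0 \<in> sos_over P E"
| sos_add: "s \<in> sos_over P E \<Longrightarrow> p \<in> P \<Longrightarrow> y \<in> E \<Longrightarrow> s + p * y\<^sup>2 \<in> sos_over P E"

lemma sos_over_add:
  assumes "s \<in> sos_over P E" "t \<in> sos_over P E"
  shows "s + t \<in> sos_over P E"
  using assms(2)
proof (induction t rule: sos_over.induct)
  case (sos_add t p y)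
  then have "(s + t) + p * y\<^sup>2 \<in> sos_over P E" by (intro sos_over.sos_add)
  then show ?case by (simp add: add.assoc)
qed (simp add: assms(1))

lemma sos_over_single: "p \<in> P \<Longrightarrow> y \<in> E \<Longrightarrow> p * y\<^sup>2 \<in> sos_over P E"
  using sos_add[OF sos_zero] by fastforce

lemma sos_over_scale:
  assumes "subring_on E" "\<And>x y. x \<in> P \<Longrightarrow> y \<in> P \<Longrightarrow> x * y \<in> P" "p \<in> P" "y \<in> E" "s \<in> sos_over P E"
  shows "s * (p * y\<^sup>2) \<in> sos_over P E"
  using assms(5)
proof (induction s rule: sos_over.induct)
  case (sos_add s q z)
  have "q * p * (z * y)\<^sup>2 \<in> sos_over P E"
    by (intro sos_over_single assms subring_onD[OF assms(1)] sos_add)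
  then have "s * (p * y\<^sup>2) + q * p * (z * y)\<^sup>2 \<in> sos_over P E"
    using sos_add.IH sos_over_add by blast
  then show ?case by (simp add: algebra_simps power_mult_distrib)
qed (simp add: sos_zero)

lemma sos_over_mult:
  assumes "subring_on E" "\<And>x y. x \<in> P \<Longrightarrow> y \<in> P \<Longrightarrow> x * y \<in> P" "s \<in> sos_over P E" "t \<in> sos_over P E"
  shows "s * t \<in> sos_over P E"
  using assms(4)
proof (induction t rule: sos_over.induct)
  case (sos_add t p y)
  have "s * t + s * (p * y\<^sup>2) \<in> sos_over P E"
    by (intro sos_over_add sos_over_scale assms(1-3) sos_add)
  then show ?case by (simp add: algebra_simps)
qed (simp add: sos_zero)

text \<open>The only obstruction to extending the cone to \<open>E\<close> is that
  \<open>- 1\<close> becomes a weighted sum of squares. The third conclusion places \<open>E\<close>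
  inside the field of the new cone, so maximality of a cone also limits its field.\<close>

lemma pos_cone_sos_over:
  fixes P :: "'c::field set"
  assumes P: "pos_cone P" and E: "subfield_on E" "P \<subseteq> E" and neg: "- 1 \<notin> sos_over P E"
  shows "pos_cone (sos_over P E)" "P \<subseteq> sos_over P E" "E \<subseteq> differences (sos_over P E)"
proof -
  let ?Q = "sos_over P E"
  have sub: "subring_on E" and inv: "x \<in> E \<Longrightarrow> inverse x \<in> E" for x
    using E(1) by (auto simp: subfield_on_def)
  have QE: "s \<in> E" if "s \<in> ?Q" for s
    using that by induction (use E(2) in \<open>auto intro!: subring_onD[OF sub]\<close>)
  have mult: "s * t \<in> ?Q" if "s \<in> ?Q" "t \<in> ?Q" for s t
    by (rule sos_over_mult[OF sub pos_coneD(4)[OF P] that])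
  have sq: "y\<^sup>2 \<in> ?Q" if "y \<in> E" for y
    using sos_over_single[OF pos_coneD(1)[OF P] that] by simp
  show PQ: "P \<subseteq> ?Q"
    using sos_over_single[OF _ subring_onD(2)[OF sub]] by fastforce
  have "x - y \<in> E" if "x \<in> ?Q" "y \<in> ?Q" for x y using QE that by (intro subring_onD[OF sub])
  moreover have "inverse x \<in> ?Q" if "x \<in> ?Q" for x
    using mult[OF that sq[OF inv[OF QE[OF that]]]] unfolding mult_inverse_square .
  moreover have "1 \<in> ?Q" using PQ pos_coneD(1)[OF P] by (rule subsetD)
  ultimately show "pos_cone ?Q"
    unfolding pos_cone_def using neg mult sq sos_over_add by (intro conjI ballI) simp_all
  show "E \<subseteq> differences ?Q"
  proof
    fix x assume x: "x \<in> E"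
    \<comment> \<open>With \<open>h\<close> one half, \<open>x\<close> is the difference of the
      squares of \<open>(x + 1) * h\<close> and \<open>(x - 1) * h\<close>. Two is invertible
      because \<open>1\<close> lies in the cone and \<open>- 1\<close> does not.\<close>
    define h :: 'c where "h = inverse (of_nat 2)"
    have h: "h \<in> E" unfolding h_def by (intro inv subring_onD[OF sub])
    have "(1 + 1 :: 'c) \<noteq> 0"
    proof
      assume "(1 + 1 :: 'c) = 0"
      then have "(1 :: 'c) = - 1" by (simp only: eq_neg_iff_add_eq_0)
      then show False using pos_coneD(1,2)[OF P] by metis
    qed
    then have two: "(1 + 1) * h = 1" unfolding h_def by simp
    have "(x + 1) * h \<in> E" "(x - 1) * h \<in> E"
      by (intro subring_onD[OF sub] x h)+
    then have "((x + 1) * h)\<^sup>2 - ((x - 1) * h)\<^sup>2 \<in> differences ?Q"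
      unfolding differences_def using sq by blast
    also have "((x + 1) * h)\<^sup>2 - ((x - 1) * h)\<^sup>2 = x * ((1 + 1) * h) * ((1 + 1) * h)"
      by (simp only: power2_eq_square ring_distribs diff_add_eq diff_diff_eq2) (simp add: algebra_simps)
    also have "\<dots> = x" unfolding two by simp
    finally show "x \<in> differences ?Q" .
  qed
qed

section \<open>Maximal cones and their total order\<close>

definition max_cone :: "'c::field set \<Rightarrow> bool" where
  "max_cone P \<longleftrightarrow> pos_cone P \<and> (\<forall>Q. pos_cone Q \<longrightarrow> P \<subseteq> Q \<longrightarrow> Q = P)"

lemma max_cone_exists:
  assumes "pos_cone P0"
  obtains P where "max_cone P" "P0 \<subseteq> P"
proof -
  define A where "A = {P. pos_cone P \<and> P0 \<subseteq> P}"
  have "\<exists>M\<in>A. \<forall>X\<in>A. M \<subseteq> X \<longrightarrow> X = M"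
  proof (rule subset_Zorn_nonempty)
    show "A \<noteq> {}" using assms by (auto simp: A_def)
    fix C assume C: "C \<noteq> {}" "subset.chain A C"
    have sub: "X \<in> A" if "X \<in> C" for X
      using C(2) that by (auto simp: subset_chain_def)
    have total: "X \<subseteq> Y \<or> Y \<subseteq> X" if "X \<in> C" "Y \<in> C" for X Y
      using C(2) that by (auto simp: subset_chain_def)
    have mem: "pos_cone X" "P0 \<subseteq> X" if "X \<in> C" for X
      using sub[OF that] by (simp_all add: A_def)
    have two: "\<exists>Z\<in>C. x \<in> Z \<and> y \<in> Z" if xy: "x \<in> \<Union>C" "y \<in> \<Union>C" for x y
    proof -
      obtain X Y where XY: "X \<in> C" "x \<in> X" "Y \<in> C" "y \<in> Y" using xy by blast
      from total[OF XY(1,3)] show ?thesis using XY by blast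
    qed
    have "pos_cone (\<Union>C)"
      unfolding pos_cone_def
    proof (intro conjI ballI)
      show "1 \<in> \<Union>C" using C(1) pos_coneD(1)[OF mem(1)] by auto
      show "- 1 \<notin> \<Union>C" using pos_coneD(2)[OF mem(1)] by auto
      fix x assume x: "x \<in> \<Union>C"
      then show "inverse x \<in> \<Union>C" using pos_coneD(5)[OF mem(1)] by auto
      fix y assume y: "y \<in> \<Union>C"
      obtain Z where Z: "Z \<in> C" "x \<in> Z" "y \<in> Z" using two[OF x y] by blast
      then have "x + y \<in> Z" "x * y \<in> Z" "(x - y)\<^sup>2 \<in> Z" using mem(1)[OF Z(1)] by (auto simp: pos_cone_def)
      then show "x + y \<in> \<Union>C" "x * y \<in> \<Union>C" "(x - y)\<^sup>2 \<in> \<Union>C" using Z(1) by auto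
    qed
    then show "\<Union>C \<in> A" using C(1) mem(2) by (auto simp: A_def)
  qed
  then obtain M where "M \<in> A" "\<And>Y. Y \<in> A \<Longrightarrow> M \<subseteq> Y \<Longrightarrow> Y = M" by blast
  then have "max_cone M" "P0 \<subseteq> M" by (auto simp: max_cone_def A_def)
  then show ?thesis by (rule that)
qed

text \<open>Adjoining \<open>- x\<close> leads to the elements \<open>p - x * q\<close> with
  \<open>p\<close> and \<open>q\<close> in \<open>P\<close>. If \<open>- 1\<close> were among them,
  \<open>x\<close> would equal \<open>(1 + p) * inverse q\<close> and so lie in \<open>P\<close>.
  Hence they form a cone, which by maximality is \<open>P\<close> itself.\<close>

lemma max_cone_total:
  assumes max: "max_cone P" and x: "x \<in> differences P" "x \<notin> P"
  shows "- x \<in> P"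
proof -
  have P: "pos_cone P" using max by (simp add: max_cone_def)
  have sub: "subring_on (differences P)" and inv: "\<And>y. y \<in> differences P \<Longrightarrow> inverse y \<in> differences P"
    using subfield_on_differences[OF P] by (auto simp: subfield_on_def)
  define Q where "Q = {p - x * q | p q. p \<in> P \<and> q \<in> P}"
  have Q: "p - x * q \<in> Q" if "p \<in> P" "q \<in> P" for p q using that by (auto simp: Q_def)
  have QE: "y \<in> differences P" if y: "y \<in> Q" for y
  proof -
    obtain p q where "y = p - x * q" "p \<in> P" "q \<in> P" using y by (auto simp: Q_def)
    then show ?thesis by (simp add: subring_onD[OF sub] pos_coneD(8)[OF P] x(1))
  qed
  have PQ: "P \<subseteq> Q" using Q[OF _ pos_coneD(6)[OF P]] by auto
  have mult: "s * t \<in> Q" if st: "s \<in> Q" "t \<in> Q" for s t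
  proof -
    obtain p q p' q' where *: "s = p - x * q" "t = p' - x * q'" "p \<in> P" "q \<in> P" "p' \<in> P" "q' \<in> P"
      using st by (auto simp: Q_def)
    have "(p * p' + x\<^sup>2 * (q * q')) - x * (p * q' + q * p') \<in> Q"
      by (intro Q pos_coneD(3,4,7)[OF P] *(3-6) x(1))
    then show ?thesis unfolding *(1,2) by (simp add: algebra_simps power2_eq_square)
  qed
  have "pos_cone Q"
    unfolding pos_cone_def
  proof (intro conjI ballI)
    show "1 \<in> Q" using PQ pos_coneD(1)[OF P] by blast
    show "- 1 \<notin> Q"
    proof
      assume "- 1 \<in> Q"
      then obtain p q where pq: "- 1 = p - x * q" "p \<in> P" "q \<in> P" by (auto simp: Q_def)
      then have xq: "x * q = 1 + p" by (metis add.commute diff_eq_eq minus_diff_eq uminus_add_conv_diff)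
      have "q \<noteq> 0"
      proof
        assume "q = 0"
        then have "p = - 1" using pq(1) by simp
        then show False using pq(2) pos_coneD(2)[OF P] by simp
      qed
      then have "x = (1 + p) * inverse q" using xq by (simp add: field_simps)
      moreover have "(1 + p) * inverse q \<in> P" by (intro pos_coneD(1,3,4,5)[OF P] pq(2,3))
      ultimately show False using x(2) by simp
    qed
    fix s assume s: "s \<in> Q"
    have "(inverse s)\<^sup>2 \<in> Q" using PQ pos_coneD(7)[OF P inv[OF QE[OF s]]] by (rule subsetD)
    from mult[OF s this] show "inverse s \<in> Q" unfolding mult_inverse_square .
    fix t assume t: "t \<in> Q"
    show "s * t \<in> Q" by (rule mult[OF s t])
    have "s - t \<in> differences P" by (intro subring_onD[OF sub] QE s t)
    then show "(s - t)\<^sup>2 \<in> Q" using PQ pos_coneD(7)[OF P] by blast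
    obtain p q p' q' where *: "s = p - x * q" "t = p' - x * q'" "p \<in> P" "q \<in> P" "p' \<in> P" "q' \<in> P"
      using s t by (auto simp: Q_def)
    have "(p + p') - x * (q + q') \<in> Q" by (intro Q pos_coneD(3,4,7)[OF P] *(3-6))
    then show "s + t \<in> Q" unfolding *(1,2) by (simp add: algebra_simps)
  qed
  then have "Q = P" using max PQ by (auto simp: max_cone_def)
  moreover have "0 - x * 1 \<in> Q" by (intro Q pos_coneD(1,6)[OF P])
  ultimately show ?thesis by simp
qed

section \<open>Intermediate values for maximal cones\<close>

lemma polys_over_division:
  assumes E: "subfield_on E" and "p \<in> polys_over E" and q: "q \<in> polys_over E" "q \<noteq> 0"
  obtains s r where "s \<in> polys_over E" "r \<in> polys_over E" "p = q * s + r" "r = 0 \<or> degree r < degree q"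
proof -
  have S: "subring_on E" and inv: "x \<in> E \<Longrightarrow> inverse x \<in> E" for x
    using E by (auto simp: subfield_on_def)
  obtain k s where ks: "s \<in> polys_over E" "smult (lead_coeff q ^ (2 * k)) p - q * s \<in> polys_over E"
    "smult (lead_coeff q ^ (2 * k)) p - q * s = 0 \<or>
     degree (smult (lead_coeff q ^ (2 * k)) p - q * s) < degree q"
    using pseudo_remainder[OF S assms(2) q] by blast
  define c where "c = lead_coeff q ^ (2 * k)"
  have c: "c \<noteq> 0" "inverse c \<in> E"
    using q by (auto simp: c_def intro!: inv subring_onD[OF S] polys_overD)
  have "p = q * smult (inverse c) s + smult (inverse c) (smult c p - q * s)"
    using c(1) by (simp add: smult_diff_right)
  then show ?thesis
    using that[of "smult (inverse c) s" "smult (inverse c) (smult c p - q * s)"]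
      ks c polys_over_intros(2)[OF S c(2)] unfolding c_def[symmetric] by (auto simp: degree_smult_eq)
qed

lemma poly_polys_over:
  assumes "subring_on S" "p \<in> polys_over S" "x \<in> S"
  shows "poly p x \<in> S"
  unfolding poly_altdef using assms by (intro subring_onD[OF assms(1)] polys_overD)

lemma max_coneD:
  assumes "max_cone P"
  shows "pos_cone P" "subfield_on (differences P)" "subring_on (differences P)"
  using assms subfield_on_differences by (auto simp: max_cone_def subfield_on_def)

text \<open>The relation \<open>x < 0\<close> of the ordering \<open>P\<close>, stated inside a
  field that has no order of its own.\<close>

definition neg_in :: "'c::field set \<Rightarrow> 'c \<Rightarrow> bool" where
  "neg_in P x \<longleftrightarrow> x \<noteq> 0 \<and> - x \<in> P"

text \<open>Passes a sign change of a product of polynomials on to one of the factors.\<close>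

lemma neg_in_factor:
  assumes max: "max_cone P" and xy: "x \<in> differences P" "y \<in> differences P" and neg: "neg_in P (x * y)"
  shows "neg_in P x \<or> neg_in P y"
proof -
  have P: "pos_cone P" using max_coneD[OF max] by simp
  have nz: "x \<noteq> 0" "y \<noteq> 0" using neg by (auto simp: neg_in_def)
  have "x \<in> P \<longrightarrow> y \<notin> P"
  proof (intro impI notI)
    assume "x \<in> P" "y \<in> P"
    then have "x * y \<in> P" by (rule pos_coneD(4)[OF P])
    then have "x * y = 0" using pos_coneD(9)[OF P, of "x * y"] neg by (simp add: neg_in_def)
    then show False using nz by simp
  qed
  then show ?thesis using max_cone_total[OF max] xy nz by (auto simp: neg_in_def)
qed

lemma neg_in_cancel:
  assumes P: "pos_cone P" and neg: "neg_in P x" and pos: "x * y \<in> P" "x * y \<noteq> 0"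
  shows "neg_in P y"
proof -
  have "(x * y) * inverse (- x) \<in> P"
    using neg by (intro pos_coneD(4,5)[OF P] pos(1)) (simp add: neg_in_def)
  moreover have "(x * y) * inverse (- x) = - y"
  proof -
    have "(x * y) * inverse (- x) = - (y * (x * inverse x))"
      by (simp add: ac_simps)
    then show ?thesis using pos(2) by simp
  qed
  ultimately have "- y \<in> P" by (simp only:)
  then show ?thesis using pos(2) by (auto simp: neg_in_def)
qed

text \<open>The weights enter as constant polynomials, so that \<open>sos_over\<close> serves
  numbers and polynomials alike. Evaluation at a point of the field turns each summand into an
  element of \<open>P\<close> times a square of the field.\<close>

lemma sos_over_const_poly:
  assumes P: "pos_cone P" and E: "subring_on E" "P \<subseteq> E"
    and s: "s \<in> sos_over ((\<lambda>p. [:p:]) ` P) (polys_over E)"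
  shows "s \<in> polys_over E" "a \<in> differences P \<Longrightarrow> E \<subseteq> differences P \<Longrightarrow> poly s a \<in> P"
proof -
  have "s \<in> polys_over E \<and> (a \<in> differences P \<longrightarrow> E \<subseteq> differences P \<longrightarrow> poly s a \<in> P)"
    using s
  proof (induction s rule: sos_over.induct)
    case sos_zero
    then show ?case
      using subring_onD(1)[OF subring_on_polys_over[OF E(1)]] pos_coneD(6)[OF P] by simp
  next
    case (sos_add s c h)
    then obtain p where p: "c = [:p:]" "p \<in> P" by blast
    have "smult p (h\<^sup>2) \<in> polys_over E"
      using p(2) E(2)
      by (intro polys_over_intros(2)[OF E(1)] subring_onD(7)[OF subring_on_polys_over[OF E(1)]] sos_add) auto
    then have "s + c * h\<^sup>2 \<in> polys_over E"
      using sos_add.IH p(1) by (intro subring_onD(3)[OF subring_on_polys_over[OF E(1)]]) auto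
    moreover have "poly (s + c * h\<^sup>2) a \<in> P" if "a \<in> differences P" "E \<subseteq> differences P"
    proof -
      have sub: "subring_on (differences P)" using subfield_on_differences[OF P] by (simp add: subfield_on_def)
      have "h \<in> polys_over (differences P)" using sos_add.hyps(3) that(2) by (auto simp: polys_over_def)
      then have "(poly h a)\<^sup>2 \<in> P" by (intro pos_coneD(7)[OF P] poly_polys_over[OF sub] that)
      then have "poly s a + p * (poly h a)\<^sup>2 \<in> P"
        using sos_add.IH p(2) that by (intro pos_coneD(3,4)[OF P]) auto
      then show ?thesis using p(1) by simp
    qed
    ultimately show ?case by simp
  qed
  then show "s \<in> polys_over E" "a \<in> differences P \<Longrightarrow> E \<subseteq> differences P \<Longrightarrow> poly s a \<in> P" by auto
qed

text \<open>The square of \<open>h\<close> may be replaced by the square of its remainder modulo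
  \<open>f\<close>, at the cost of a multiple of \<open>f\<close>. Remainders have degree at most
  \<open>degree f - 1\<close>; writing the bound with \<open>+ 2\<close> avoids truncated
  subtraction.\<close>

lemma sos_over_reduce:
  assumes E: "subfield_on E" and f: "f \<in> polys_over E" "0 < degree f"
    and s: "s \<in> sos_over ((\<lambda>p. [:p:]) ` P) (polys_over E)" and "P \<subseteq> E"
  shows "\<exists>s'\<in>sos_over ((\<lambda>p. [:p:]) ` P) (polys_over E). \<exists>u\<in>polys_over E.
    s = s' + f * u \<and> degree s' + 2 \<le> 2 * degree f"
  using s
proof (induction s rule: sos_over.induct)
  case sos_zero
  have S: "subring_on E" using E by (simp add: subfield_on_def)
  show ?case
    by (rule bexI[OF _ sos_over.sos_zero], rule bexI[of _ 0])
       (use f(2) subring_onD(1)[OF subring_on_polys_over[OF S]] in auto)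
next
  case (sos_add s c h)
  have S: "subring_on E" using E by (simp add: subfield_on_def)
  note R = subring_on_polys_over[OF S]
  obtain p where p: "c = [:p:]" "p \<in> P" using sos_add.hyps by blast
  obtain s' u where s': "s' \<in> sos_over ((\<lambda>p. [:p:]) ` P) (polys_over E)" "u \<in> polys_over E"
    "s = s' + f * u" "degree s' + 2 \<le> 2 * degree f" using sos_add.IH by blast
  have "f \<noteq> 0" using f(2) by auto
  then obtain q r where qr: "q \<in> polys_over E" "r \<in> polys_over E" "h = f * q + r" "r = 0 \<or> degree r < degree f"
    using polys_over_division[OF E sos_add.hyps(3) f(1)] by blast
  have dr: "degree r + 1 \<le> degree f" using qr(4) f(2) by auto
  define v where "v = u + smult p (f * q\<^sup>2 + (q * r + q * r))"
  have "v \<in> polys_over E"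
    unfolding v_def using p(2) \<open>P \<subseteq> E\<close>
    by (intro subring_onD(3,4,7)[OF R] polys_over_intros(2)[OF S] s'(2) qr f(1)) auto
  moreover have "s' + c * r\<^sup>2 \<in> sos_over ((\<lambda>p. [:p:]) ` P) (polys_over E)"
    using p by (intro sos_over.sos_add s'(1) qr) auto
  moreover have "s + c * h\<^sup>2 = (s' + c * r\<^sup>2) + f * v"
    unfolding s'(3) qr(3) v_def p(1)
    by (simp add: algebra_simps power2_eq_square smult_add_right)
  moreover have "degree (s' + c * r\<^sup>2) + 2 \<le> 2 * degree f"
  proof -
    have "degree (c * r\<^sup>2) \<le> 2 * degree r"
    proof -
      have "degree (c * r\<^sup>2) \<le> degree (r\<^sup>2)" unfolding p(1) using degree_smult_le by simp
      also have "\<dots> \<le> degree r * 2" by (rule degree_power_le)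
      finally show ?thesis by simp
    qed
    then have "degree (s' + c * r\<^sup>2) \<le> 2 * degree f - 2"
      using s'(4) dr by (intro degree_add_le) auto
    then show ?thesis using f(2) by simp
  qed
  ultimately show ?case by blast
qed

text \<open>
  Descent on the degree of \<open>f\<close>: the cofactor \<open>g\<close> changes sign at the same two points, divides the same
  kind of sum, and, after reducing the squares modulo \<open>f\<close>, has smaller degree.
\<close>

lemma sign_change_not_dvd_sos:
  assumes max: "max_cone P" and ab: "a \<in> differences P" "b \<in> differences P"
    and "f \<in> polys_over (differences P)" "g \<in> polys_over (differences P)"
    and "neg_in P (poly f a * poly f b)"
    and "s \<in> sos_over ((\<lambda>p. [:p:]) ` P) (polys_over (differences P))"
  shows "f * g \<noteq> 1 + s"
  using assms(4-7)
proof (induction "degree f" arbitrary: f g s rule: less_induct)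
  case less
  note P = max_coneD(1)[OF max] and E = max_coneD(2)[OF max] and S = max_coneD(3)[OF max]
  have PE: "P \<subseteq> differences P" using pos_coneD(8)[OF P] by blast
  show ?case
  proof
    assume eq: "f * g = 1 + s"
    have deg: "0 < degree f"
    proof (rule ccontr)
      assume "\<not> 0 < degree f"
      then obtain c where c: "f = [:c:]" by (metis degree_eq_zeroE neq0_conv)
      have "c \<in> differences P" using polys_overD[OF less.prems(1), of 0] c by simp
      then have "c * c \<in> P" using pos_coneD(7)[OF P] by (simp flip: power2_eq_square)
      then show False using less.prems(3) c pos_coneD(9)[OF P, of "c * c"] by (simp add: neg_in_def)
    qed
    obtain s' u where s': "s' \<in> sos_over ((\<lambda>p. [:p:]) ` P) (polys_over (differences P))"
      "u \<in> polys_over (differences P)" "s = s' + f * u" "degree s' + 2 \<le> 2 * degree f"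
      using sos_over_reduce[OF E less.prems(1) deg less.prems(4) PE] by blast
    define g' where "g' = g - u"
    have g': "g' \<in> polys_over (differences P)"
      unfolding g'_def by (intro subring_onD(6)[OF subring_on_polys_over[OF S]] less.prems s')
    have eq': "f * g' = 1 + s'" using eq s'(3) by (simp add: g'_def algebra_simps)
    \<comment> \<open>The value of \<open>s'\<close> lies in \<open>P\<close> and \<open>- 1\<close>
      does not, so \<open>f * g' = 1 + s'\<close> is positive throughout the field. Hence
      \<open>f\<close> and \<open>g'\<close> have equal signs at \<open>a\<close>, and likewise at
      \<open>b\<close>.\<close>
    have val: "poly f x * poly g' x \<in> P" "poly f x * poly g' x \<noteq> 0" if "x \<in> differences P" for x
    proof -
      have sx: "poly s' x \<in> P" using sos_over_const_poly(2)[OF P S PE s'(1) that] by simp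
      have eqx: "poly f x * poly g' x = 1 + poly s' x" using arg_cong[OF eq', of "\<lambda>p. poly p x"] by simp
      then show "poly f x * poly g' x \<in> P" using pos_coneD(3)[OF P pos_coneD(1)[OF P] sx] by simp
      show "poly f x * poly g' x \<noteq> 0"
      proof
        assume "poly f x * poly g' x = 0"
        then have "poly s' x = - 1" using eqx by (simp add: add_eq_0_iff)
        then show False using sx pos_coneD(2)[OF P] by simp
      qed
    qed
    have rearr: "(poly f a * poly f b) * (poly g' a * poly g' b) =
        (poly f a * poly g' a) * (poly f b * poly g' b)" by (simp add: ac_simps)
    have "neg_in P (poly g' a * poly g' b)"
      by (rule neg_in_cancel[OF P less.prems(3)]; unfold rearr)
         (use pos_coneD(4)[OF P val(1)[OF ab(1)] val(1)[OF ab(2)]] val(2)[OF ab(1)] val(2)[OF ab(2)] in simp_all)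
    moreover have "degree g' < degree f"
    proof -
      have "f \<noteq> 0" "g' \<noteq> 0" using val(2)[OF ab(1)] by auto
      then have "degree f + degree g' = degree (1 + s')" unfolding eq'[symmetric] by (simp add: degree_mult_eq)
      also have "\<dots> \<le> 2 * degree f - 2" using s'(4) by (intro degree_add_le) auto
      finally show ?thesis using deg by linarith
    qed
    ultimately have "g' * f \<noteq> 1 + s'" using less.hyps g' less.prems(1) s'(1) by blast
    then show False using eq' by (simp add: mult.commute)
  qed
qed

lemma subring_on_poly_values:
  assumes "subring_on E"
  shows "subring_on ((\<lambda>h. poly h \<alpha>) ` polys_over E)"
proof -
  note R = subring_on_polys_over[OF assms]
  show ?thesis
    unfolding subring_on_def
  proof (intro conjI ballI)
    show "1 \<in> (\<lambda>h. poly h \<alpha>) ` polys_over E" using subring_onD(2)[OF R] by (auto intro!: image_eqI[of _ _ 1])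
    fix x y assume "x \<in> (\<lambda>h. poly h \<alpha>) ` polys_over E" "y \<in> (\<lambda>h. poly h \<alpha>) ` polys_over E"
    then obtain h k where hk: "x = poly h \<alpha>" "y = poly k \<alpha>" "h \<in> polys_over E" "k \<in> polys_over E" by blast
    show "x - y \<in> (\<lambda>h. poly h \<alpha>) ` polys_over E"
      by (rule image_eqI[of _ _ "h - k"]) (use hk subring_onD(6)[OF R] in auto)
    show "x * y \<in> (\<lambda>h. poly h \<alpha>) ` polys_over E"
      by (rule image_eqI[of _ _ "h * k"]) (use hk subring_onD(4)[OF R] in auto)
  qed
qed

text \<open>The assumption \<open>min\<close> says that \<open>f\<close> is, up to a constant, the minimal polynomial of \<open>\<alpha>\<close>.\<close>

lemma subfield_on_poly_values:
  assumes E: "subfield_on E" and f: "f \<in> polys_over E" "f \<noteq> 0" "poly f \<alpha> = 0"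
    and min: "\<And>h. h \<in> polys_over E \<Longrightarrow> h \<noteq> 0 \<Longrightarrow> poly h \<alpha> = 0 \<Longrightarrow> degree f \<le> degree h"
  shows "subfield_on ((\<lambda>h. poly h \<alpha>) ` polys_over E)"
proof -
  have S: "subring_on E" and inv: "\<And>x. x \<in> E \<Longrightarrow> inverse x \<in> E"
    using E by (auto simp: subfield_on_def)
  note R = subring_on_polys_over[OF S]
  \<comment> \<open>Euclidean descent: \<open>f = h * q + r\<close> gives
    \<open>poly r \<alpha> = - (poly h \<alpha> * poly q \<alpha>)\<close>, so an inverse for the
    value of \<open>r\<close> yields one for the value of \<open>h\<close>. If \<open>r\<close> were
    zero, \<open>q\<close> would vanish at \<open>\<alpha>\<close> and have smaller degree than
    \<open>f\<close>.\<close>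
  have unit: "\<exists>u\<in>polys_over E. poly u \<alpha> * poly h \<alpha> = 1"
    if "h \<in> polys_over E" "h \<noteq> 0" "degree h < degree f" for h
    using that
  proof (induction "degree h" arbitrary: h rule: less_induct)
    case less
    have h\<alpha>: "poly h \<alpha> \<noteq> 0" using min less.prems by force
    show ?case
    proof (cases "degree h = 0")
      case True
      then obtain c where c: "h = [:c:]" by (metis degree_eq_zeroE)
      then have "c \<in> E" "c \<noteq> 0" using polys_overD[OF less.prems(1), of 0] less.prems(2) by auto
      then have "[:inverse c:] \<in> polys_over E"
        by (intro polys_over_intros[OF S] inv subring_onD(1)[OF R])
      then show ?thesis using c \<open>c \<noteq> 0\<close> by (intro bexI[of _ "[:inverse c:]"]) auto
    next
      case False
      obtain q r where qr: "q \<in> polys_over E" "r \<in> polys_over E" "f = h * q + r" "r = 0 \<or> degree r < degree h"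
        using polys_over_division[OF E f(1) less.prems(1,2)] by blast
      have r\<alpha>: "poly r \<alpha> = - (poly h \<alpha> * poly q \<alpha>)"
        using arg_cong[OF qr(3), of "\<lambda>p. poly p \<alpha>"] f(3) by (simp add: eq_neg_iff_add_eq_0 add.commute)
      have "r \<noteq> 0"
      proof
        assume "r = 0"
        then have "poly q \<alpha> = 0" "q \<noteq> 0" using r\<alpha> h\<alpha> qr(3) f(2) by auto
        then have "degree f \<le> degree q" using min qr(1) by blast
        moreover have "degree f = degree h + degree q"
          using qr(3) \<open>r = 0\<close> less.prems(2) \<open>q \<noteq> 0\<close> by (simp add: degree_mult_eq)
        ultimately show False using False by simp
      qed
      then obtain u where u: "u \<in> polys_over E" "poly u \<alpha> * poly r \<alpha> = 1"
        using less.hyps[of r] qr(2,4) less.prems(3) by auto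
      show ?thesis
      proof (rule bexI[of _ "- (u * q)"])
        show "poly (- (u * q)) \<alpha> * poly h \<alpha> = 1" using u(2) r\<alpha> by (simp add: ac_simps)
      qed (intro subring_onD[OF R] u qr)
    qed
  qed
  have "inverse x \<in> (\<lambda>h. poly h \<alpha>) ` polys_over E" if x: "x \<in> (\<lambda>h. poly h \<alpha>) ` polys_over E" for x
  proof (cases "x = 0")
    case False
    obtain h where h: "x = poly h \<alpha>" "h \<in> polys_over E" using x by blast
    obtain q r where qr: "q \<in> polys_over E" "r \<in> polys_over E" "h = f * q + r" "r = 0 \<or> degree r < degree f"
      using polys_over_division[OF E h(2) f(1,2)] by blast
    then have xr: "x = poly r \<alpha>" using h(1) f(3) by simp
    then have "r \<noteq> 0" using False by auto
    then obtain u where u: "u \<in> polys_over E" "poly u \<alpha> * x = 1" using unit[OF qr(2)] qr(4) xr by auto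
    then have "inverse x = poly u \<alpha>" using False by (metis inverse_unique mult.commute)
    then show ?thesis using u(1) by blast
  qed (use x in simp)
  then show ?thesis using subring_on_poly_values[OF S] by (simp add: subfield_on_def)
qed

text \<open>Among the factors of \<open>f0\<close> that change sign, one of least degree is, up to a
  constant, the minimal polynomial of its root \<open>\<alpha>\<close>. If the cone did not extend
  to the field generated by \<open>\<alpha>\<close>, this factor would divide \<open>1 + t\<close>
  for a weighted sum of squares \<open>t\<close>, against \<open>sign_change_not_dvd_sos\<close>.
  Maximality then puts \<open>\<alpha>\<close> into the field, so the factor is linear, and a linear
  polynomial changes sign only across its zero.\<close>

lemma max_cone_IVT:
  fixes P :: "'c::alg_closed_field set"
  assumes max: "max_cone P" and ab: "a \<in> differences P" "b \<in> differences P"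
    and f0: "f0 \<in> polys_over (differences P)" "neg_in P (poly f0 a * poly f0 b)"
  obtains x where "x \<in> differences P" "poly f0 x = 0" "neg_in P ((a - x) * (b - x))"
proof -
  let ?E = "differences P"
  note P = max_coneD(1)[OF max] and E = max_coneD(2)[OF max] and S = max_coneD(3)[OF max]
  note R = subring_on_polys_over[OF S]
  have PE: "P \<subseteq> ?E" using pos_coneD(8)[OF P] by blast
  define C where "C f \<longleftrightarrow> f \<in> polys_over ?E \<and> (\<exists>h\<in>polys_over ?E. f0 = f * h) \<and> neg_in P (poly f a * poly f b)" for f
  have "C f0" using f0 subring_onD(2)[OF R] by (auto simp: C_def intro!: bexI[of _ 1])
  then obtain f where f: "C f" "\<And>g. C g \<Longrightarrow> degree f \<le> degree g"
    using ex_has_least_nat[of C f0 degree] by blast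
  obtain k where fk: "f \<in> polys_over ?E" "k \<in> polys_over ?E" "f0 = f * k" "neg_in P (poly f a * poly f b)"
    using f(1) by (auto simp: C_def)
  have fnz: "f \<noteq> 0" using fk(4) by (auto simp: neg_in_def)
  have deg: "degree f \<noteq> 0"
  proof
    assume "degree f = 0"
    then obtain c where c: "f = [:c:]" by (metis degree_eq_zeroE)
    have "c \<in> ?E" using polys_overD[OF fk(1), of 0] c by simp
    then have "c * c \<in> P" using pos_coneD(7)[OF P] by (simp flip: power2_eq_square)
    then show False using fk(4) c pos_coneD(9)[OF P, of "c * c"] by (simp add: neg_in_def)
  qed
  then obtain \<alpha> where \<alpha>: "poly f \<alpha> = 0"
    using alg_closed_imp_poly_has_root[of f] by blast
  \<comment> \<open>For a polynomial \<open>m\<close> of least degree vanishing at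
    \<open>\<alpha>\<close> one has \<open>f = m * s\<close>, and the sign change passes to
    \<open>m\<close> or to \<open>s\<close>. It cannot pass to \<open>s\<close>, whose degree is
    smaller than that of \<open>f\<close>; so it passes to \<open>m\<close>, and the choice of
    \<open>f\<close> bounds its degree by that of \<open>m\<close>.\<close>
  have min: "degree f \<le> degree h" if h: "h \<in> polys_over ?E" "h \<noteq> 0" "poly h \<alpha> = 0" for h
  proof -
    define D where "D m \<longleftrightarrow> m \<in> polys_over ?E \<and> m \<noteq> 0 \<and> poly m \<alpha> = 0" for m
    have "D h" using h by (simp add: D_def)
    then obtain m where m: "D m" "\<And>g. D g \<Longrightarrow> degree m \<le> degree g"
      using ex_has_least_nat[of D h degree] by blast
    then have m': "m \<in> polys_over ?E" "m \<noteq> 0" "poly m \<alpha> = 0" by (auto simp: D_def)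
    obtain s r where sr: "s \<in> polys_over ?E" "r \<in> polys_over ?E" "f = m * s + r" "r = 0 \<or> degree r < degree m"
      using polys_over_division[OF E fk(1) m'(1,2)] by blast
    have r\<alpha>: "poly r \<alpha> = 0" using \<alpha> m'(3) sr(3) by simp
    have "r = 0"
    proof (rule ccontr)
      assume "r \<noteq> 0"
      then have "D r" using r\<alpha> sr(2) by (simp add: D_def)
      from m(2)[OF this] show False using sr(4) \<open>r \<noteq> 0\<close> by simp
    qed
    then have fms: "f = m * s" using sr(3) by simp
    have "s \<noteq> 0" using fms fnz by auto
    have "degree m \<noteq> 0"
    proof
      assume "degree m = 0"
      then obtain c where "m = [:c:]" by (metis degree_eq_zeroE)
      then show False using m'(2,3) by simp
    qed
    have "neg_in P ((poly m a * poly m b) * (poly s a * poly s b))"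
      using fk(4) fms by (simp add: ac_simps)
    then have "neg_in P (poly m a * poly m b) \<or> neg_in P (poly s a * poly s b)"
      by (rule neg_in_factor[OF max, rotated -1])
         (intro subring_onD(4)[OF S] poly_polys_over[OF S] m' sr ab)+
    then have "degree f \<le> degree m"
    proof
      assume "neg_in P (poly m a * poly m b)"
      then have "C m" using m'(1) sr(1) fk(2,3) fms subring_onD(4)[OF R sr(1) fk(2)]
        by (auto simp: C_def mult.assoc)
      then show ?thesis by (rule f(2))
    next
      assume "neg_in P (poly s a * poly s b)"
      then have "C s" using m'(1) sr(1) fk(2,3) fms subring_onD(4)[OF R m'(1) fk(2)]
        by (auto simp: C_def ac_simps intro!: bexI[of _ "m * k"])
      then have "degree f \<le> degree s" by (rule f(2))
      then show ?thesis using \<open>degree m \<noteq> 0\<close> fms m'(2) \<open>s \<noteq> 0\<close> by (simp add: degree_mult_eq)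
    qed
    also have "\<dots> \<le> degree h" using m(2) \<open>D h\<close> by blast
    finally show ?thesis .
  qed
  define E' where "E' = (\<lambda>h. poly h \<alpha>) ` polys_over ?E"
  have E': "subfield_on E'"
    unfolding E'_def by (rule subfield_on_poly_values[OF E fk(1) fnz \<alpha> min])
  have EE': "?E \<subseteq> E'"
  proof
    fix c assume "c \<in> ?E"
    then have "[:c:] \<in> polys_over ?E" by (intro polys_over_intros[OF S] subring_onD(1)[OF R])
    then show "c \<in> E'" unfolding E'_def by (intro image_eqI[of _ _ "[:c:]"]) auto
  qed
  \<comment> \<open>Elements of \<open>E'\<close> are values of polynomials at
    \<open>\<alpha>\<close>. So an identity for \<open>- 1\<close> as a weighted sum in
    \<open>E'\<close> lifts to polynomials and holds there modulo \<open>f\<close>.\<close>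
  have lift: "\<exists>t\<in>sos_over ((\<lambda>p. [:p:]) ` P) (polys_over ?E). poly t \<alpha> = s" if "s \<in> sos_over P E'" for s
    using that
  proof (induction s rule: sos_over.induct)
    case sos_zero
    then show ?case by (intro bexI[OF _ sos_over.sos_zero]) simp
  next
    case (sos_add s p y)
    obtain t where t: "t \<in> sos_over ((\<lambda>p. [:p:]) ` P) (polys_over ?E)" "poly t \<alpha> = s"
      using sos_add.IH by blast
    obtain h where h: "y = poly h \<alpha>" "h \<in> polys_over ?E" using sos_add.hyps(3) by (auto simp: E'_def)
    have "t + [:p:] * h\<^sup>2 \<in> sos_over ((\<lambda>p. [:p:]) ` P) (polys_over ?E)"
      by (intro sos_over.sos_add t h imageI sos_add)
    then show ?case using t(2) h(1) by (intro bexI[of _ "t + [:p:] * h\<^sup>2"]) simp_all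
  qed
  have neg: "- 1 \<notin> sos_over P E'"
  proof
    assume "- 1 \<in> sos_over P E'"
    then obtain t where t: "t \<in> sos_over ((\<lambda>p. [:p:]) ` P) (polys_over ?E)" "poly t \<alpha> = - 1"
      using lift by blast
    have "1 + t \<in> polys_over ?E"
      by (intro subring_onD(2,3)[OF R] sos_over_const_poly(1)[OF P S PE t(1)])
    then obtain s r where sr: "s \<in> polys_over ?E" "r \<in> polys_over ?E" "1 + t = f * s + r" "r = 0 \<or> degree r < degree f"
      using polys_over_division[OF E _ fk(1) fnz] by blast
    have r\<alpha>: "poly r \<alpha> = 0" using arg_cong[OF sr(3), of "\<lambda>p. poly p \<alpha>"] t(2) \<alpha> by simp
    have "r = 0"
    proof (rule ccontr)
      assume "r \<noteq> 0"
      then have "degree f \<le> degree r" using min[OF sr(2)] r\<alpha> by blast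
      then show False using sr(4) \<open>r \<noteq> 0\<close> by simp
    qed
    then show False
      using sign_change_not_dvd_sos[OF max ab fk(1) sr(1) fk(4) t(1)] sr(3) by simp
  qed
  note Q = pos_cone_sos_over[OF P E' subset_trans[OF PE EE'] neg]
  have "sos_over P E' = P" using max Q(1,2) unfolding max_cone_def by blast
  then have "E' \<subseteq> ?E" using Q(3) by simp
  moreover have "[:0, 1:] \<in> polys_over ?E"
    by (intro polys_over_intros(1)[OF S] subring_onD(1,2)[OF S] subring_onD(1)[OF R])
  then have "\<alpha> \<in> E'" unfolding E'_def by (rule image_eqI[rotated]) simp
  ultimately have \<alpha>E: "\<alpha> \<in> ?E" by (rule subsetD)
  have "[:- \<alpha>, 1:] \<in> polys_over ?E"
    by (intro polys_over_intros[OF S] subring_onD(1)[OF R] subring_onD(2,5)[OF S] \<alpha>E)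
  from min[OF this] have "degree f \<le> 1" by simp
  with deg have "degree f = 1" by simp
  define c d where "c = coeff f 0" and "d = coeff f 1"
  have cd: "f = [:c, d:]"
  proof (rule poly_eqI)
    fix n show "coeff f n = coeff [:c, d:] n"
      using \<open>degree f = 1\<close> by (cases n; cases "n - 1") (auto simp: c_def d_def coeff_eq_0)
  qed
  have "c + d * \<alpha> = 0" using \<alpha> cd by (simp add: mult.commute)
  then have c: "c = - (d * \<alpha>)" by (simp only: eq_neg_iff_add_eq_0)
  have dE: "d \<in> ?E" using polys_overD[OF fk(1)] by (simp add: d_def)
  \<comment> \<open>Now \<open>f\<close> is \<open>d\<close> times the linear polynomial with zero
    \<open>\<alpha>\<close>; its values at \<open>a\<close> and \<open>b\<close> have the product
    shown, and the square of \<open>d\<close> cannot be negative.\<close>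
  have "neg_in P (d\<^sup>2 * ((a - \<alpha>) * (b - \<alpha>)))"
    using fk(4) cd c by (simp add: algebra_simps power2_eq_square)
  then have "neg_in P (d\<^sup>2) \<or> neg_in P ((a - \<alpha>) * (b - \<alpha>))"
    by (rule neg_in_factor[OF max, rotated -1]) (intro subring_onD(4,6,7)[OF S] dE ab \<alpha>E)+
  moreover have "\<not> neg_in P (d\<^sup>2)"
    using pos_coneD(7)[OF P dE] pos_coneD(9)[OF P, of "d\<^sup>2"] by (auto simp: neg_in_def)
  ultimately have "neg_in P ((a - \<alpha>) * (b - \<alpha>))" by blast
  moreover have "poly f0 \<alpha> = 0" using fk(3) \<alpha> by simp
  ultimately show ?thesis using that \<alpha>E by blast
qed

section \<open>The Artin-Lang theorem\<close>

lemma mpoly_sum_single: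
  fixes f :: "'k \<Rightarrow>\<^sub>0 'a::comm_monoid_add"
  shows "f = (\<Sum>m\<in>Poly_Mapping.keys f. Poly_Mapping.single m (Poly_Mapping.lookup f m))"
proof (rule poly_mapping_eqI)
  fix k
  have "Poly_Mapping.lookup (\<Sum>m\<in>Poly_Mapping.keys f. Poly_Mapping.single m (Poly_Mapping.lookup f m)) k
      = (\<Sum>m\<in>Poly_Mapping.keys f. if m = k then Poly_Mapping.lookup f k else 0)"
    unfolding lookup_sum by (rule sum.cong) (auto simp: lookup_single when_def)
  also have "\<dots> = Poly_Mapping.lookup f k" by (auto simp: in_keys_iff)
  finally show "Poly_Mapping.lookup f k = Poly_Mapping.lookup
      (\<Sum>m\<in>Poly_Mapping.keys f. Poly_Mapping.single m (Poly_Mapping.lookup f m)) k" ..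
qed

lemma mpoly_induct [case_names zero add single]:
  fixes f :: "'k \<Rightarrow>\<^sub>0 'a::comm_monoid_add"
  assumes "P 0" "\<And>f g. P f \<Longrightarrow> P g \<Longrightarrow> P (f + g)" "\<And>m c. P (Poly_Mapping.single m c)"
  shows "P f"
proof -
  have "P (\<Sum>m\<in>A. Poly_Mapping.single m (Poly_Mapping.lookup f m))" for A
    by (induction A rule: infinite_finite_induct) (auto intro: assms)
  then show ?thesis using mpoly_sum_single[of f] by metis
qed

lemma mpoly_subst_superset:
  assumes "\<phi> 0 = 0" "finite A" "Poly_Mapping.keys f \<subseteq> A"
  shows "mpoly_subst \<phi> v f =
    (\<Sum>m\<in>A. \<phi> (Poly_Mapping.lookup f m) * (\<Prod>i\<in>UNIV. v i ^ Poly_Mapping.lookup m i))"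
  unfolding mpoly_subst_def
  by (rule sum.mono_neutral_left) (use assms in \<open>auto simp: in_keys_iff\<close>)

lemma mpoly_subst_add:
  fixes \<phi> :: "'a::comm_ring_1 \<Rightarrow> 'b::comm_ring_1"
  assumes "ring_map \<phi>"
  shows "mpoly_subst \<phi> v (f + g) = mpoly_subst \<phi> v f + mpoly_subst \<phi> v g"
proof -
  let ?A = "Poly_Mapping.keys f \<union> Poly_Mapping.keys g"
  note sup = mpoly_subst_superset[of \<phi> ?A, OF ring_mapD(4)[OF assms]]
  show ?thesis
    using Poly_Mapping.keys_add[of f g]
    by (subst (1 2 3) sup) (auto simp: lookup_add ring_mapD[OF assms] distrib_right sum.distrib)
qed

lemma mpoly_subst_single:
  assumes "\<phi> 0 = 0"
  shows "mpoly_subst \<phi> v (Poly_Mapping.single m c) = \<phi> c * (\<Prod>i\<in>UNIV. v i ^ Poly_Mapping.lookup m i)"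
  using assms by (subst mpoly_subst_superset[where A = "{m}"]) auto

lemma mpoly_subst_const: "\<phi> 0 = 0 \<Longrightarrow> mpoly_subst \<phi> v (mpoly_const c) = \<phi> c"
  by (simp add: mpoly_const_def mpoly_subst_single)

lemma ring_map_mpoly_subst:
  fixes \<phi> :: "'a::comm_ring_1 \<Rightarrow> 'b::comm_ring_1" and v :: "'v::finite \<Rightarrow> 'b"
  assumes "ring_map \<phi>"
  shows "ring_map (mpoly_subst \<phi> v)"
proof -
  note zero = ring_mapD(4)[OF assms]
  have s0: "mpoly_subst \<phi> v 0 = 0" by (simp add: mpoly_subst_def)
  have ss: "mpoly_subst \<phi> v (Poly_Mapping.single m c * Poly_Mapping.single n d) =
      mpoly_subst \<phi> v (Poly_Mapping.single m c) * mpoly_subst \<phi> v (Poly_Mapping.single n d)" for m n c d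
    by (simp add: mult_single mpoly_subst_single[of \<phi>, OF zero] ring_mapD[OF assms] lookup_add power_add
        prod.distrib ac_simps)
  have sg: "mpoly_subst \<phi> v (Poly_Mapping.single m c * g) =
      mpoly_subst \<phi> v (Poly_Mapping.single m c) * mpoly_subst \<phi> v g" for m c g
    by (induction g rule: mpoly_induct) (simp_all add: s0 ss distrib_left mpoly_subst_add[OF assms])
  have "mpoly_subst \<phi> v (f * g) = mpoly_subst \<phi> v f * mpoly_subst \<phi> v g" for f g
    by (induction f rule: mpoly_induct) (simp_all add: s0 sg distrib_right mpoly_subst_add[OF assms])
  moreover have "mpoly_subst \<phi> v 1 = 1"
    unfolding single_one[symmetric] mpoly_subst_single[of \<phi>, OF zero] by (simp add: ring_mapD[OF assms])
  ultimately show ?thesis by (simp add: ring_map_def mpoly_subst_add[OF assms])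
qed

lemma ring_map_mpoly_eval: "ring_map (mpoly_eval x)"
proof -
  have "ring_map (\<lambda>c::real. c)" by (simp add: ring_map_def)
  from ring_map_mpoly_subst[OF this] show ?thesis unfolding mpoly_eval_def[abs_def] .
qed

lemma ring_map_mpoly_const: "ring_map (mpoly_const :: 'a::comm_ring_1 \<Rightarrow> ('v, 'a) mpoly)"
  by (simp add: ring_map_def mpoly_const_def single_add mult_single)

definition mpoly_var :: "'v \<Rightarrow> ('v, 'a::comm_ring_1) mpoly" where
  "mpoly_var i = Poly_Mapping.single (Poly_Mapping.single i 1) 1"

lemma mpoly_eval_const [simp]: "mpoly_eval x (mpoly_const c) = c"
  by (simp add: mpoly_eval_def mpoly_subst_const)

lemma mpoly_var_power: "mpoly_var i ^ k = Poly_Mapping.single (Poly_Mapping.single i k) 1"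
  by (induction k) (simp_all add: mpoly_var_def mult_single single_add[symmetric])

lemma prod_single_1:
  "(\<Prod>i\<in>A. Poly_Mapping.single (e i) (1::'a::comm_ring_1)) = Poly_Mapping.single (\<Sum>i\<in>A. e i) 1"
  by (induction A rule: infinite_finite_induct) (simp_all add: mult_single)

lemma mpoly_monomial:
  fixes m :: "'v::finite \<Rightarrow>\<^sub>0 nat" and c :: "'a::comm_ring_1"
  shows "Poly_Mapping.single m c = mpoly_const c * (\<Prod>i\<in>UNIV. mpoly_var i ^ Poly_Mapping.lookup m i)"
proof -
  have "(\<Sum>i\<in>UNIV. Poly_Mapping.single i (Poly_Mapping.lookup m i)) = m"
    by (rule poly_mapping_eqI) (simp add: lookup_sum lookup_single when_def)
  then show ?thesis by (simp add: mpoly_var_power prod_single_1 mpoly_const_def mult_single)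
qed

lemma mpoly_eval_var [simp]: "mpoly_eval x (mpoly_var i) = x $ i"
proof -
  have "(\<Prod>k\<in>UNIV. (x $ k) ^ (if i = k then Suc 0 else 0)) = (\<Prod>k\<in>UNIV. if k = i then x $ i else 1)"
    by (rule prod.cong) auto
  then show ?thesis
    by (simp add: mpoly_eval_def mpoly_var_def mpoly_subst_single lookup_single when_def)
qed

text \<open>One field for all finite index types. The order on \<open>nat\<close> orders the
  monomials linearly, which makes these polynomials an integral domain with a field of fractions;
  the closure provides the roots to be adjoined.\<close>

type_synonym big_field = "((nat \<Rightarrow>\<^sub>0 nat) \<Rightarrow>\<^sub>0 real) fract alg_closure"

definition mpoly_nat :: "('v::finite, 'a::comm_ring_1) mpoly \<Rightarrow> (nat, 'a) mpoly" where
  "mpoly_nat = mpoly_subst mpoly_const (\<lambda>i. mpoly_var (to_nat i))"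

lemma mpoly_nat_eq_0:
  fixes f :: "('v::finite, 'a::comm_ring_1) mpoly"
  assumes "mpoly_nat f = 0"
  shows "f = 0"
proof (rule poly_mapping_eqI)
  fix m
  \<comment> \<open>\<open>E m\<close> is the exponent \<open>m\<close> with its variables renamed
    by \<open>to_nat\<close>. Renaming is injective on exponents, so no two monomials of
    \<open>f\<close> merge and every coefficient can be read off.\<close>
  define E where "E m = (\<Sum>i\<in>UNIV. Poly_Mapping.single (to_nat (i::'v)) (Poly_Mapping.lookup m i))"
    for m :: "'v \<Rightarrow>\<^sub>0 nat"
  have inj: "m = n" if "E m = E n" for m n
  proof (rule poly_mapping_eqI)
    fix k
    have "Poly_Mapping.lookup (E m) (to_nat k) = Poly_Mapping.lookup m k" for m
      by (simp add: E_def lookup_sum lookup_single when_def)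
    then show "Poly_Mapping.lookup m k = Poly_Mapping.lookup n k" using that by metis
  qed
  have "mpoly_nat f = (\<Sum>n\<in>Poly_Mapping.keys f. Poly_Mapping.single (E n) (Poly_Mapping.lookup f n))"
    by (simp add: mpoly_nat_def mpoly_subst_def mpoly_var_power prod_single_1 mpoly_const_def mult_single E_def)
  then have "0 = (\<Sum>n\<in>Poly_Mapping.keys f. Poly_Mapping.lookup
      (Poly_Mapping.single (E n) (Poly_Mapping.lookup f n)) (E m))"
    using assms by (metis lookup_sum lookup_zero)
  also have "\<dots> = (\<Sum>n\<in>Poly_Mapping.keys f. if n = m then Poly_Mapping.lookup f m else 0)"
    using inj by (intro sum.cong) (auto simp: lookup_single when_def)
  also have "\<dots> = Poly_Mapping.lookup f m" by (auto simp: in_keys_iff)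
  finally show "Poly_Mapping.lookup f m = Poly_Mapping.lookup 0 m" by simp
qed

definition embed :: "('v::finite, real) mpoly \<Rightarrow> big_field" where
  "embed f = to_ac (to_fract (mpoly_nat f))"

lemma ring_map_mpoly_nat: "ring_map mpoly_nat"
  unfolding mpoly_nat_def by (rule ring_map_mpoly_subst[OF ring_map_mpoly_const])

lemma ring_map_embed: "ring_map embed"
  unfolding ring_map_def embed_def by (simp add: ring_mapD[OF ring_map_mpoly_nat])

lemma embed_eq_0: "embed f = 0 \<longleftrightarrow> f = 0"
  using mpoly_nat_eq_0[of f] ring_mapD(4)[OF ring_map_embed] by (auto simp: embed_def)

lemma embed_inject: "embed f = embed g \<longleftrightarrow> f = g"
  using embed_eq_0[of "f - g"] by (simp add: ring_mapD[OF ring_map_embed])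

text \<open>The index type \<open>'v\<close> carries no order, so the absence of zero divisors is
  inherited from the field through \<open>embed\<close>.\<close>

lemma mpoly_mult_eq_0:
  fixes f g :: "('v::finite, real) mpoly"
  shows "f * g = 0 \<longleftrightarrow> f = 0 \<or> g = 0"
  using embed_eq_0[of "f * g"] embed_eq_0[of f] embed_eq_0[of g] ring_mapD(3)[OF ring_map_embed, of f g]
  by auto

section \<open>Preorderings of polynomials and their cones of fractions\<close>

lemma ring_preordering_hullD:
  fixes G :: "'a::comm_ring_1 set"
  shows "a \<in> ring_preordering hull G \<Longrightarrow> b \<in> ring_preordering hull G \<Longrightarrow> a + b \<in> ring_preordering hull G"
    "a \<in> ring_preordering hull G \<Longrightarrow> b \<in> ring_preordering hull G \<Longrightarrow> a * b \<in> ring_preordering hull G"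
    "a\<^sup>2 \<in> ring_preordering hull G" "0 \<in> ring_preordering hull G" "1 \<in> ring_preordering hull G"
proof -
  note R = iffD1[OF ring_preordering_def ring_preordering_hull[of G]]
  from R show "a \<in> ring_preordering hull G \<Longrightarrow> b \<in> ring_preordering hull G \<Longrightarrow> a + b \<in> ring_preordering hull G"
    by simp
  from R show "a \<in> ring_preordering hull G \<Longrightarrow> b \<in> ring_preordering hull G \<Longrightarrow> a * b \<in> ring_preordering hull G"
    by simp
  from R have sq: "a\<^sup>2 \<in> ring_preordering hull G" for a by simp
  from sq[of a] sq[of 0] sq[of 1]
  show "a\<^sup>2 \<in> ring_preordering hull G" "0 \<in> ring_preordering hull G" "1 \<in> ring_preordering hull G"
    by simp_all
qed

text \<open>Degenerate means that the preordering generated in the field of rational functions is improper.\<close>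

definition degenerate :: "('v::finite, real) mpoly set \<Rightarrow> bool" where
  "degenerate G \<longleftrightarrow> (\<exists>b. b \<noteq> 0 \<and> - b\<^sup>2 \<in> ring_preordering hull G)"

text \<open>The preordering that \<open>G\<close> generates in the field of fractions. A square
  denominator leaves the sign to \<open>t\<close>, and for \<open>- 1\<close> to have this form is
  exactly degeneracy of \<open>G\<close>.\<close>

definition fraction_cone :: "('v::finite, real) mpoly set \<Rightarrow> big_field set" where
  "fraction_cone G = {embed t * inverse ((embed b)\<^sup>2) | t (b :: ('v, real) mpoly).
     t \<in> ring_preordering hull G \<and> b \<noteq> 0}"

lemma pos_cone_fraction_cone:
  fixes G :: "('v::finite, real) mpoly set"
  assumes "\<not> degenerate G"
  shows "pos_cone (fraction_cone G)"
proof -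
  let ?T = "ring_preordering hull G" and ?e = "embed :: ('v, real) mpoly \<Rightarrow> big_field"
  note hom = ring_mapD[OF ring_map_embed] and T = ring_preordering_hullD[where G = G]
  have I: "x \<in> fraction_cone G" if "x * (?e b)\<^sup>2 = ?e t" "t \<in> ?T" "b \<noteq> 0" for x t b
  proof -
    have "?e b \<noteq> 0" using that(3) embed_eq_0 by blast
    then have "x = ?e t * inverse ((?e b)\<^sup>2)" unfolding that(1)[symmetric] by simp
    then show ?thesis unfolding fraction_cone_def using that(2,3) by blast
  qed
  have D: "\<exists>t b. x * (?e b)\<^sup>2 = ?e t \<and> t \<in> ?T \<and> b \<noteq> 0" if x: "x \<in> fraction_cone G" for x
  proof -
    obtain t b where "x = ?e t * inverse ((?e b)\<^sup>2)" "t \<in> ?T" "b \<noteq> 0"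
      using x unfolding fraction_cone_def by blast
    moreover from this have "?e b \<noteq> 0" using embed_eq_0 by blast
    ultimately show ?thesis by (intro exI[of _ t] exI[of _ b]) simp
  qed
  show ?thesis
    unfolding pos_cone_def
  proof (intro conjI ballI)
    show "1 \<in> fraction_cone G" by (rule I[of _ 1 1]) (simp_all add: hom T)
    show "- 1 \<notin> fraction_cone G"
    proof
      assume "- 1 \<in> fraction_cone G"
      then obtain t b where tb: "- 1 * (?e b)\<^sup>2 = ?e t" "t \<in> ?T" "b \<noteq> 0" using D by blast
      then have "?e (- b\<^sup>2) = ?e t" by (simp add: hom)
      then have "- b\<^sup>2 = t" by (simp only: embed_inject)
      then show False using assms tb by (auto simp: degenerate_def)
    qed
    fix x assume "x \<in> fraction_cone G"
    then obtain t b where x: "x * (?e b)\<^sup>2 = ?e t" "t \<in> ?T" "b \<noteq> 0" using D by blast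
    show "inverse x \<in> fraction_cone G"
    proof (cases "x = 0")
      case True
      then show ?thesis by (intro I[of _ 1 0]) (simp_all add: hom T)
    next
      case False
      have "?e b \<noteq> 0" using x(3) embed_eq_0 by blast
      then have "?e t \<noteq> 0" using False x(1) by (metis mult_eq_0_iff power_eq_0_iff)
      then have "t \<noteq> 0" using embed_eq_0 by blast
      show ?thesis
      \<comment> \<open>The inverse \<open>b^2 / t\<close> is written as
        \<open>t * b^2 / t^2\<close>, so that its denominator is a square again.\<close>
      proof (rule I[of _ t "t * b\<^sup>2"])
        have "inverse x * (?e t)\<^sup>2 = (inverse x * x) * (?e b)\<^sup>2 * ?e t"
          unfolding x(1)[symmetric] by (simp only: power2_eq_square ac_simps)
        then show "inverse x * (?e t)\<^sup>2 = ?e (t * b\<^sup>2)" using False by (simp add: hom ac_simps)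
      qed (use x(2) \<open>t \<noteq> 0\<close> T(2,3) in auto)
    qed
    fix y assume "y \<in> fraction_cone G"
    then obtain s c where y: "y * (?e c)\<^sup>2 = ?e s" "s \<in> ?T" "c \<noteq> 0" using D by blast
    have bc: "b * c \<noteq> 0" using x(3) y(3) mpoly_mult_eq_0 by blast
    have bc2: "(b * c)\<^sup>2 \<noteq> 0" using bc mpoly_mult_eq_0 unfolding power2_eq_square by blast
    have xc: "x * (?e (b * c))\<^sup>2 = ?e (t * c\<^sup>2)"
      by (simp add: hom x(1)[symmetric] power_mult_distrib ac_simps)
    have yb: "y * (?e (b * c))\<^sup>2 = ?e (s * b\<^sup>2)"
      by (simp add: hom y(1)[symmetric] power_mult_distrib ac_simps)
    show "x + y \<in> fraction_cone G"
    proof (rule I[OF _ _ bc])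
      show "(x + y) * (?e (b * c))\<^sup>2 = ?e (t * c\<^sup>2 + s * b\<^sup>2)"
        unfolding distrib_right xc yb by (simp add: hom)
    qed (intro T x y)
    show "x * y \<in> fraction_cone G"
    proof (rule I[OF _ _ bc])
      show "(x * y) * (?e (b * c))\<^sup>2 = ?e (t * s)"
        by (simp add: hom x(1)[symmetric] y(1)[symmetric] power_mult_distrib ac_simps)
    qed (intro T x y)
    show "(x - y)\<^sup>2 \<in> fraction_cone G"
    proof (rule I[OF _ _ bc2])
      have "(x - y)\<^sup>2 * (?e ((b * c)\<^sup>2))\<^sup>2 = ((x - y) * (?e (b * c))\<^sup>2)\<^sup>2"
        by (simp add: hom power_mult_distrib)
      also have "\<dots> = ?e ((t * c\<^sup>2 - s * b\<^sup>2)\<^sup>2)"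
        unfolding left_diff_distrib xc yb by (simp add: hom)
      finally show "(x - y)\<^sup>2 * (?e ((b * c)\<^sup>2))\<^sup>2 = ?e ((t * c\<^sup>2 - s * b\<^sup>2)\<^sup>2)" .
    qed (rule T)
  qed
qed

definition real_embed :: "real \<Rightarrow> big_field" where
  "real_embed c = to_ac (to_fract (mpoly_const c))"

text \<open>A cone that exists unconditionally; it supplies a field when there is no counterexample
  to start from.\<close>

lemma pos_cone_real: "pos_cone (real_embed ` {0..})"
proof -
  have hom: "ring_map real_embed"
    unfolding ring_map_def real_embed_def by (simp add: ring_mapD[OF ring_map_mpoly_const])
  have inj: "c = d" if "real_embed c = real_embed d" for c d
  proof -
    have "(mpoly_const c :: (nat, real) mpoly) = mpoly_const d"
      using that by (simp add: real_embed_def)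
    from arg_cong[OF this, of "\<lambda>p. Poly_Mapping.lookup p 0"] show ?thesis
      unfolding mpoly_const_def lookup_single_eq .
  qed
  have I: "x \<in> real_embed ` {0..}" if "x = real_embed c" "0 \<le> c" for x c using that by auto
  show ?thesis
    unfolding pos_cone_def
  proof (intro conjI ballI)
    show "1 \<in> real_embed ` {0..}" by (rule I[of _ 1]) (simp_all add: ring_mapD[OF hom])
    show "- 1 \<notin> real_embed ` {0..}"
    proof
      assume "- 1 \<in> real_embed ` {0..}"
      then obtain c where "real_embed c = - 1" "0 \<le> c" by auto
      then have "real_embed c = real_embed (- 1)" by (simp add: ring_mapD[OF hom])
      from inj[OF this] \<open>0 \<le> c\<close> show False by simp
    qed
    fix x assume "x \<in> real_embed ` {0..}"
    then obtain c where c: "x = real_embed c" "0 \<le> c" by auto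
    show "inverse x \<in> real_embed ` {0..}"
    proof (cases "c = 0")
      case True
      then show ?thesis using c by (intro I[of _ 0]) (simp_all add: ring_mapD[OF hom])
    next
      case False
      have "x * real_embed (inverse c) = real_embed (c * inverse c)"
        unfolding c(1) ring_mapD(3)[OF hom] ..
      also have "\<dots> = 1" using False by (simp add: ring_mapD(1)[OF hom])
      finally have "x * real_embed (inverse c) = 1" .
      then show ?thesis using c by (intro I[of _ "inverse c"]) (simp_all add: inverse_unique)
    qed
    fix y assume "y \<in> real_embed ` {0..}"
    then obtain d where d: "y = real_embed d" "0 \<le> d" by auto
    show "x + y \<in> real_embed ` {0..}" using c d by (intro I[of _ "c + d"]) (simp_all add: ring_mapD[OF hom])
    show "x * y \<in> real_embed ` {0..}" using c d by (intro I[of _ "c * d"]) (simp_all add: ring_mapD[OF hom])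
    show "(x - y)\<^sup>2 \<in> real_embed ` {0..}" using c d by (intro I[of _ "(c - d)\<^sup>2"]) (simp_all add: ring_mapD[OF hom])
  qed
qed

text \<open>Zero is exempt: it lies in every preordering, so non-degeneracy cannot keep it out of
  \<open>G\<close>.\<close>

definition realizable :: "('v::finite, real) mpoly set \<Rightarrow> bool" where
  "realizable G \<longleftrightarrow> (\<exists>x. \<forall>g\<in>G. g \<noteq> 0 \<longrightarrow> 0 < mpoly_eval x g)"

text \<open>
  A type definition cannot depend on the variables of a proof. Therefore the ordered field is built from
  a globally chosen counterexample to the Artin-Lang theorem, if there is one.
\<close>

definition critical :: "('v::finite, real) mpoly set \<Rightarrow> bool" where
  "critical G \<longleftrightarrow> finite G \<and> \<not> degenerate G \<and> \<not> realizable G"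

definition critical_set :: "('v::finite, real) mpoly set" where
  "critical_set = (SOME G. critical G)"

text \<open>The argument of type \<open>'v itself\<close> records the index type, which
  \<open>big_field\<close> does not mention. The condition is an implication, so that a maximal cone
  can be chosen whether or not there is a counterexample.\<close>

definition critical_cone :: "'v::finite itself \<Rightarrow> big_field set" where
  "critical_cone _ = (SOME P. max_cone P \<and>
     (critical (critical_set :: ('v, real) mpoly set) \<longrightarrow>
      fraction_cone (critical_set :: ('v, real) mpoly set) \<subseteq> P))"

lemma critical_cone:
  shows "max_cone (critical_cone TYPE('v::finite))"
    and "critical (critical_set :: ('v, real) mpoly set) \<Longrightarrow>
      fraction_cone (critical_set :: ('v, real) mpoly set) \<subseteq> critical_cone TYPE('v)"
proof -
  have "\<exists>P. max_cone P \<and> (critical (critical_set :: ('v, real) mpoly set) \<longrightarrow>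
      fraction_cone (critical_set :: ('v, real) mpoly set) \<subseteq> P)"
  proof (cases "critical (critical_set :: ('v, real) mpoly set)")
    case True
    then have "pos_cone (fraction_cone (critical_set :: ('v, real) mpoly set))"
      by (intro pos_cone_fraction_cone) (simp add: critical_def)
    from max_cone_exists[OF this] show ?thesis by blast
  next
    case False
    with max_cone_exists[OF pos_cone_real] show ?thesis by blast
  qed
  from someI_ex[OF this]
  show "max_cone (critical_cone TYPE('v))"
    and "critical (critical_set :: ('v, real) mpoly set) \<Longrightarrow>
      fraction_cone (critical_set :: ('v, real) mpoly set) \<subseteq> critical_cone TYPE('v)"
    unfolding critical_cone_def by auto
qed

section \<open>The real closed field of a maximal cone\<close>

typedef (overloaded) ('v::finite) ordered_closure = "differences (critical_cone TYPE('v))"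
  using subring_onD(1)[OF max_coneD(3)[OF critical_cone(1)]] by blast

setup_lifting type_definition_ordered_closure

lemmas critical_cone_props = pos_coneD[OF max_coneD(1)[OF critical_cone(1)]]
lemmas critical_field_closed = subring_onD[OF max_coneD(3)[OF critical_cone(1)]]

lemma critical_field_inverse:
  "x \<in> differences (critical_cone TYPE('v::finite)) \<Longrightarrow> inverse x \<in> differences (critical_cone TYPE('v))"
  using max_coneD(2)[OF critical_cone(1)[where 'v = 'v]] by (simp add: subfield_on_def)

instantiation ordered_closure :: (finite) field
begin

lift_definition zero_ordered_closure :: "'a ordered_closure" is 0 by (rule critical_field_closed)
lift_definition one_ordered_closure :: "'a ordered_closure" is 1 by (rule critical_field_closed)
lift_definition plus_ordered_closure :: "'a ordered_closure \<Rightarrow> 'a ordered_closure \<Rightarrow> 'a ordered_closure"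
  is "(+)" by (rule critical_field_closed)
lift_definition minus_ordered_closure :: "'a ordered_closure \<Rightarrow> 'a ordered_closure \<Rightarrow> 'a ordered_closure"
  is "(-)" by (rule critical_field_closed)
lift_definition times_ordered_closure :: "'a ordered_closure \<Rightarrow> 'a ordered_closure \<Rightarrow> 'a ordered_closure"
  is "(*)" by (rule critical_field_closed)
lift_definition uminus_ordered_closure :: "'a ordered_closure \<Rightarrow> 'a ordered_closure"
  is uminus by (rule critical_field_closed)
lift_definition inverse_ordered_closure :: "'a ordered_closure \<Rightarrow> 'a ordered_closure"
  is inverse by (rule critical_field_inverse)
definition divide_ordered_closure :: "'a ordered_closure \<Rightarrow> 'a ordered_closure \<Rightarrow> 'a ordered_closure" where
  "divide_ordered_closure x y = x * inverse y"

instance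
proof
  note rep = Rep_ordered_closure_inject[symmetric] zero_ordered_closure.rep_eq one_ordered_closure.rep_eq
    plus_ordered_closure.rep_eq minus_ordered_closure.rep_eq times_ordered_closure.rep_eq
    uminus_ordered_closure.rep_eq inverse_ordered_closure.rep_eq
  fix a b c :: "'a ordered_closure"
  show "a * b * c = a * (b * c)" unfolding rep by (rule mult.assoc)
  show "a * b = b * a" unfolding rep by (rule mult.commute)
  show "a + b + c = a + (b + c)" unfolding rep by (rule add.assoc)
  show "a + b = b + a" unfolding rep by (rule add.commute)
  show "(a + b) * c = a * c + b * c" unfolding rep by (rule distrib_right)
  show "1 * a = a" "0 + a = a" "- a + a = 0" "a - b = a + - b" "inverse (0 :: 'a ordered_closure) = 0"
    "(0 :: 'a ordered_closure) \<noteq> 1"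
    unfolding rep by simp_all
  show "a \<noteq> 0 \<Longrightarrow> inverse a * a = 1" unfolding rep by simp
  show "a div b = a * inverse b" by (fact divide_ordered_closure_def)
qed

end

lift_definition nonneg_closure :: "'a::finite ordered_closure \<Rightarrow> bool" is "\<lambda>x. x \<in> critical_cone TYPE('a)" .

lemma nonneg_closure:
  fixes x y :: "'a::finite ordered_closure"
  shows "nonneg_closure 0" "nonneg_closure x \<Longrightarrow> nonneg_closure y \<Longrightarrow> nonneg_closure (x + y)"
    "nonneg_closure x \<Longrightarrow> nonneg_closure y \<Longrightarrow> nonneg_closure (x * y)"
    "nonneg_closure x \<Longrightarrow> nonneg_closure (- x) \<Longrightarrow> x = 0" "nonneg_closure x \<or> nonneg_closure (- x)"
  by (transfer, rule critical_cone_props(6), transfer, rule critical_cone_props(3), assumption+,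
      transfer, rule critical_cone_props(4), assumption+, transfer, erule (1) critical_cone_props(9),
      transfer, use max_cone_total[OF critical_cone(1)] in blast)

instantiation ordered_closure :: (finite) linordered_field
begin

definition less_eq_ordered_closure :: "'a ordered_closure \<Rightarrow> 'a ordered_closure \<Rightarrow> bool" where
  "less_eq_ordered_closure x y \<longleftrightarrow> nonneg_closure (y - x)"
definition less_ordered_closure :: "'a ordered_closure \<Rightarrow> 'a ordered_closure \<Rightarrow> bool" where
  "less_ordered_closure x y \<longleftrightarrow> nonneg_closure (y - x) \<and> x \<noteq> y"
definition abs_ordered_closure :: "'a ordered_closure \<Rightarrow> 'a ordered_closure" where
  "abs_ordered_closure x = (if x < 0 then - x else x)"
definition sgn_ordered_closure :: "'a ordered_closure \<Rightarrow> 'a ordered_closure" where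
  "sgn_ordered_closure x = (if x = 0 then 0 else if 0 < x then 1 else - 1)"

instance
proof
  fix x y z :: "'a ordered_closure"
  show le_anti: "x \<le> y \<Longrightarrow> y \<le> x \<Longrightarrow> x = y" for x y :: "'a ordered_closure"
    using nonneg_closure(4)[of "y - x"] by (simp add: less_eq_ordered_closure_def)
  show "x < y \<longleftrightarrow> x \<le> y \<and> \<not> y \<le> x"
    using le_anti[of x y] nonneg_closure(1)
    by (auto simp: less_ordered_closure_def less_eq_ordered_closure_def)
  show "x \<le> x" by (simp add: less_eq_ordered_closure_def nonneg_closure(1))
  show "x \<le> y \<Longrightarrow> y \<le> z \<Longrightarrow> x \<le> z"
    using nonneg_closure(2)[of "y - x" "z - y"] by (simp add: less_eq_ordered_closure_def)
  show "x \<le> y \<or> y \<le> x"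
    using nonneg_closure(5)[of "y - x"] by (simp add: less_eq_ordered_closure_def)
  show "x \<le> y \<Longrightarrow> z + x \<le> z + y" by (simp add: less_eq_ordered_closure_def)
  show "x < y \<Longrightarrow> 0 < z \<Longrightarrow> z * x < z * y"
    using nonneg_closure(3)[of z "y - x"] by (auto simp: less_ordered_closure_def right_diff_distrib)
  show "\<bar>x\<bar> = (if x < 0 then - x else x)" by (fact abs_ordered_closure_def)
  show "sgn x = (if x = 0 then 0 else if 0 < x then 1 else - 1)" by (fact sgn_ordered_closure_def)
qed

end

lemma neg_in_closure:
  fixes x :: "'a::finite ordered_closure"
  shows "neg_in (critical_cone TYPE('a)) (Rep_ordered_closure x) \<longleftrightarrow> x < 0"
proof -
  have "Rep_ordered_closure x = 0 \<longleftrightarrow> x = 0" by transfer simp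
  moreover have "- Rep_ordered_closure x \<in> critical_cone TYPE('a) \<longleftrightarrow> nonneg_closure (- x)"
    by transfer simp
  ultimately show ?thesis by (auto simp: neg_in_def less_ordered_closure_def)
qed

lemma ring_map_Rep: "ring_map (Rep_ordered_closure :: 'a::finite ordered_closure \<Rightarrow> big_field)"
  by (simp add: ring_map_def one_ordered_closure.rep_eq plus_ordered_closure.rep_eq times_ordered_closure.rep_eq)

instance ordered_closure :: (finite) real_closed_field
proof
  fix a b :: "'a ordered_closure" and f n
  let ?P = "critical_cone TYPE('a)" and ?R = "Rep_ordered_closure :: 'a ordered_closure \<Rightarrow> big_field"
  define p where "p = (\<Sum>k\<le>n. monom (f k :: 'a ordered_closure) k)"
  have p: "(\<Sum>k\<le>n. f k * x ^ k) = poly p x" for x by (simp add: p_def poly_sum poly_monom)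
  note hom = ring_map_Rep[where 'a = 'a]
  assume ab: "a < b" "(\<Sum>k\<le>n. f k * a ^ k) < 0" "0 < (\<Sum>k\<le>n. f k * b ^ k)"
  have "poly p a * poly p b < 0" using ab(2,3) unfolding p by (rule mult_neg_pos)
  then have "neg_in ?P (poly (map_poly ?R p) (?R a) * poly (map_poly ?R p) (?R b))"
    unfolding poly_map_poly_ring_map[OF hom] ring_mapD(3)[OF hom, symmetric] neg_in_closure .
  moreover have "map_poly ?R p \<in> polys_over (differences ?P)"
    using Rep_ordered_closure by (auto simp: polys_over_def coeff_map_poly ring_mapD[OF hom])
  ultimately obtain x where x: "x \<in> differences ?P" "poly (map_poly ?R p) x = 0" "neg_in ?P ((?R a - x) * (?R b - x))"
    using max_cone_IVT[OF critical_cone(1)[where 'v = 'a] Rep_ordered_closure[of a] Rep_ordered_closure[of b]] by metis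
  obtain y where y: "x = ?R y" using x(1) by (metis Abs_ordered_closure_inverse)
  have "?R (poly p y) = 0" using x(2) unfolding y poly_map_poly_ring_map[OF hom] .
  then have "?R (poly p y) = ?R 0" by (simp add: ring_mapD[OF hom])
  then have "poly p y = 0" by (simp only: Rep_ordered_closure_inject)
  moreover have "(a - y) * (b - y) < 0"
    using x(3) unfolding y ring_mapD(3,6)[OF hom, symmetric] neg_in_closure .
  then have "a < y" "y < b" using ab(1) by (auto simp: mult_less_0_iff)
  ultimately show "\<exists>x. a < x \<and> x < b \<and> (\<Sum>k\<le>n. f k * x ^ k) = 0" unfolding p by blast
qed

section \<open>Polynomials in a chosen set of variables\<close>

inductive_set polys_in :: "'v set \<Rightarrow> ('v::finite, real) mpoly set" for J where
  const: "mpoly_const c \<in> polys_in J"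
| var: "i \<in> J \<Longrightarrow> mpoly_var i \<in> polys_in J"
| add: "f \<in> polys_in J \<Longrightarrow> g \<in> polys_in J \<Longrightarrow> f + g \<in> polys_in J"
| mult: "f \<in> polys_in J \<Longrightarrow> g \<in> polys_in J \<Longrightarrow> f * g \<in> polys_in J"

lemma subring_on_polys_in: "subring_on (polys_in J)"
proof -
  note const_hom = ring_mapD[OF ring_map_mpoly_const]
  have "f - g \<in> polys_in J" if "f \<in> polys_in J" "g \<in> polys_in J" for f g
  proof -
    have "f + mpoly_const (- 1) * g \<in> polys_in J" by (intro polys_in.intros that)
    then show ?thesis by (simp add: const_hom)
  qed
  moreover have "1 \<in> polys_in J" using polys_in.const[of 1 J] by (simp add: const_hom)
  ultimately show ?thesis by (simp add: subring_on_def polys_in.mult)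
qed

lemma polys_in_UNIV: "f \<in> polys_in UNIV"
proof (induction f rule: mpoly_induct)
  case zero
  show ?case by (rule subring_onD[OF subring_on_polys_in])
next
  case (add f g)
  then show ?case by (rule polys_in.add)
next
  case (single m c)
  have "(\<Prod>i\<in>A. mpoly_var i ^ Poly_Mapping.lookup m i) \<in> polys_in UNIV" for A
    by (induction A rule: infinite_finite_induct)
       (auto intro!: subring_onD[OF subring_on_polys_in] polys_in.var)
  then show ?case unfolding mpoly_monomial[of m] by (intro polys_in.mult polys_in.const)
qed

lemma polys_in_insert:
  assumes "f \<in> polys_in (insert v J)"
  shows "\<exists>p\<in>polys_over (polys_in J). f = poly p (mpoly_var v)"
proof -
  note S = subring_on_polys_in[of J]
  note R = subring_on_polys_over[OF S]
  show ?thesis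
    using assms
  proof (induction f rule: polys_in.induct)
    case (const c)
    show ?case
      by (rule bexI[of _ "[:mpoly_const c:]"])
         (simp, intro polys_over_intros(1)[OF S] polys_in.const subring_onD(1)[OF R])
  next
    case (var i)
    show ?case
    proof (cases "i = v")
      case True
      show ?thesis
        by (rule bexI[of _ "[:0, 1:]"])
           (use True in simp, intro polys_over_intros(1)[OF S] subring_onD(1,2)[OF S] subring_onD(1)[OF R])
    next
      case False
      then have "i \<in> J" using var by simp
      show ?thesis
        by (rule bexI[of _ "[:mpoly_var i:]"])
           (simp, intro polys_over_intros(1)[OF S] polys_in.var \<open>i \<in> J\<close> subring_onD(1)[OF R])
    qed
  next
    case (add f g)
    then obtain p q where "p \<in> polys_over (polys_in J)" "q \<in> polys_over (polys_in J)"
      "f = poly p (mpoly_var v)" "g = poly q (mpoly_var v)" by blast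
    then show ?case using subring_onD(3)[OF R, of p q] by (intro bexI[of _ "p + q"]) simp_all
  next
    case (mult f g)
    then obtain p q where "p \<in> polys_over (polys_in J)" "q \<in> polys_over (polys_in J)"
      "f = poly p (mpoly_var v)" "g = poly q (mpoly_var v)" by blast
    then show ?case using subring_onD(4)[OF R, of p q] by (intro bexI[of _ "p * q"]) simp_all
  qed
qed

lemma mpoly_eval_cong:
  assumes "f \<in> polys_in J" "\<And>i. i \<in> J \<Longrightarrow> x $ i = y $ i"
  shows "mpoly_eval x f = mpoly_eval y f"
  using assms by (induction f rule: polys_in.induct) (simp_all add: ring_mapD[OF ring_map_mpoly_eval])

lemma polys_in_empty: "f \<in> polys_in {} \<Longrightarrow> \<exists>c. f = mpoly_const c"
proof (induction f rule: polys_in.induct)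
  case (add f g)
  then show ?case using ring_mapD(2)[OF ring_map_mpoly_const] by metis
next
  case (mult f g)
  then show ?case using ring_mapD(3)[OF ring_map_mpoly_const] by metis
qed auto

text \<open>For \<open>c\<close> one half, every element is a difference of two squares. This puts
  all polynomials into the field of a cone containing their squares, and it turns
  \<open>- b^2\<close> in a preordering into \<open>b^2 * f\<close> for every
  \<open>f\<close>.\<close>

lemma difference_of_squares:
  fixes f c :: "'a::comm_ring_1"
  assumes "c + c = 1"
  shows "(c * (f + 1))\<^sup>2 - (c * (f - 1))\<^sup>2 = f"
proof -
  have "(c * (f + 1))\<^sup>2 - (c * (f - 1))\<^sup>2 = (c + c) * (c + c) * f"
    by (simp add: power2_eq_square algebra_simps)
  then show ?thesis using assms by simp
qed

lemma half_mpoly: "mpoly_const (1 / 2) + mpoly_const (1 / 2) = (1 :: ('v, real) mpoly)"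
proof -
  have hom: "ring_map (mpoly_const :: real \<Rightarrow> ('v, real) mpoly)" by (rule ring_map_mpoly_const)
  show ?thesis unfolding ring_mapD(2)[OF hom, symmetric] by (simp add: ring_mapD(1)[OF hom])
qed

lemma artin_lang:
  fixes G :: "('v::finite, real) mpoly set"
  assumes "finite G" "\<not> degenerate G"
  shows "realizable G"
proof (rule ccontr)
  assume "\<not> realizable G"
  then have "critical G" using assms by (simp add: critical_def)
  \<comment> \<open>\<open>G\<close> only shows that some counterexample exists. From here on the
    argument runs with the chosen one, because \<open>ordered_closure\<close> is built from
    it.\<close>
  then have crit: "critical (critical_set :: ('v, real) mpoly set)"
    unfolding critical_set_def by (rule someI)
  define H where "H = (critical_set :: ('v, real) mpoly set)"
  define T where "T = ring_preordering hull H"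
  let ?P = "critical_cone TYPE('v)" and ?e = "embed :: ('v, real) mpoly \<Rightarrow> big_field"
  note hom = ring_mapD[OF ring_map_embed]
  have T: "?e t \<in> ?P" if "t \<in> T" for t
  proof -
    have "?e t * inverse ((?e (1 :: ('v, real) mpoly))\<^sup>2) \<in> fraction_cone H"
      unfolding fraction_cone_def using that[unfolded T_def]
      by (intro CollectI exI[of _ t] exI[of _ 1]) simp
    then have "?e t \<in> fraction_cone H" by (simp add: hom)
    then show ?thesis using critical_cone(2)[OF crit] by (auto simp: H_def)
  qed
  have mem: "?e f \<in> differences ?P" for f
  proof -
    let ?c = "mpoly_const (1 / 2)"
    have "?e ((?c * (f + 1))\<^sup>2) \<in> ?P" "?e ((?c * (f - 1))\<^sup>2) \<in> ?P"
      by (rule T, unfold T_def, rule ring_preordering_hullD(3))+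
    then have "?e ((?c * (f + 1))\<^sup>2) - ?e ((?c * (f - 1))\<^sup>2) \<in> differences ?P"
      unfolding differences_def by blast
    then show ?thesis unfolding hom(6)[symmetric] difference_of_squares[OF half_mpoly] .
  qed
  \<comment> \<open>The generic point: each polynomial is sent to itself, read as an element of the
    real closed field.\<close>
  define \<phi> :: "('v, real) mpoly \<Rightarrow> 'v ordered_closure" where "\<phi> f = Abs_ordered_closure (?e f)" for f
  have Rep: "Rep_ordered_closure (\<phi> f) = ?e f" for f
    unfolding \<phi>_def by (rule Abs_ordered_closure_inverse[OF mem])
  have \<phi>: "ring_map \<phi>"
    unfolding ring_map_def
    by (simp add: Rep_ordered_closure_inject[symmetric] Rep hom one_ordered_closure.rep_eq
        plus_ordered_closure.rep_eq times_ordered_closure.rep_eq)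
  have \<phi>0: "\<phi> f = 0 \<longleftrightarrow> f = 0" for f
    by (simp add: Rep_ordered_closure_inject[symmetric] Rep zero_ordered_closure.rep_eq embed_eq_0)
  have pos: "0 < \<phi> t" if "t \<in> T" "t \<noteq> 0" for t
  proof -
    have "nonneg_closure (\<phi> t)" unfolding nonneg_closure.rep_eq Rep by (rule T[OF that(1)])
    then show ?thesis using that(2) \<phi>0[of t] by (auto simp: less_ordered_closure_def)
  qed
  \<comment> \<open>A positive real constant is a square, so the ordering respects the signs of real
    constants. This is the base of the transfer, where no variable is left.\<close>
  have const_pos: "0 < \<phi> (mpoly_const c)" if "0 < c" for c
  proof (rule pos)
    have "mpoly_const c = (mpoly_const (sqrt c))\<^sup>2"
      using that by (simp flip: ring_mapD(7)[OF ring_map_mpoly_const])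
    then show "mpoly_const c \<in> T" unfolding T_def using ring_preordering_hullD(3) by metis
    show "mpoly_const c \<noteq> (0 :: ('v, real) mpoly)"
    proof
      assume "mpoly_const c = (0 :: ('v, real) mpoly)"
      from arg_cong[OF this, of "mpoly_eval 0"] show False
        using that by (simp add: ring_mapD(4)[OF ring_map_mpoly_eval])
    qed
  qed
  have const: "sg (\<phi> (mpoly_const c)) = sg c" for c
  proof (cases c "0::real" rule: linorder_cases)
    case less
    have "mpoly_const (- c) = - (mpoly_const c :: ('v, real) mpoly)"
      by (rule ring_mapD(5)[OF ring_map_mpoly_const])
    then have "0 < - \<phi> (mpoly_const c)"
      using const_pos[of "- c"] less ring_mapD(5)[OF \<phi>, of "mpoly_const c"] by simp
    with less show ?thesis by (simp add: sg_def)
  next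
    case equal
    then show ?thesis by (simp add: ring_mapD[OF \<phi>] ring_mapD[OF ring_map_mpoly_const])
  next
    case greater
    then show ?thesis using const_pos[of c] by (simp add: sg_def)
  qed
  \<comment> \<open>Real coordinates are found one variable at a time. The induction hypothesis
    gives \<open>x0\<close> with the right signs on the conditions \<open>B\<close> for the
    coefficients; these allow the generic value of \<open>v\<close> to be replaced by a real number
    \<open>y\<close>.\<close>
  have transfer: "\<exists>x::real^'v. \<forall>f\<in>F. sg (\<phi> f) = sg (mpoly_eval x f)" if "finite J" "finite F" "F \<subseteq> polys_in J" for J F
    using that
  proof (induction J arbitrary: F rule: finite_induct)
    case empty
    have "sg (\<phi> f) = sg (mpoly_eval 0 f)" if "f \<in> F" for f
    proof -
      obtain c where "f = mpoly_const c" using empty.prems(2) \<open>f \<in> F\<close> polys_in_empty by blast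
      then show ?thesis using const by simp
    qed
    then show ?case by blast
  next
    case (insert v J)
    have "\<forall>f\<in>F. \<exists>p. p \<in> polys_over (polys_in J) \<and> f = poly p (mpoly_var v)"
      using insert.prems(2) polys_in_insert by blast
    then obtain p where p: "\<And>f. f \<in> F \<Longrightarrow> p f \<in> polys_over (polys_in J)"
      "\<And>f. f \<in> F \<Longrightarrow> f = poly (p f) (mpoly_var v)" by (metis (no_types))
    have pF: "finite (p ` F)" "p ` F \<subseteq> polys_over (polys_in J)" using insert.prems(1) p(1) by auto
    obtain B where B: "finite B" "B \<subseteq> polys_in J"
      "\<And>(\<psi> :: ('v, real) mpoly \<Rightarrow> real) x. ring_map \<psi> \<Longrightarrow> (\<And>b. b \<in> B \<Longrightarrow> sg (\<phi> b) = sg (\<psi> b)) \<Longrightarrow>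
        \<exists>y. \<forall>f\<in>p ` F. sg (poly (map_poly \<phi> f) x) = sg (poly (map_poly \<psi> f) y)"
      using sign_transfer[OF subring_on_polys_in \<phi> _ pF, where 'b = real] \<phi>0 by metis
    obtain x0 :: "real^'v" where x0: "\<And>b. b \<in> B \<Longrightarrow> sg (\<phi> b) = sg (mpoly_eval x0 b)"
      using insert.IH[OF B(1,2)] by blast
    obtain y where y: "\<And>f. f \<in> F \<Longrightarrow> sg (poly (map_poly \<phi> (p f)) (\<phi> (mpoly_var v))) =
        sg (poly (map_poly (mpoly_eval x0) (p f)) y)"
      using B(3)[OF ring_map_mpoly_eval x0, of "\<phi> (mpoly_var v)"] by blast
    define x where "x = (\<chi> i. if i = v then y else x0 $ i)"
    have "sg (\<phi> f) = sg (mpoly_eval x f)" if f: "f \<in> F" for f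
    proof -
      \<comment> \<open>The coefficients lie in \<open>polys_in J\<close> and \<open>v\<close> is
        not in \<open>J\<close>, so setting coordinate \<open>v\<close> to \<open>y\<close> does not
        disturb them.\<close>
      have "map_poly (mpoly_eval x0) (p f) = map_poly (mpoly_eval x) (p f)"
      proof (rule map_poly_cong)
        fix c assume "c \<in> set (coeffs (p f))"
        then have "c \<in> polys_in J" using polys_overD[OF p(1)[OF f]] by (auto simp: coeffs_def split: if_splits)
        then show "mpoly_eval x0 c = mpoly_eval x c"
          by (rule mpoly_eval_cong) (use insert.hyps in \<open>auto simp: x_def\<close>)
      qed
      moreover have "y = mpoly_eval x (mpoly_var v)" by (simp add: x_def)
      ultimately have "poly (map_poly (mpoly_eval x0) (p f)) y = mpoly_eval x (poly (p f) (mpoly_var v))"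
        by (simp only: poly_map_poly_ring_map[OF ring_map_mpoly_eval])
      also have "poly (p f) (mpoly_var v) = f" using p(2)[OF f] ..
      finally have "sg (poly (map_poly \<phi> (p f)) (\<phi> (mpoly_var v))) = sg (mpoly_eval x f)"
        using y[OF f] by simp
      then show ?thesis unfolding poly_map_poly_ring_map[OF \<phi>] p(2)[OF f, symmetric] .
    qed
    then show ?case by blast
  qed
  have "finite H" using crit by (simp add: critical_def H_def)
  moreover have "H \<subseteq> polys_in UNIV" using polys_in_UNIV by blast
  ultimately have "\<exists>x::real^'v. \<forall>f\<in>H. sg (\<phi> f) = sg (mpoly_eval x f)"
    by (rule transfer[OF finite_class.finite_UNIV])
  then obtain x :: "real^'v" where x: "\<And>f. f \<in> H \<Longrightarrow> sg (\<phi> f) = sg (mpoly_eval x f)"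
    by blast
  have "0 < mpoly_eval x g" if "g \<in> H" "g \<noteq> 0" for g
  proof -
    have "g \<in> T" unfolding T_def using that(1) by (rule hull_inc)
    then have "0 < \<phi> g" using that(2) by (rule pos)
    then show ?thesis using sg_eq_cong(2)[OF x[OF that(1)]] by simp
  qed
  then have "realizable H" unfolding realizable_def by blast
  then show False using crit by (simp add: critical_def H_def)
qed

text \<open>No real point makes \<open>- f\<close> and all nonzero elements of \<open>G\<close>
  positive, so \<open>insert (- f) G\<close> is degenerate: \<open>- b^2 = s - f * t\<close> with
  \<open>s\<close> and \<open>t\<close> in the preordering of \<open>G\<close>. Multiplying
  \<open>f * t = s + b^2\<close> by \<open>t\<close> puts \<open>t^2 * f\<close> into it.\<close>

lemma nonneg_imp_multiple_in_preordering:
  fixes G :: "('v::finite, real) mpoly set"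
  assumes "finite G" and nonneg: "\<And>x. x \<in> nonneg_set G \<Longrightarrow> 0 \<le> mpoly_eval x f"
  shows "\<exists>c. c \<noteq> 0 \<and> c\<^sup>2 * f \<in> ring_preordering hull G"
proof (cases "f = 0")
  case True
  then show ?thesis using ring_preordering_hullD(4) by (intro exI[of _ 1]) simp
next
  case False
  let ?T = "ring_preordering hull G"
  note T = ring_preordering_hullD[where G = G] and ev = ring_mapD[OF ring_map_mpoly_eval]
  have "\<not> realizable (insert (- f) G)"
  proof
    assume "realizable (insert (- f) G)"
    then obtain x where x: "\<And>g. g \<in> insert (- f) G \<Longrightarrow> g \<noteq> 0 \<Longrightarrow> 0 < mpoly_eval x g"
      unfolding realizable_def by blast
    have "0 \<le> mpoly_eval x g" if "g \<in> G" for g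
      using x[of g] that by (cases "g = 0") (auto simp: ev)
    then have "0 \<le> mpoly_eval x f" by (intro nonneg) (simp add: nonneg_set_def)
    then show False using x[of "- f"] False by (simp add: ev)
  qed
  then have "degenerate (insert (- f) G)" using artin_lang assms(1) by blast
  then obtain b where b: "b \<noteq> 0" "- b\<^sup>2 \<in> ring_preordering hull (insert (- f) G)"
    unfolding degenerate_def by blast
  define U where "U = {s - f * t | s t. s \<in> ?T \<and> t \<in> ?T}"
  have U: "s - f * t \<in> U" if "s \<in> ?T" "t \<in> ?T" for s t using that unfolding U_def by blast
  have "ring_preordering U"
    unfolding ring_preordering_def
  proof (intro conjI ballI allI)
    fix x y assume "x \<in> U" "y \<in> U"
    then obtain s t s' t' where *: "x = s - f * t" "y = s' - f * t'" "s \<in> ?T" "t \<in> ?T" "s' \<in> ?T" "t' \<in> ?T"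
      unfolding U_def by blast
    have "(s + s') - f * (t + t') \<in> U" by (intro U T *)
    then show "x + y \<in> U" unfolding *(1,2) by (simp add: algebra_simps)
    have "(s * s' + f\<^sup>2 * (t * t')) - f * (s * t' + t * s') \<in> U" by (intro U T *)
    then show "x * y \<in> U" unfolding *(1,2) by (simp add: algebra_simps power2_eq_square)
  next
    fix a
    have "a\<^sup>2 - f * 0 \<in> U" by (intro U T)
    then show "a\<^sup>2 \<in> U" by simp
  qed
  moreover have "insert (- f) G \<subseteq> U"
  proof
    fix g assume "g \<in> insert (- f) G"
    then consider "g = - f" | "g \<in> G" by blast
    then show "g \<in> U"
    proof cases
      case 1
      then show ?thesis using U[OF T(4,5)] by simp
    next
      case 2
      then show ?thesis using U[OF hull_inc[OF 2] T(4)] by simp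
    qed
  qed
  ultimately have "ring_preordering hull (insert (- f) G) \<subseteq> U" by (intro hull_minimal)
  then obtain s t where st: "- b\<^sup>2 = s - f * t" "s \<in> ?T" "t \<in> ?T" using b(2) unfolding U_def by blast
  have ft: "f * t = s + b\<^sup>2" using st(1) by (simp add: algebra_simps)
  show ?thesis
  proof (cases "t = 0")
    case True
    \<comment> \<open>For \<open>t = 0\<close> the multiplier is \<open>b\<close> instead. Since
      both \<open>b^2\<close> and \<open>- b^2\<close> are available, \<open>b^2\<close> times any
      difference of squares lies in the preordering, and \<open>f\<close> is such a
      difference.\<close>
    then have neg: "- b\<^sup>2 \<in> ?T" using st by simp
    let ?c = "mpoly_const (1 / 2)"
    have "b\<^sup>2 * (?c * (f + 1))\<^sup>2 + - b\<^sup>2 * (?c * (f - 1))\<^sup>2 \<in> ?T" by (intro T neg)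
    also have "b\<^sup>2 * (?c * (f + 1))\<^sup>2 + - b\<^sup>2 * (?c * (f - 1))\<^sup>2 =
        b\<^sup>2 * ((?c * (f + 1))\<^sup>2 - (?c * (f - 1))\<^sup>2)" by (simp only: right_diff_distrib) simp
    also have "\<dots> = b\<^sup>2 * f" unfolding difference_of_squares[OF half_mpoly] ..
    finally show ?thesis using b(1) by blast
  next
    case False
    have "t * (s + b\<^sup>2) \<in> ?T" by (intro T st)
    also have "t * (s + b\<^sup>2) = t\<^sup>2 * f" unfolding ft[symmetric] by (simp add: power2_eq_square ac_simps)
    finally show ?thesis using False by blast
  qed
qed

section \<open>Positive semidefinite polynomial matrices\<close>

definition outer :: "'a::comm_ring_1 ^ 'n \<Rightarrow> 'a ^ 'n ^ 'n" where
  "outer v = (\<chi> i j. v $ i * v $ j)"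

lemma matrix_moduleD:
  fixes B :: "'a::comm_ring_1 ^ 'n ^ 'n"
  assumes "B \<in> matrix_module M"
  shows "\<exists>(k :: nat) m (C :: nat \<Rightarrow> 'a ^ 'n ^ 'n).
    B = (\<Sum>i<k. map_matrix ((*) (m i)) (transpose (C i) ** C i)) \<and> (\<forall>i<k. m i \<in> M)"
  using assms unfolding matrix_module_def by simp

lemma matrix_module_add_single:
  fixes A B :: "'a::comm_ring_1 ^ 'n ^ 'n"
  assumes "B \<in> matrix_module M" "c \<in> M"
  shows "B + map_matrix ((*) c) (transpose A ** A) \<in> matrix_module M"
proof -
  obtain k :: nat and m and C :: "nat \<Rightarrow> 'a ^ 'n ^ 'n" where B: "B = (\<Sum>i<k. map_matrix ((*) (m i)) (transpose (C i) ** C i))"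
    "\<forall>i<k. m i \<in> M"
    using matrix_moduleD[OF assms(1)] by blast
  have "B + map_matrix ((*) c) (transpose A ** A) =
      (\<Sum>i<Suc k. map_matrix ((*) ((m(k := c)) i)) (transpose ((C(k := A)) i) ** (C(k := A)) i))"
    unfolding B(1) by simp
  moreover have "\<forall>i<Suc k. (m(k := c)) i \<in> M" using B(2) assms(2) by (auto simp: less_Suc_eq)
  ultimately show ?thesis
    unfolding matrix_module_def
    by (intro CollectI exI[of _ "Suc k"] exI[of _ "m(k := c)"] exI[of _ "C(k := A)"] conjI)
qed

lemma matrix_module_zero: "0 \<in> matrix_module M"
  unfolding matrix_module_def by (intro CollectI exI[of _ 0]) simp

lemma matrix_module_add:
  fixes B C :: "'a::comm_ring_1 ^ 'n ^ 'n"
  assumes "B \<in> matrix_module M" "C \<in> matrix_module M"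
  shows "B + C \<in> matrix_module M"
proof -
  obtain k :: nat and m and D :: "nat \<Rightarrow> 'a ^ 'n ^ 'n" where C: "C = (\<Sum>i<k. map_matrix ((*) (m i)) (transpose (D i) ** D i))"
    "\<forall>i<k. m i \<in> M"
    using matrix_moduleD[OF assms(2)] by blast
  have "l \<le> k \<Longrightarrow> B + (\<Sum>i<l. map_matrix ((*) (m i)) (transpose (D i) ** D i)) \<in> matrix_module M" for l
  proof (induction l)
    case (Suc l)
    then have "(B + (\<Sum>i<l. map_matrix ((*) (m i)) (transpose (D i) ** D i))) +
        map_matrix ((*) (m l)) (transpose (D l) ** D l) \<in> matrix_module M"
      using C(2) by (intro matrix_module_add_single) auto
    then show ?case by (simp add: add.assoc)
  qed (simp add: assms(1))
  then show ?thesis unfolding C(1) by blast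
qed

lemma matrix_module_scale:
  fixes B :: "'a::comm_ring_1 ^ 'n ^ 'n"
  assumes "B \<in> matrix_module M" "\<And>m. m \<in> M \<Longrightarrow> c * m \<in> M"
  shows "map_matrix ((*) c) B \<in> matrix_module M"
proof -
  obtain k :: nat and m and C :: "nat \<Rightarrow> 'a ^ 'n ^ 'n" where B: "B = (\<Sum>i<k. map_matrix ((*) (m i)) (transpose (C i) ** C i))"
    "\<forall>i<k. m i \<in> M"
    using matrix_moduleD[OF assms(1)] by blast
  have "map_matrix ((*) c) B = (\<Sum>i<k. map_matrix ((*) (c * m i)) (transpose (C i) ** C i))"
    unfolding B(1) by (simp add: vec_eq_iff map_matrix_def sum_component sum_distrib_left mult.assoc)
  moreover have "\<forall>i<k. c * m i \<in> M" using B(2) assms(2) by blast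
  ultimately show ?thesis
    unfolding matrix_module_def by (intro CollectI exI[of _ k] exI[of _ "\<lambda>i. c * m i"] exI[of _ C]) simp
qed

lemma outer_in_matrix_module:
  fixes v :: "'a::comm_ring_1 ^ 'n"
  assumes "c \<in> M"
  shows "map_matrix ((*) c) (outer v) \<in> matrix_module M"
proof -
  \<comment> \<open>A matrix whose only nonzero row is \<open>v\<close>. The index
    \<open>undefined\<close> merely selects some row of the nonempty index type.\<close>
  define A :: "'a ^ 'n ^ 'n" where "A = (\<chi> r i. if r = undefined then v $ i else 0)"
  have "(\<Sum>r\<in>UNIV. A $ r $ i * A $ r $ j) = (\<Sum>(r::'n)\<in>UNIV. if r = undefined then v $ i * v $ j else 0)" for i j
    by (rule sum.cong) (simp_all add: A_def)
  then have "transpose A ** A = outer v"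
    by (simp add: vec_eq_iff matrix_matrix_mult_def transpose_def outer_def)
  then show ?thesis using matrix_module_add_single[OF matrix_module_zero assms, of A] by simp
qed

section \<open>Semidefinite real matrices\<close>

lemma transpose_eq_nth:
  assumes "transpose A = A"
  shows "A $ k $ l = A $ l $ k"
  using arg_cong[OF assms, of "\<lambda>M. M $ l $ k"] by (simp add: transpose_def)

lemma psd_row_zero:
  fixes A :: "real ^ 'n ^ 'n"
  assumes "psd A" "A $ i $ i = 0"
  shows "A $ i $ j = 0"
proof (cases "i = j")
  case False
  have sym: "A $ j $ i = A $ i $ j"
    using assms(1) by (intro transpose_eq_nth) (simp add: psd_def)
  have "0 \<le> 2 * t * A $ i $ j + A $ j $ j" for t
  proof -
    define w :: "real ^ 'n" where "w = t *\<^sub>R axis i 1 + axis j 1"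
    have "0 \<le> w \<bullet> (A *v w)" using assms(1) by (simp add: psd_def)
    also have "A *v w = t *\<^sub>R column i A + column j A"
      by (simp add: w_def matrix_vector_right_distrib matrix_vector_mult_scaleR matrix_vector_mult_basis)
    also have "w \<bullet> \<dots> = 2 * t * A $ i $ j + A $ j $ j"
      by (simp add: w_def inner_add_left inner_add_right inner_axis' column_def assms(2) sym algebra_simps)
    finally show ?thesis .
  qed
  \<comment> \<open>The form at \<open>w\<close> is affine in \<open>t\<close>. If
    \<open>A $ i $ j\<close> were nonzero, this value of \<open>t\<close> would make it
    \<open>- 1\<close>.\<close>
  then have pos: "0 \<le> 2 * (- (A $ j $ j + 1) / (2 * A $ i $ j)) * A $ i $ j + A $ j $ j" .
  show ?thesis
  proof (rule ccontr)
    assume "A $ i $ j \<noteq> 0"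
    then have "2 * (- (A $ j $ j + 1) / (2 * A $ i $ j)) * A $ i $ j = - (A $ j $ j + 1)" by simp
    with pos show False by linarith
  qed
qed (use assms in simp)

text \<open>The Schur complement of the entry \<open>f = A $ i $ i\<close>, multiplied by
  \<open>f^2\<close> to clear its denominator. Its form at \<open>v\<close> is the form of
  \<open>A\<close> at \<open>f *\<^sub>R v - a *\<^sub>R axis i 1\<close>, where \<open>a\<close> is
  entry \<open>i\<close> of \<open>A *v v\<close>.\<close>

lemma psd_schur_complement:
  fixes A :: "real ^ 'n ^ 'n"
  assumes "psd A"
  shows "psd (\<chi> k l. A $ i $ i * (A $ i $ i * A $ k $ l - A $ i $ k * A $ i $ l))" (is "psd ?S")
proof -
  have tr: "transpose A = A" using assms by (simp add: psd_def)
  have sym: "A $ k $ l = A $ l $ k" for k l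
    using tr by (rule transpose_eq_nth)
  have "0 \<le> v \<bullet> (?S *v v)" for v
  proof -
    define f where "f = A $ i $ i"
    define a where "a = (A *v v) $ i"
    define w where "w = f *\<^sub>R v - a *\<^sub>R axis i 1"
    have col: "v \<bullet> column i A = a"
      unfolding a_def matrix_vector_mult_def inner_vec_def column_def by (simp add: sym[of _ i] ac_simps)
    have "0 \<le> w \<bullet> (A *v w)" using assms by (simp add: psd_def)
    also have "A *v w = f *\<^sub>R (A *v v) - a *\<^sub>R column i A"
      by (simp add: w_def matrix_vector_mult_diff_distrib matrix_vector_mult_scaleR matrix_vector_mult_basis)
    also have "w \<bullet> \<dots> = f * (f * (v \<bullet> (A *v v)) - a * a)"
      by (simp add: w_def inner_diff_left inner_diff_right inner_axis' col a_def[symmetric])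
         (simp add: column_def f_def[symmetric] algebra_simps)
    also have "\<dots> = v \<bullet> (?S *v v)"
    proof -
      have "(?S *v v) $ k = f * (f * (A *v v) $ k - A $ i $ k * a)" for k
        unfolding matrix_vector_mult_def a_def f_def
        by (simp add: sum_distrib_left sum_subtractf[symmetric] algebra_simps)
      then have "?S *v v = f *\<^sub>R (f *\<^sub>R (A *v v) - a *\<^sub>R A $ i)"
        by (simp add: vec_eq_iff algebra_simps)
      moreover have "v \<bullet> (A $ i) = a"
        unfolding a_def matrix_vector_mult_def inner_vec_def by (simp add: ac_simps)
      ultimately show ?thesis by (simp add: inner_diff_right)
    qed
    finally show ?thesis .
  qed
  moreover have "transpose ?S = ?S"
    by (simp add: vec_eq_iff transpose_def) (metis sym mult.commute)
  ultimately show ?thesis by (simp add: psd_def)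
qed

section \<open>Symmetric elimination with squared polynomial denominators\<close>

definition denominator_in :: "('v::finite, real) mpoly set \<Rightarrow> ('v, real) mpoly ^ 'n ^ 'n \<Rightarrow> bool" where
  "denominator_in T F \<longleftrightarrow> (\<exists>b. b \<noteq> 0 \<and> map_matrix ((*) (b\<^sup>2)) F \<in> matrix_module T)"

context
  fixes G :: "('v::finite, real) mpoly set"
  assumes fin: "finite G"
begin

abbreviation "multiple_in \<equiv> denominator_in (ring_preordering hull G)"

lemma multiple_in_zero: "multiple_in (0 :: ('v, real) mpoly ^ 'n ^ 'n)"
proof -
  have "map_matrix ((*) (1\<^sup>2)) (0 :: ('v, real) mpoly ^ 'n ^ 'n) = 0"
    by (simp add: vec_eq_iff map_matrix_def)
  then show ?thesis using matrix_module_zero unfolding denominator_in_def by (intro exI[of _ 1]) simp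
qed

lemma multiple_in_add:
  assumes "multiple_in A" "multiple_in B"
  shows "multiple_in (A + B)"
proof -
  note T = ring_preordering_hullD[where G = G]
  obtain a b where a: "a \<noteq> 0" "map_matrix ((*) (a\<^sup>2)) A \<in> matrix_module (ring_preordering hull G)"
    and b: "b \<noteq> 0" "map_matrix ((*) (b\<^sup>2)) B \<in> matrix_module (ring_preordering hull G)"
    using assms unfolding denominator_in_def by blast
  have "map_matrix ((*) (b\<^sup>2)) (map_matrix ((*) (a\<^sup>2)) A) + map_matrix ((*) (a\<^sup>2)) (map_matrix ((*) (b\<^sup>2)) B)
      \<in> matrix_module (ring_preordering hull G)"
    by (intro matrix_module_add matrix_module_scale a b T)
  also have "map_matrix ((*) (b\<^sup>2)) (map_matrix ((*) (a\<^sup>2)) A) + map_matrix ((*) (a\<^sup>2)) (map_matrix ((*) (b\<^sup>2)) B)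
      = map_matrix ((*) ((a * b)\<^sup>2)) (A + B)"
    by (simp add: vec_eq_iff map_matrix_def power_mult_distrib algebra_simps)
  finally show ?thesis
    unfolding denominator_in_def using a(1) b(1) mpoly_mult_eq_0 by blast
qed

lemma multiple_in_sum: "(\<And>i. i \<in> I \<Longrightarrow> multiple_in (A i)) \<Longrightarrow> multiple_in (sum A I)"
  by (induction I rule: infinite_finite_induct) (simp_all add: multiple_in_zero multiple_in_add)

lemma multiple_in_cancel:
  assumes "multiple_in (map_matrix ((*) (c\<^sup>2)) A)" "c \<noteq> 0"
  shows "multiple_in A"
proof -
  obtain b where b: "b \<noteq> 0"
    "map_matrix ((*) (b\<^sup>2)) (map_matrix ((*) (c\<^sup>2)) A) \<in> matrix_module (ring_preordering hull G)"
    using assms(1) unfolding denominator_in_def by blast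
  have "map_matrix ((*) (b\<^sup>2)) (map_matrix ((*) (c\<^sup>2)) A) = map_matrix ((*) ((b * c)\<^sup>2)) A"
    by (simp add: vec_eq_iff map_matrix_def power_mult_distrib algebra_simps)
  then show ?thesis
    unfolding denominator_in_def using b assms(2) mpoly_mult_eq_0 by metis
qed

text \<open>The place where the scalar statement enters the elimination, through matrices of rank
  one.\<close>

lemma multiple_in_outer:
  assumes "\<And>x. x \<in> nonneg_set G \<Longrightarrow> 0 \<le> mpoly_eval x f"
  shows "multiple_in (map_matrix ((*) f) (outer v))"
proof -
  obtain c where c: "c \<noteq> 0" "c\<^sup>2 * f \<in> ring_preordering hull G"
    using nonneg_imp_multiple_in_preordering[OF fin assms] by blast
  have "map_matrix ((*) (c\<^sup>2)) (map_matrix ((*) f) (outer v)) = map_matrix ((*) (c\<^sup>2 * f)) (outer v)"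
    by (simp add: vec_eq_iff map_matrix_def algebra_simps)
  then show ?thesis
    unfolding denominator_in_def using c outer_in_matrix_module[OF c(2)] by metis
qed

text \<open>Polarization: the outer square of a sum of two unit vectors minus their separate outer
  squares, all scaled by \<open>f\<close>. Both \<open>f\<close> and \<open>- f\<close> are
  nonnegative on \<open>nonneg_set G\<close>, so each of the three terms is covered by the scalar
  statement.\<close>

lemma multiple_in_symmetric_unit:
  assumes "\<And>x. x \<in> nonneg_set G \<Longrightarrow> mpoly_eval x f = 0" "i \<noteq> j"
  shows "multiple_in (\<chi> k l. if k = i \<and> l = j \<or> k = j \<and> l = i then f else 0)"
proof -
  have f: "0 \<le> mpoly_eval x f" "0 \<le> mpoly_eval x (- f)" if "x \<in> nonneg_set G" for x
    using assms(1)[OF that] ring_mapD(5)[OF ring_map_mpoly_eval, of x f] by simp_all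
  have "(\<chi> k l. if k = i \<and> l = j \<or> k = j \<and> l = i then f else 0) =
      map_matrix ((*) f) (outer (axis i 1 + axis j 1)) +
      (map_matrix ((*) (- f)) (outer (axis i 1)) + map_matrix ((*) (- f)) (outer (axis j 1)))"
    using assms(2) by (auto simp: vec_eq_iff map_matrix_def outer_def axis_def)
  also have "multiple_in \<dots>"
    by (intro multiple_in_add multiple_in_outer f)
  finally show ?thesis .
qed

text \<open>Induction on a set of rows outside which the matrix vanishes. A nonzero pivot
  \<open>f\<close> splits \<open>f^2\<close> times the matrix into the Schur complement
  \<open>S\<close>, which is zero in row \<open>i\<close> and semidefinite on the set, and
  \<open>f\<close> times an outer square, where \<open>f\<close> is nonnegative as a diagonal
  entry.\<close>

lemma psd_imp_multiple_in:
  fixes F :: "('v, real) mpoly ^ 'n ^ 'n"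
  assumes "transpose F = F" "\<And>x. x \<in> nonneg_set G \<Longrightarrow> psd (matrix_eval x F)"
  shows "multiple_in F"
proof -
  note ev = ring_mapD[OF ring_map_mpoly_eval]
  have main: "multiple_in F" if "finite I" "\<And>k l. F $ k $ l = F $ l $ k" "\<And>k l. k \<notin> I \<Longrightarrow> F $ k $ l = 0"
    "\<And>x. x \<in> nonneg_set G \<Longrightarrow> psd (matrix_eval x F)" for I and F :: "('v, real) mpoly ^ 'n ^ 'n"
    using that
  proof (induction I arbitrary: F rule: finite_induct)
    case empty
    then have "F = 0" by (simp add: vec_eq_iff)
    then show ?case using multiple_in_zero by simp
  next
    case (insert i I)
    note sym = insert.prems(1) and supp = insert.prems(2) and psd = insert.prems(3)
    define f where "f = F $ i $ i"
    show ?case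
    proof (cases "f = 0")
      case True
      \<comment> \<open>If the diagonal entry is the zero polynomial, row \<open>i\<close> vanishes
        at every point of the set, but its entries may still be nonzero polynomials. They are split
        off in symmetric pairs.\<close>
      define F' where "F' = (\<chi> k l. if k = i \<or> l = i then 0 else F $ k $ l)"
      have zero: "mpoly_eval x (F $ i $ k) = 0" if "x \<in> nonneg_set G" for x k
        using psd_row_zero[OF psd[OF that], of i k] True by (simp add: matrix_eval_def map_matrix_def f_def ev(4))
      have "matrix_eval x F' = matrix_eval x F" if "x \<in> nonneg_set G" for x
      proof -
        have "mpoly_eval x (F $ k $ i) = 0" for k using zero[OF that, of k] sym[of k i] by simp
        then show ?thesis
          using zero[OF that] by (simp add: matrix_eval_def map_matrix_def F'_def vec_eq_iff ev(4))
      qed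
      moreover have "F' $ k $ l = F' $ l $ k" for k l using sym[of k l] by (simp add: F'_def)
      moreover have "F' $ k $ l = 0" if "k \<notin> I" for k l using supp[of k l] that by (simp add: F'_def)
      ultimately have mF': "multiple_in F'" using psd by (intro insert.IH) simp_all
      have mU: "multiple_in (\<Sum>j\<in>UNIV - {i}. \<chi> k l. if k = i \<and> l = j \<or> k = j \<and> l = i then F $ i $ j else 0)"
        by (intro multiple_in_sum multiple_in_symmetric_unit zero) auto
      have "F = F' + (\<Sum>j\<in>UNIV - {i}. \<chi> k l. if k = i \<and> l = j \<or> k = j \<and> l = i then F $ i $ j else 0)"
        (is "F = F' + ?U")
      proof -
        have U: "?U $ k $ l = (\<Sum>j\<in>UNIV - {i}. if k = i \<and> l = j \<or> k = j \<and> l = i then F $ i $ j else 0)" for k l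
          by (simp add: sum_component)
        have "F $ k $ l = F' $ k $ l + ?U $ k $ l" for k l
        proof (cases "(k = i) = (l = i)")
          case True
          then have "?U $ k $ l = 0" unfolding U by (intro sum.neutral ballI) (cases "k = i"; simp)
          then show ?thesis using True \<open>f = 0\<close> by (cases "k = i") (simp_all add: F'_def f_def)
        next
          case False
          define j where "j = (if k = i then l else k)"
          have "?U $ k $ l = (\<Sum>j'\<in>UNIV - {i}. if j' = j then F $ i $ j else 0)"
            unfolding U
          proof (rule sum.cong[OF refl])
            fix j' assume "j' \<in> UNIV - {i}"
            then show "(if k = i \<and> l = j' \<or> k = j' \<and> l = i then F $ i $ j' else 0) = (if j' = j then F $ i $ j else 0)"
              using False unfolding j_def by (cases "k = i") auto
          qed
          also have "\<dots> = F $ i $ j" using False by (auto simp: j_def)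
          also have "\<dots> = F $ k $ l" using False sym[of i k] by (auto simp: j_def)
          finally show ?thesis using False by (auto simp: F'_def)
        qed
        then show ?thesis by (simp add: vec_eq_iff)
      qed
      then show ?thesis using multiple_in_add[OF mF' mU] by (simp only:)
    next
      case False
      define S where "S = (\<chi> k l. f * (f * F $ k $ l - F $ i $ k * F $ i $ l))"
      have "matrix_eval x S = (\<chi> k l. matrix_eval x F $ i $ i * (matrix_eval x F $ i $ i * matrix_eval x F $ k $ l -
          matrix_eval x F $ i $ k * matrix_eval x F $ i $ l))" for x
        by (simp add: matrix_eval_def map_matrix_def S_def f_def vec_eq_iff ev(3,6))
      then have "psd (matrix_eval x S)" if "x \<in> nonneg_set G" for x
        using psd_schur_complement[OF psd[OF that], of i] by simp
      moreover have "S $ k $ l = S $ l $ k" for k l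
        using sym[of k l] by (simp add: S_def mult.commute)
      moreover have "S $ k $ l = 0" if "k \<notin> I" for k l
      proof (cases "k = i")
        case True
        then show ?thesis by (simp add: S_def f_def)
      next
        case False
        then have "F $ k $ l = 0" "F $ i $ k = 0" using supp[of k l] supp[of k i] that sym[of i k] by simp_all
        then show ?thesis by (simp add: S_def)
      qed
      ultimately have "multiple_in S" by (intro insert.IH)
      moreover have "multiple_in (map_matrix ((*) f) (outer (F $ i)))"
      proof (rule multiple_in_outer)
        fix x assume "x \<in> nonneg_set G"
        then have "0 \<le> axis i 1 \<bullet> (matrix_eval x F *v axis i 1)" using psd by (simp add: psd_def)
        also have "\<dots> = mpoly_eval x f"
          by (simp add: matrix_vector_mult_basis inner_axis' column_def matrix_eval_def map_matrix_def f_def)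
        finally show "0 \<le> mpoly_eval x f" .
      qed
      moreover have "map_matrix ((*) (f\<^sup>2)) F = S + map_matrix ((*) f) (outer (F $ i))"
        by (simp add: vec_eq_iff map_matrix_def S_def outer_def power2_eq_square algebra_simps)
      ultimately have "multiple_in (map_matrix ((*) (f\<^sup>2)) F)" by (simp add: multiple_in_add)
      then show ?thesis using False by (rule multiple_in_cancel)
    qed
  qed
  show ?thesis
    by (rule main[OF finite_class.finite_UNIV transpose_eq_nth[OF assms(1)] _ assms(2)]) simp_all
qed

end

lemma mat_mult_eq: "mat b ** A = map_matrix ((*) b) (A :: 'a::comm_ring_1 ^ 'n ^ 'm)"
  by (simp add: vec_eq_iff matrix_matrix_mult_def mat_def map_matrix_def if_distrib [of "\<lambda>x. x * y" for y]
      cong: if_cong)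

lemma mult_mat_eq: "A ** mat b = map_matrix ((*) b) (A :: 'a::comm_ring_1 ^ 'n ^ 'm)"
  by (simp add: vec_eq_iff matrix_matrix_mult_def mat_def map_matrix_def if_distrib mult.commute
      cong: if_cong)

theorem theorem6p3:
  fixes \<G> :: "(('d::finite, real) mpoly ^ 'n ^ 'n) set"
    and G :: "('d, real) mpoly set"
    and F :: "('d, real) mpoly ^ 'n ^ 'n"
  assumes "finite \<G>" and "\<G> \<subseteq> symmetric_matrices"
    and "finite G"
    and "matrix_nonneg_set \<G> = nonneg_set G"
    and "matrix_module (ring_preordering hull G) \<subseteq> matrix_preordering hull \<G>"
    and "F \<in> symmetric_matrices"
    and "compact (matrix_nonneg_set \<G>)"
    and "\<forall>x \<in> matrix_nonneg_set \<G>. psd (matrix_eval x F)"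
    and "\<forall>v::real^'n. v \<noteq> 0 \<longrightarrow>
           finite {p \<in> matrix_nonneg_set \<G>. mpoly_eval p (quadratic_form v F) = 0}"
    and "\<forall>v::real^'n. v \<noteq> 0 \<longrightarrow>
           (\<forall>p \<in> matrix_nonneg_set \<G>. mpoly_eval p (quadratic_form v F) = 0 \<longrightarrow>
             taylor p (quadratic_form v F) \<in> ring_preordering hull (taylor p ` G))"
  shows "(\<exists>X :: ('d, real) mpoly ^ 'n ^ 'n. X ** F ** transpose X \<in> matrix_module (ring_preordering hull G) \<and>
              matrix_module (ring_preordering hull G) \<subseteq> matrix_preordering hull \<G>) \<and>
         (\<exists>b :: ('d, real) mpoly. b \<noteq> 0 \<and>
              map_matrix ((*) (b\<^sup>2)) F \<in> matrix_module (ring_preordering hull G) \<and>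
              matrix_module (ring_preordering hull G) \<subseteq> matrix_preordering hull \<G>)"
proof -
  have "transpose F = F" using assms(6) by (simp add: symmetric_matrices_def)
  moreover have "psd (matrix_eval x F)" if "x \<in> nonneg_set G" for x
    using assms(4,8) that by simp
  ultimately have "denominator_in (ring_preordering hull G) F"
    by (rule psd_imp_multiple_in[OF assms(3)])
  then obtain b where b: "b \<noteq> 0" "map_matrix ((*) (b\<^sup>2)) F \<in> matrix_module (ring_preordering hull G)"
    unfolding denominator_in_def by blast
  have "mat b ** F ** transpose (mat b) = map_matrix ((*) (b\<^sup>2)) F"
    unfolding transpose_mat mat_mult_eq mult_mat_eq
    by (simp add: vec_eq_iff map_matrix_def power2_eq_square ac_simps)
  with b assms(5) show ?thesis by metis
qed

end
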